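(* Let $d,n,m\in\mathbb N$, $\sigma>0$, $L\in\mathbb N_0$, let $\Theta$ be a class of square-integrable (pointwise defined) functions $f\colon\mathbb S^d\to\mathbb R$, and let $\psi_1,\ldots,\psi_m\in L^2(\mathbb S^d)$ (not necessarily orthonormal or linearly independent) satisfy $S:=\operatorname{span}\{\psi_1,\ldots,\psi_m\}\subseteq\mathscr P^d_L$. Let $\mathcal X=\{x_1,\ldots,x_n\}\subset\mathbb S^d$ be a spherical $t$-design with $t\ge 2L$. Let $\mathcal F^d_n=\mathcal F^d_n(\Theta,\mathcal X)$ be the regression experiment, $\mathcal G^d_n=\mathcal G^d_n(\Theta)$ the Gaussian white noise experiment with drift $f$, and $\widetilde{\mathcal G}^d_n$ the Gaussian white noise experiment with drift $\tilde f_m$, all with parameter $f\in\Theta$, as defined in the context. Then $$\Delta(\mathcal F^d_n,\mathcal G^d_n)\le \Delta_1+\Delta_2,$$ where, with an absolute constant $C>0$, $$\Delta_1=\Delta(\mathcal F^d_n,\widetilde{\mathcal G}^d_n)\le 1-2\Phi\Big(-\frac{\sqrt n}{2\sigma}\sup_{f\in\Theta}\|f-\tilde f_m\|_n\Big)\le C\,\sigma^{-1}n^{1/2}\sup_{f\in\Theta}\|f-\tilde f_m\|_n$$ and $$\Delta_2=\Delta(\widetilde{\mathcal G}^d_n,\mathcal G^d_n)\le 1-2\Phi\Big(-\frac{\sqrt n}{2\sigma}\sup_{f\in\Theta}\|f-\tilde f_m\|_{L^2(\mathbb S^d)}\Big)\le C\,\sigma^{-1}n^{1/2}\sup_{f\in\Theta}\|f-\tilde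 f_m\|_{L^2(\mathbb S^d)}.$$
   Context: Sphere: $\mathbb S^d=\{x\in\mathbb R^{d+1}:\|x\|=1\}$ with normalized surface area measure $\mu$ (a probability measure); $L^2(\mathbb S^d)$ is the real $L^2$ space of $\mu$. $\mathscr P^d_L$ is the space of restrictions to $\mathbb S^d$ of real polynomials in $d+1$ variables of total degree $\le L$; equivalently the span of all spherical harmonics of degree $\le L$. A finite set $\{x_1,\ldots,x_n\}\subset\mathbb S^d$ of $n$ points is a spherical $t$-design if $\frac1n\sum_{i=1}^n p(x_i)=\int_{\mathbb S^d}p\,d\mu$ for all polynomials $p$ of total degree $\le t$ in $d+1$ variables. Empirical quantities: $\langle f,g\rangle_n=\frac1n\sum_{i=1}^n f(x_i)g(x_i)$, with semi-norm $\|f\|_n=\langle f,f\rangle_n^{1/2}$. The empirical approximation of $f$ is $\tilde f_m=\sum_{j=1}^m\langle f,\psi_j\rangle_n\,\psi_j$. (The $\psi_j$, being elements of $\mathscr P^d_L$, are evaluated pointwise as polynomials.) Experiments (parameter $f\in\Theta$; $\sigma$ known): $\mathcal F^d_n(\Theta,\mathcal X)$: observe $Z_i=f(x_i)+\sigma\epsilon_i$, $i=1,\ldots,n$, with $\epsilon_i$ i.i.d. standard Gaussian. $\mathcal G^d_n(\Theta)$: observe $dZ(x)=f(x)\,d\mu(x)+\frac{\sigma}{\sqrt n}\,dW(x)$, with $dW$ standard Gaussian white noise on $\mathbb S^d$; i.e. observe the Gaussian process $(G_g)_{g\in L^2(\mathbb S^d)}$ with mean $\langle f,g\rangle_{L^2(\mathbb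 S^d)}$ and covariance $\operatorname{Cov}(G_g,G_h)=\frac{\sigma^2}{n}\langle g,h\rangle_{L^2(\mathbb S^d)}$; equivalently, for an orthonormal basis $(\varphi_j)_{j\in\mathbb N}$ of $L^2(\mathbb S^d)$, observe the sequence $y_j=\langle f,\varphi_j\rangle+\frac{\sigma}{\sqrt n}\eta_j$, $j\in\mathbb N$, with $\eta_j$ i.i.d. standard Gaussian. $\widetilde{\mathcal G}^d_n$: the same with $f$ replaced by $\tilde f_m$ in the drift, i.e. $d\widetilde Z(x)=\tilde f_m(x)\,d\mu(x)+\frac{\sigma}{\sqrt n}\,dW(x)$ (still parametrized by $f\in\Theta$). Le Cam distance: for experiments $\mathcal E=(\mathsf X_{\mathcal E},\mathcal A_{\mathcal E},(P^{\mathcal E}_\theta)_{\theta\in\Theta})$ and $\mathcal E'=(\mathsf X_{\mathcal E'},\mathcal A_{\mathcal E'},(P^{\mathcal E'}_\theta)_{\theta\in\Theta})$ with the same parameter space, the deficiency is $\delta(\mathcal E,\mathcal E')=\inf_K\sup_{\theta\in\Theta}V(KP^{\mathcal E}_\theta,P^{\mathcal E'}_\theta)$, the infimum running over all Markov kernels $K$ from $(\mathsf X_{\mathcal E},\mathcal A_{\mathcal E})$ to $(\mathsf X_{\mathcal E'},\mathcal A_{\mathcal E'})$, $KP(A)=\int K(x,A)\,dP(x)$, and $V(P,Q)=\sup_A|P(A)-Q(A)|$ the total variation distance. $\Delta(\mathcal E,\mathcal E')=\max\{\delta(\mathcal E,\mathcal E'),\delta(\mathcal E',\mathcal E)\}$.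 $\Phi$ is the standard Gaussian distribution function, with $\Phi(-\infty)=0$. *)

theory Defs
  imports "HOL-Probability.Probability"
begin

section \<open>The sphere and its normalized surface measure\<close>

text \<open>
  The dimension \<open>d\<close> has to be an ordinary variable, because the constant in the main statement
  must not depend on it. Points of (d+1)-dimensional space are therefore functions
  in \<open>{..d} \<rightarrow>\<^sub>E UNIV\<close> (coordinates 0, ..., d), and \<open>L2_set x {..d}\<close> is the Euclidean norm.
\<close>

definition euclid :: "nat \<Rightarrow> (nat \<Rightarrow> real) measure" where
  "euclid d = (\<Pi>\<^sub>M i\<in>{..d}. lborel)"

definition unit_sphere :: "nat \<Rightarrow> (nat \<Rightarrow> real) set" where
  "unit_sphere d = {x \<in> {..d} \<rightarrow>\<^sub>E UNIV. L2_set x {..d} = 1}"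

definition punctured_ball :: "nat \<Rightarrow> (nat \<Rightarrow> real) set" where
  "punctured_ball d = {x \<in> {..d} \<rightarrow>\<^sub>E UNIV. 0 < L2_set x {..d} \<and> L2_set x {..d} \<le> 1}"

text \<open>
  Surface measure is obtained from Lebesgue measure by polar coordinates: the normalized surface
  measure of \<open>A\<close> is the relative volume, in the unit ball, of the cone \<open>{r x | 0 < r \<le> 1, x \<in> A}\<close>.
  Equivalently, it is the law of \<open>x / \<parallel>x\<parallel>\<close> for \<open>x\<close> uniform in the unit ball without the origin.
\<close>

definition sphere_measure :: "nat \<Rightarrow> (nat \<Rightarrow> real) measure" where
  "sphere_measure d =
     distr (uniform_measure (restrict_space (euclid d) (punctured_ball d)) (punctured_ball d))
       (restrict_space (\<Pi>\<^sub>M i\<in>{..d}. borel) (unit_sphere d))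
       (\<lambda>x. \<lambda>i\<in>{..d}. x i / L2_set x {..d})"

lemma space_sphere_measure: "space (sphere_measure d) = unit_sphere d"
  by (auto simp: sphere_measure_def space_restrict_space unit_sphere_def space_PiM)

lemma L2_set_measurable [measurable]:
  "(\<lambda>x. L2_set x {..d}) \<in> borel_measurable (\<Pi>\<^sub>M i\<in>{..d}. lborel)"
  unfolding L2_set_def by measurable

lemma punctured_ball_sets [measurable]: "punctured_ball d \<in> sets (euclid d)"
proof -
  have "punctured_ball d =
      {x \<in> space (\<Pi>\<^sub>M i\<in>{..d}. lborel). 0 < L2_set x {..d} \<and> L2_set x {..d} \<le> 1}"
    by (simp add: punctured_ball_def space_PiM)
  also have "\<dots> \<in> sets (\<Pi>\<^sub>M i\<in>{..d}. lborel)" by measurable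
  finally show ?thesis by (simp add: euclid_def)
qed

lemma emeasure_punctured_ball:
  "emeasure (euclid d) (punctured_ball d) \<noteq> 0" "emeasure (euclid d) (punctured_ball d) \<noteq> \<infinity>"
proof -
  interpret product_sigma_finite "\<lambda>_::nat. lborel :: real measure" ..
  define a where "a = 1 / (real d + 1)"
  have a: "0 < a" by (simp add: a_def)
  let ?Q = "PiE {..d} (\<lambda>_. {0<..<a})" and ?R = "PiE {..d} (\<lambda>_. {-1..1::real})"
  have Q: "emeasure (euclid d) ?Q = (\<Prod>i\<in>{..d}. ennreal a)"
    using a by (simp add: euclid_def emeasure_PiM)
  have R: "emeasure (euclid d) ?R = (\<Prod>i\<in>{..d}. 2)"
    by (simp add: euclid_def emeasure_PiM)
  have mR: "?R \<in> sets (euclid d)" by (simp add: euclid_def sets_PiM_I_finite)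
  have "?Q \<subseteq> punctured_ball d"
  proof
    fix x assume x: "x \<in> ?Q"
    then have pos: "0 < x i" "x i < a" if "i \<le> d" for i using that by (auto simp: PiE_def Pi_def)
    have "L2_set x {..d} \<le> (\<Sum>i\<in>{..d}. \<bar>x i\<bar>)" by (rule L2_set_le_sum_abs)
    also have "\<dots> \<le> (\<Sum>i\<in>{..d}. a)" using pos by (intro sum_mono) (auto simp: less_imp_le abs_of_pos)
    also have "\<dots> = 1" by (simp add: a_def field_simps)
    finally have "L2_set x {..d} \<le> 1" .
    moreover have "\<bar>x 0\<bar> \<le> L2_set x {..d}"
      using member_le_L2_set[of "{..d}" 0 "\<lambda>i. \<bar>x i\<bar>"] by (simp add: L2_set_def)
    ultimately show "x \<in> punctured_ball d" using pos[of 0] x by (auto simp: punctured_ball_def)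
  qed
  then have "emeasure (euclid d) ?Q \<le> emeasure (euclid d) (punctured_ball d)"
    by (intro emeasure_mono) auto
  moreover have "emeasure (euclid d) ?Q \<noteq> 0" using a by (simp add: Q)
  ultimately show "emeasure (euclid d) (punctured_ball d) \<noteq> 0" by auto
  have "punctured_ball d \<subseteq> ?R"
  proof
    fix x assume x: "x \<in> punctured_ball d"
    have "\<bar>x i\<bar> \<le> 1" if "i \<le> d" for i
    proof -
      have "\<bar>x i\<bar> \<le> L2_set x {..d}"
        using member_le_L2_set[of "{..d}" i "\<lambda>i. \<bar>x i\<bar>"] that by (simp add: L2_set_def)
      then show ?thesis using x by (simp add: punctured_ball_def)
    qed
    then have "x i \<in> {-1..1}" if "i \<le> d" for i using that by (auto simp: abs_le_iff)
    with x show "x \<in> ?R" by (auto simp: punctured_ball_def PiE_iff)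
  qed
  then have "emeasure (euclid d) (punctured_ball d) \<le> emeasure (euclid d) ?R"
    using mR by (rule emeasure_mono)
  also have "\<dots> < \<infinity>" unfolding R by (simp add: less_top[symmetric] ennreal_mult_eq_top_iff power_eq_top_ennreal)
  finally show "emeasure (euclid d) (punctured_ball d) \<noteq> \<infinity>" by simp
qed

lemma prob_space_sphere_measure: "prob_space (sphere_measure d)"
proof -
  let ?B = "restrict_space (euclid d) (punctured_ball d)"
  have sp: "space (euclid d) = {..d} \<rightarrow>\<^sub>E UNIV" by (simp add: euclid_def space_PiM)
  have "prob_space (uniform_measure ?B (punctured_ball d))"
    using emeasure_punctured_ball[of d]
    by (intro prob_space_uniform_measure) (auto simp: emeasure_restrict_space)
  moreover have "(\<lambda>x. \<lambda>i\<in>{..d}. x i / L2_set x {..d}) \<in>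
      ?B \<rightarrow>\<^sub>M restrict_space (\<Pi>\<^sub>M i\<in>{..d}. borel) (unit_sphere d)"
  proof (rule measurable_restrict_space2)
    show "(\<lambda>x. \<lambda>i\<in>{..d}. x i / L2_set x {..d}) \<in> space ?B \<rightarrow> unit_sphere d"
    proof
      fix x assume "x \<in> space ?B"
      then have p: "0 < L2_set x {..d}" by (auto simp: space_restrict_space punctured_ball_def)
      have "L2_set (\<lambda>i\<in>{..d}. x i / L2_set x {..d}) {..d} =
          L2_set (\<lambda>i. inverse (L2_set x {..d}) * x i) {..d}"
        by (intro L2_set_cong) (auto simp: field_simps)
      also have "\<dots> = inverse (L2_set x {..d}) * L2_set x {..d}"
        using p by (intro L2_set_right_distrib[symmetric]) auto
      finally show "(\<lambda>i\<in>{..d}. x i / L2_set x {..d}) \<in> unit_sphere d"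
        using p by (auto simp: unit_sphere_def)
    qed
    have "(\<lambda>x. \<lambda>i\<in>{..d}. x i / L2_set x {..d}) \<in>
        (\<Pi>\<^sub>M i\<in>{..d}. lborel) \<rightarrow>\<^sub>M (\<Pi>\<^sub>M i\<in>{..d}. borel)"
      by measurable
    then show "(\<lambda>x. \<lambda>i\<in>{..d}. x i / L2_set x {..d}) \<in> ?B \<rightarrow>\<^sub>M (\<Pi>\<^sub>M i\<in>{..d}. borel)"
      unfolding euclid_def by (rule measurable_restrict_space1)
  qed
  ultimately show ?thesis
    unfolding sphere_measure_def by (intro prob_space.prob_space_distr) simp_all
qed

text \<open>
  Real functions on the sphere are functions on the ambient type; only their values on
  \<open>unit_sphere d\<close> matter. Elements of \<open>L2_sphere d\<close> are genuine functions, not equivalence classes.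
\<close>

definition L2_sphere :: "nat \<Rightarrow> ((nat \<Rightarrow> real) \<Rightarrow> real) set" where
  "L2_sphere d = {f \<in> borel_measurable (sphere_measure d).
                    integrable (sphere_measure d) (\<lambda>x. (f x)\<^sup>2)}"

definition L2_inner :: "nat \<Rightarrow> ((nat \<Rightarrow> real) \<Rightarrow> real) \<Rightarrow> ((nat \<Rightarrow> real) \<Rightarrow> real) \<Rightarrow> real" where
  "L2_inner d f g = (\<integral>x. f x * g x \<partial>sphere_measure d)"

definition L2_norm :: "nat \<Rightarrow> ((nat \<Rightarrow> real) \<Rightarrow> real) \<Rightarrow> real" where
  "L2_norm d f = sqrt (L2_inner d f f)"

section \<open>Polynomials and spherical designs\<close>

definition multi_indices :: "nat \<Rightarrow> nat \<Rightarrow> (nat \<Rightarrow> nat) set" where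
  "multi_indices d L = {\<alpha> \<in> {..d} \<rightarrow>\<^sub>E UNIV. (\<Sum>i\<le>d. \<alpha> i) \<le> L}"

lemma finite_multi_indices: "finite (multi_indices d L)"
proof (rule finite_subset)
  show "multi_indices d L \<subseteq> {..d} \<rightarrow>\<^sub>E {..L}"
  proof
    fix \<alpha> assume \<alpha>: "\<alpha> \<in> multi_indices d L"
    have "\<alpha> i \<le> L" if "i \<le> d" for i
      using member_le_sum[of i "{..d}" \<alpha>] that \<alpha> by (auto simp: multi_indices_def)
    with \<alpha> show "\<alpha> \<in> {..d} \<rightarrow>\<^sub>E {..L}" by (auto simp: multi_indices_def PiE_iff)
  qed
qed (simp add: finite_PiE)

text \<open>Polynomial functions in d+1 variables of total degree at most \<open>L\<close>.\<close>

definition polynomials :: "nat \<Rightarrow> nat \<Rightarrow> ((nat \<Rightarrow> real) \<Rightarrow> real) set" where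
  "polynomials d L =
     {\<lambda>x. \<Sum>\<alpha>\<in>multi_indices d L. c \<alpha> * (\<Prod>i\<le>d. x i ^ \<alpha> i) | c. True}"

definition sphere_polynomials :: "nat \<Rightarrow> nat \<Rightarrow> ((nat \<Rightarrow> real) \<Rightarrow> real) set" where
  "sphere_polynomials d L = {g. \<exists>p\<in>polynomials d L. \<forall>x\<in>unit_sphere d. g x = p x}"

definition linear_span :: "nat \<Rightarrow> (nat \<Rightarrow> 'a \<Rightarrow> real) \<Rightarrow> ('a \<Rightarrow> real) set" where
  "linear_span m \<psi> = {\<lambda>x. \<Sum>j=1..m. c j * \<psi> j x | c. True}"

definition spherical_design :: "nat \<Rightarrow> nat \<Rightarrow> nat \<Rightarrow> (nat \<Rightarrow> nat \<Rightarrow> real) \<Rightarrow> bool" where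
  "spherical_design d t n x \<longleftrightarrow>
     inj_on x {1..n} \<and> x ` {1..n} \<subseteq> unit_sphere d \<and>
     (\<forall>p\<in>polynomials d t. (\<Sum>i=1..n. p (x i)) / real n = (\<integral>y. p y \<partial>sphere_measure d))"

section \<open>Empirical quantities\<close>

definition emp_inner :: "nat \<Rightarrow> (nat \<Rightarrow> 'a) \<Rightarrow> ('a \<Rightarrow> real) \<Rightarrow> ('a \<Rightarrow> real) \<Rightarrow> real" where
  "emp_inner n x f g = (\<Sum>i=1..n. f (x i) * g (x i)) / real n"

definition emp_norm :: "nat \<Rightarrow> (nat \<Rightarrow> 'a) \<Rightarrow> ('a \<Rightarrow> real) \<Rightarrow> real" where
  "emp_norm n x f = sqrt (emp_inner n x f f)"

definition emp_approx ::
    "nat \<Rightarrow> (nat \<Rightarrow> 'a) \<Rightarrow> nat \<Rightarrow> (nat \<Rightarrow> 'a \<Rightarrow> real) \<Rightarrow> ('a \<Rightarrow> real) \<Rightarrow> 'a \<Rightarrow> real" where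
  "emp_approx n x m \<psi> f = (\<lambda>y. \<Sum>j=1..m. emp_inner n x f (\<psi> j) * \<psi> j y)"

section \<open>Statistical experiments and the Le Cam distance\<close>

text \<open>
  An experiment is a sample space (a measure of which only the space and the sigma-algebra are
  used) together with the family of laws on it. The parameter space is a separate argument
  \<open>\<Theta>\<close>, common to both experiments. Suprema are taken in \<open>ennreal\<close>: they may be infinite, and the
  supremum over an empty parameter space is 0.
\<close>

type_synonym ('p, 'x) stat_experiment = "'x measure \<times> ('p \<Rightarrow> 'x measure)"

definition total_variation :: "'x measure \<Rightarrow> 'x measure \<Rightarrow> ennreal" where
  "total_variation P Q = (SUP A\<in>sets P. ennreal \<bar>measure P A - measure Q A\<bar>)"

definition deficiency :: "'p set \<Rightarrow> ('p, 'x) stat_experiment \<Rightarrow> ('p, 'y) stat_experiment \<Rightarrow> ennreal" where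
  "deficiency \<Theta> E E' =
     (INF K \<in> fst E \<rightarrow>\<^sub>M prob_algebra (fst E').
        SUP \<theta>\<in>\<Theta>. total_variation (snd E \<theta> \<bind> K) (snd E' \<theta>))"

definition le_cam :: "'p set \<Rightarrow> ('p, 'x) stat_experiment \<Rightarrow> ('p, 'y) stat_experiment \<Rightarrow> ennreal" where
  "le_cam \<Theta> E E' = max (deficiency \<Theta> E E') (deficiency \<Theta> E' E)"

section \<open>Gaussian processes and the experiments\<close>

text \<open>The standard Gaussian distribution function on the extended reals, so \<open>Phi (-\<infinity>) = 0\<close>.\<close>

definition Phi :: "ereal \<Rightarrow> real" where
  "Phi u = measure std_normal_distribution {y. ereal y \<le> u}"

text \<open>
  The (possibly degenerate) multivariate Gaussian law with mean vector \<open>\<mu>\<close> and covariance matrix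
  \<open>C\<close>: the law of \<open>\<mu> + A \<eta>\<close>, where \<open>\<eta>\<close> is a vector of independent standard Gaussians and
  \<open>A\<close> times its transpose is \<open>C\<close>.
\<close>

definition multivariate_normal ::
    "'i set \<Rightarrow> ('i \<Rightarrow> real) \<Rightarrow> ('i \<Rightarrow> 'i \<Rightarrow> real) \<Rightarrow> ('i \<Rightarrow> real) measure \<Rightarrow> bool" where
  "multivariate_normal I \<mu> C M \<longleftrightarrow>
     (\<exists>(r::nat) A. (\<forall>i\<in>I. \<forall>j\<in>I. C i j = (\<Sum>l<r. A i l * A j l)) \<and>
        M = distr (\<Pi>\<^sub>M l\<in>{..<r}. std_normal_distribution) (\<Pi>\<^sub>M i\<in>I. borel)
              (\<lambda>\<eta>. \<lambda>i\<in>I. \<mu> i + (\<Sum>l<r. A i l * \<eta> l)))"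

definition gaussian_process ::
    "'i set \<Rightarrow> ('i \<Rightarrow> real) \<Rightarrow> ('i \<Rightarrow> 'i \<Rightarrow> real) \<Rightarrow> ('i \<Rightarrow> real) measure \<Rightarrow> bool" where
  "gaussian_process I \<mu> C M \<longleftrightarrow>
     prob_space M \<and> sets M = sets (\<Pi>\<^sub>M i\<in>I. borel) \<and>
     (\<forall>J. finite J \<and> J \<subseteq> I \<longrightarrow>
        multivariate_normal J \<mu> C (distr M (\<Pi>\<^sub>M i\<in>J. borel) (\<lambda>\<omega>. restrict \<omega> J)))"

text \<open>
  White noise with drift \<open>h\<close> and noise level \<open>\<tau>\<close>, i.e. \<open>h d\<mu> + \<tau> dW\<close>, is the law of the Gaussian
  process indexed by the square-integrable functions with the mean and covariance below. These
  determine the law uniquely.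
\<close>

definition white_noise_space :: "nat \<Rightarrow> (((nat \<Rightarrow> real) \<Rightarrow> real) \<Rightarrow> real) measure" where
  "white_noise_space d = (\<Pi>\<^sub>M g\<in>L2_sphere d. borel)"

definition white_noise_law ::
    "nat \<Rightarrow> real \<Rightarrow> ((nat \<Rightarrow> real) \<Rightarrow> real) \<Rightarrow> (((nat \<Rightarrow> real) \<Rightarrow> real) \<Rightarrow> real) measure \<Rightarrow> bool" where
  "white_noise_law d \<tau> h M \<longleftrightarrow>
     gaussian_process (L2_sphere d) (\<lambda>g. L2_inner d h g) (\<lambda>g g'. \<tau>\<^sup>2 * L2_inner d g g') M"

text \<open>
  \<open>E\<close> is the white noise experiment with noise level \<open>\<tau>\<close> in which the parameter \<open>\<theta> \<in> \<Theta>\<close> has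
  drift \<open>D \<theta>\<close>; laws at parameters outside \<open>\<Theta>\<close> play no role.
\<close>

definition white_noise_experiment ::
    "nat \<Rightarrow> real \<Rightarrow> 'p set \<Rightarrow> ('p \<Rightarrow> (nat \<Rightarrow> real) \<Rightarrow> real) \<Rightarrow>
     ('p, ((nat \<Rightarrow> real) \<Rightarrow> real) \<Rightarrow> real) stat_experiment \<Rightarrow> bool" where
  "white_noise_experiment d \<tau> \<Theta> D E \<longleftrightarrow>
     fst E = white_noise_space d \<and> (\<forall>\<theta>\<in>\<Theta>. white_noise_law d \<tau> (D \<theta>) (snd E \<theta>))"

definition regression_experiment ::
    "nat \<Rightarrow> (nat \<Rightarrow> 'a) \<Rightarrow> real \<Rightarrow> ('a \<Rightarrow> real, nat \<Rightarrow> real) stat_experiment" where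
  "regression_experiment n x \<sigma> =
     (\<Pi>\<^sub>M i\<in>{1..n}. borel,
      \<lambda>f. distr (\<Pi>\<^sub>M i\<in>{1..n}. std_normal_distribution) (\<Pi>\<^sub>M i\<in>{1..n}. borel)
            (\<lambda>\<epsilon>. \<lambda>i\<in>{1..n}. f (x i) + \<sigma> * \<epsilon> i))"

end

theory Submission
  imports Defs
begin

text \<open>
  Let \<open>e k\<close> be an \<open>L2\<close>-orthonormal basis of the span of the \<open>\<psi> j\<close>. Since products of two elements of
  the span have degree at most \<open>2 * L \<le> t\<close>, the design makes the \<open>e k\<close> orthonormal for the empirical
  inner product as well. For a drift in the span, the empirical coefficients of the regression data
  and the coordinates of the white noise along the \<open>e k\<close> are therefore Gaussian vectors with the same
  law, and either observation can be turned into the other by resampling its noise orthogonal to the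
  \<open>e k\<close>: regression and white noise with drift in the span are equivalent. What remains are total
  variation distances between Gaussian laws that differ only in their drift. These, too, are
  randomizations of the one-dimensional laws \<open>N(0, 1)\<close> and \<open>N(\<delta>, 1)\<close>, with \<open>\<delta>\<close> the norm of
  the difference of the drifts divided by the noise level, whose distance is \<open>1 - 2 \<Phi>(- \<delta> / 2)\<close>.
\<close>

section \<open>Characteristic functionals determine joint laws\<close>

text \<open>White noise is given only through its finite-dimensional laws, on a product over the
  uncountable set \<open>L2_sphere d\<close>, so laws are compared through characteristic
  functionals rather than densities. Every randomization has the same shape, a linear map of the
  data plus independent noise, and its output is identified by uniqueness of the Gaussian law with
  given mean and covariance. The law of the resampled noise is free of the drift, so one kernel
  serves all parameters at once. That noise is obtained by removing the components along the
  \<open>e k\<close> from a law already at hand; for white noise this law is borrowed from the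
  experiment, and an empty \<Theta> is treated apart.

  Elements of \<open>L2_sphere d\<close> are genuine functions, so an L2 expansion in the
  \<open>e k\<close> says nothing about values at single points. The design rescues the values at
  its own points: an element of the span with zero L2 norm also has zero empirical norm.

  The constant C = 1 comes from the bound 1/2 on the Gaussian density, with a factor 2 to
  spare.\<close>

lemma borel_measurable_cis [measurable (raw)]:
  "f \<in> borel_measurable M \<Longrightarrow> (\<lambda>x. cis (f x)) \<in> borel_measurable M"
  unfolding cis_conv_exp by measurable

lemma borel_measurable_cnj [measurable (raw)]:
  "f \<in> borel_measurable M \<Longrightarrow> (\<lambda>x. cnj (f x)) \<in> borel_measurable M"
  by (rule borel_measurable_continuous_on[OF continuous_on_cnj[OF continuous_on_id]])

lemma char_conv_cis: "char M t = (\<integral>x. cis (t * x) \<partial>M)"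
  by (simp add: char_def cis_conv_exp)

lemma (in prob_space) integrable_bounded_by:
  fixes f :: "'a \<Rightarrow> 'b::{banach, second_countable_topology}"
  assumes "f \<in> borel_measurable M" "\<And>x. x \<in> space M \<Longrightarrow> norm (f x) \<le> B"
  shows "integrable M f"
  using assms by (intro integrable_const_bound[of _ B] AE_I2) auto

text \<open>The weights are kept away from zero so that the weighted law can be normalized.\<close>

lemma weighted_law:
  fixes X :: "'a \<Rightarrow> real"
  assumes "prob_space M"
    and [measurable]: "X \<in> borel_measurable M" "w \<in> borel_measurable M"
    and w: "\<And>x. 1 \<le> w x" "\<And>x. w x \<le> (3::real)"
  obtains N where "real_distribution N"
    "1 \<le> (\<integral>x. w x \<partial>M)"
    "\<And>s. char N s = (\<integral>x. cis (s * X x) * w x \<partial>M) / (\<integral>x. w x \<partial>M)"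
    "\<And>B. B \<in> sets borel \<Longrightarrow>
       measure N B = (\<integral>x. indicator B (X x) * w x \<partial>M) / (\<integral>x. w x \<partial>M)"
proof -
  interpret M: prob_space M by fact
  have w0: "0 \<le> w x" for x using w(1)[of x] by simp
  have int: "integrable M w"
    using w w0 by (intro M.integrable_bounded_by[where B=3]) auto
  define c where "c = (\<integral>x. w x \<partial>M)"
  have "(\<integral>x. 1 \<partial>M) \<le> c"
    unfolding c_def using w int by (intro integral_mono) auto
  then have c: "1 \<le> c" by (simp add: M.prob_space)
  have pos: "0 \<le> w x / c" for x using w0 c by simp
  let ?D = "density M (\<lambda>x. ennreal (w x / c))"
  let ?N = "distr ?D borel X"
  have "emeasure ?D (space M) = (\<integral>\<^sup>+x. ennreal (w x / c) \<partial>M)"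
    by (subst emeasure_density) (auto intro!: nn_integral_cong)
  also have "\<dots> = ennreal (\<integral>x. w x / c \<partial>M)"
    using int pos by (intro nn_integral_eq_integral) auto
  also have "\<dots> = 1" using c by (simp add: c_def)
  finally have "prob_space ?D" by (intro prob_spaceI) simp
  then have "prob_space ?N" by (intro prob_space.prob_space_distr) auto
  then have "real_distribution ?N"
    by (auto simp: real_distribution_def real_distribution_axioms_def)
  moreover have "char ?N s = (\<integral>x. cis (s * X x) * w x \<partial>M) / c" for s
  proof -
    have "char ?N s = (\<integral>x. cis (s * X x) \<partial>?D)"
      unfolding char_conv_cis by (subst integral_distr) auto
    also have "\<dots> = (\<integral>x. (w x / c) *\<^sub>R cis (s * X x) \<partial>M)"
      using pos by (subst integral_density) auto
    also have "\<dots> = (\<integral>x. cis (s * X x) * w x / c \<partial>M)"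
      by (intro Bochner_Integration.integral_cong) (auto simp: scaleR_conv_of_real field_simps)
    finally show ?thesis by simp
  qed
  moreover have "measure ?N B = (\<integral>x. indicator B (X x) * w x \<partial>M) / c"
    if [measurable]: "B \<in> sets borel" for B
  proof -
    have "measure ?N B = (\<integral>x. indicator B x \<partial>?N)" by simp
    also have "\<dots> = (\<integral>x. indicator B (X x) \<partial>?D)"
      by (subst integral_distr) auto
    also have "\<dots> = (\<integral>x. (w x / c) *\<^sub>R indicator B (X x) \<partial>M)"
      using pos by (subst integral_density) auto
    also have "\<dots> = (\<integral>x. indicator B (X x) * w x / c \<partial>M)"
      by (intro Bochner_Integration.integral_cong) (auto simp: field_simps)
    finally show ?thesis by simp
  qed
  ultimately show ?thesis using c by (intro that[of ?N]) (auto simp: c_def)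
qed

text \<open>At \<open>s = 0\<close> the hypothesis equates the total masses of the weights. The
  normalized weighted laws of \<open>X1\<close> and \<open>X2\<close> then have the same
  characteristic function, and Levy's uniqueness theorem applies.\<close>

lemma weighted_char_unique_pos:
  fixes X1 :: "'a \<Rightarrow> real" and X2 :: "'b \<Rightarrow> real"
  assumes "prob_space M1" "prob_space M2"
    and "X1 \<in> borel_measurable M1" "X2 \<in> borel_measurable M2"
      "w1 \<in> borel_measurable M1" "w2 \<in> borel_measurable M2"
    and "\<And>x. 1 \<le> w1 x" "\<And>x. w1 x \<le> (3::real)"
    and "\<And>x. 1 \<le> w2 x" "\<And>x. w2 x \<le> (3::real)"
    and eq: "\<And>s. (\<integral>x. cis (s * X1 x) * w1 x \<partial>M1) = (\<integral>x. cis (s * X2 x) * w2 x \<partial>M2)"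
    and "B \<in> sets borel"
  shows "(\<integral>x. indicator B (X1 x) * w1 x \<partial>M1) = (\<integral>x. indicator B (X2 x) * w2 x \<partial>M2)"
proof -
  obtain N1 where N1: "real_distribution N1" "1 \<le> (\<integral>x. w1 x \<partial>M1)"
    "\<And>s. char N1 s = (\<integral>x. cis (s * X1 x) * w1 x \<partial>M1) / (\<integral>x. w1 x \<partial>M1)"
    "measure N1 B = (\<integral>x. indicator B (X1 x) * w1 x \<partial>M1) / (\<integral>x. w1 x \<partial>M1)"
    by (rule weighted_law[of M1 X1 w1]) (use assms in auto)
  obtain N2 where N2: "real_distribution N2" "1 \<le> (\<integral>x. w2 x \<partial>M2)"
    "\<And>s. char N2 s = (\<integral>x. cis (s * X2 x) * w2 x \<partial>M2) / (\<integral>x. w2 x \<partial>M2)"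
    "measure N2 B = (\<integral>x. indicator B (X2 x) * w2 x \<partial>M2) / (\<integral>x. w2 x \<partial>M2)"
    by (rule weighted_law[of M2 X2 w2]) (use assms in auto)
  have "complex_of_real (\<integral>x. w1 x \<partial>M1) = complex_of_real (\<integral>x. w2 x \<partial>M2)"
    using eq[of 0] by simp
  then have c: "(\<integral>x. w1 x \<partial>M1) = (\<integral>x. w2 x \<partial>M2)" by simp
  have "char N1 = char N2" using N1(3) N2(3) c eq by (intro ext) simp
  then have "N1 = N2" using N1 N2 by (intro Levy_uniqueness)
  then show ?thesis using N1 N2 c by (simp add: field_simps)
qed

text \<open>Adding 2 to a weight bounded by 1 in absolute value puts it into [1, 3], where the
  positive case applies. The positive case for the constant weight 2 is then subtracted.\<close>

lemma weighted_char_unique_real: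
  fixes X1 :: "'a \<Rightarrow> real" and X2 :: "'b \<Rightarrow> real"
  assumes "prob_space M1" "prob_space M2"
    and [measurable]: "X1 \<in> borel_measurable M1" "X2 \<in> borel_measurable M2"
      "u1 \<in> borel_measurable M1" "u2 \<in> borel_measurable M2"
    and u: "\<And>x. \<bar>u1 x\<bar> \<le> (1::real)" "\<And>x. \<bar>u2 x\<bar> \<le> (1::real)"
    and eq0: "\<And>s. (\<integral>x. cis (s * X1 x) \<partial>M1) = (\<integral>x. cis (s * X2 x) \<partial>M2)"
    and eq: "\<And>s. (\<integral>x. cis (s * X1 x) * u1 x \<partial>M1) = (\<integral>x. cis (s * X2 x) * u2 x \<partial>M2)"
    and [measurable]: "B \<in> sets borel"
  shows "(\<integral>x. indicator B (X1 x) * u1 x \<partial>M1) = (\<integral>x. indicator B (X2 x) * u2 x \<partial>M2)"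
proof -
  interpret M1: prob_space M1 by fact
  interpret M2: prob_space M2 by fact
  have [simp]: "integrable M1 (\<lambda>x. cis (s * X1 x))" "integrable M1 (\<lambda>x. cis (s * X1 x) * u1 x)"
     "integrable M2 (\<lambda>x. cis (s * X2 x))" "integrable M2 (\<lambda>x. cis (s * X2 x) * u2 x)"
     "integrable M1 (\<lambda>x. indicator B (X1 x) * u1 x)" "integrable M1 (\<lambda>x. indicat_real B (X1 x))"
     "integrable M2 (\<lambda>x. indicator B (X2 x) * u2 x)" "integrable M2 (\<lambda>x. indicat_real B (X2 x))" for s
    using u by (auto intro!: M1.integrable_bounded_by[where B=1] M2.integrable_bounded_by[where B=1]
        simp: norm_mult indicator_def)
  have b: "1 \<le> 2 + u1 x" "2 + u1 x \<le> 3" for x using u(1)[of x] by (auto simp: abs_le_iff)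
  have b': "1 \<le> 2 + u2 x" "2 + u2 x \<le> 3" for x using u(2)[of x] by (auto simp: abs_le_iff)
  have *: "(\<integral>x. indicator B (X1 x) * (2 + u1 x) \<partial>M1) = (\<integral>x. indicator B (X2 x) * (2 + u2 x) \<partial>M2)"
    using assms b b'
    by (intro weighted_char_unique_pos) (auto simp: distrib_left)
  have **: "(\<integral>x. indicator B (X1 x) * (2::real) \<partial>M1) = (\<integral>x. indicator B (X2 x) * 2 \<partial>M2)"
    using assms by (intro weighted_char_unique_pos) auto
  show ?thesis using * ** by (simp add: distrib_left)
qed

text \<open>Complex weights arise in \<open>joint_char_unique\<close> as products of indicators and
  oscillating factors. Real and imaginary parts are treated separately, which requires the
  hypothesis for the conjugate weight too.\<close>

lemma weighted_char_unique:
  fixes X1 :: "'a \<Rightarrow> real" and X2 :: "'b \<Rightarrow> real" and w1 :: "'a \<Rightarrow> complex"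
  assumes "prob_space M1" "prob_space M2"
    and [measurable]: "X1 \<in> borel_measurable M1" "X2 \<in> borel_measurable M2"
      "w1 \<in> borel_measurable M1" "w2 \<in> borel_measurable M2"
    and w: "\<And>x. norm (w1 x) \<le> 1" "\<And>x. norm (w2 x) \<le> 1"
    and eq0: "\<And>s. (\<integral>x. cis (s * X1 x) \<partial>M1) = (\<integral>x. cis (s * X2 x) \<partial>M2)"
    and eq: "\<And>s. (\<integral>x. cis (s * X1 x) * w1 x \<partial>M1) = (\<integral>x. cis (s * X2 x) * w2 x \<partial>M2)"
    and [measurable]: "B \<in> sets borel"
  shows "(\<integral>x. indicator B (X1 x) * w1 x \<partial>M1) = (\<integral>x. indicator B (X2 x) * w2 x \<partial>M2)"
proof -
  interpret M1: prob_space M1 by fact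
  interpret M2: prob_space M2 by fact
  have i1: "integrable M1 (\<lambda>x. cis (s * X1 x) * w1 x)" "integrable M1 (\<lambda>x. cis (s * X1 x) * cnj (w1 x))"
      "integrable M1 (\<lambda>x. indicator B (X1 x) * w1 x)" for s
    using w by (auto intro!: M1.integrable_bounded_by[where B=1] simp: norm_mult indicator_def)
  have i2: "integrable M2 (\<lambda>x. cis (s * X2 x) * w2 x)" "integrable M2 (\<lambda>x. cis (s * X2 x) * cnj (w2 x))"
      "integrable M2 (\<lambda>x. indicator B (X2 x) * w2 x)" for s
    using w by (auto intro!: M2.integrable_bounded_by[where B=1] simp: norm_mult indicator_def)
  \<comment> \<open>Conjugating the hypothesis at \<open>- s\<close> moves the conjugate onto the
    weight and restores the frequency \<open>s\<close>.\<close>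
  have cnj: "(\<integral>x. cis (s * X1 x) * cnj (w1 x) \<partial>M1) = (\<integral>x. cis (s * X2 x) * cnj (w2 x) \<partial>M2)" for s
  proof -
    have "(\<integral>x. cis (s * X1 x) * cnj (w1 x) \<partial>M1) = (\<integral>x. cnj (cis ((- s) * X1 x) * w1 x) \<partial>M1)"
      by (simp add: cis_cnj)
    also have "\<dots> = (\<integral>x. cnj (cis ((- s) * X2 x) * w2 x) \<partial>M2)"
      unfolding Bochner_Integration.integral_cnj eq ..
    finally show ?thesis by (simp add: cis_cnj)
  qed
  have re: "(\<integral>x. indicator B (X1 x) * Re (w1 x) \<partial>M1) = (\<integral>x. indicator B (X2 x) * Re (w2 x) \<partial>M2)"
  proof (rule weighted_char_unique_real[OF assms(1-4) _ _ _ _ eq0 _ assms(11)])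
    fix s
    have z: "a * complex_of_real (Re z) = (a * z + a * cnj z) / 2" for a z
      using complex_add_cnj[of z] by (metis distrib_left mult.commute nonzero_mult_div_cancel_left
          of_real_mult of_real_numeral times_divide_eq_right zero_neq_numeral)
    show "(\<integral>x. cis (s * X1 x) * Re (w1 x) \<partial>M1) = (\<integral>x. cis (s * X2 x) * Re (w2 x) \<partial>M2)"
      unfolding z using i1 i2 eq cnj by simp
    show "(\<lambda>x. Re (w1 x)) \<in> borel_measurable M1" "(\<lambda>x. Re (w2 x)) \<in> borel_measurable M2"
      by measurable
    show "\<bar>Re (w1 x)\<bar> \<le> 1" "\<bar>Re (w2 y)\<bar> \<le> 1" for x y
      using order_trans[OF abs_Re_le_cmod w(1)] order_trans[OF abs_Re_le_cmod w(2)] by auto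
  qed
  have im: "(\<integral>x. indicator B (X1 x) * Im (w1 x) \<partial>M1) = (\<integral>x. indicator B (X2 x) * Im (w2 x) \<partial>M2)"
  proof (rule weighted_char_unique_real[OF assms(1-4) _ _ _ _ eq0 _ assms(11)])
    fix s
    have z: "a * complex_of_real (Im z) = (a * z - a * cnj z) * (- \<i> / 2)" for a z
      by (simp add: right_diff_distrib[symmetric] complex_diff_cnj)
    show "(\<integral>x. cis (s * X1 x) * Im (w1 x) \<partial>M1) = (\<integral>x. cis (s * X2 x) * Im (w2 x) \<partial>M2)"
      unfolding z using i1 i2 eq cnj by simp
    show "(\<lambda>x. Im (w1 x)) \<in> borel_measurable M1" "(\<lambda>x. Im (w2 x)) \<in> borel_measurable M2"
      by measurable
    show "\<bar>Im (w1 x)\<bar> \<le> 1" "\<bar>Im (w2 y)\<bar> \<le> 1" for x y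
      using order_trans[OF abs_Im_le_cmod w(1)] order_trans[OF abs_Im_le_cmod w(2)] by auto
  qed
  have ind: "(indicator B y :: complex) * z =
      Complex (indicator B y * Re z) (indicator B y * Im z)" for y z
    by (auto simp: indicator_def complex_eq_iff)
  show ?thesis
  proof (rule complex_eqI)
    show "Re (\<integral>x. indicator B (X1 x) * w1 x \<partial>M1) = Re (\<integral>x. indicator B (X2 x) * w2 x \<partial>M2)"
      using re i1 i2 by (subst (1 2) integral_Re[symmetric]) (auto simp: ind)
    show "Im (\<integral>x. indicator B (X1 x) * w1 x \<partial>M1) = Im (\<integral>x. indicator B (X2 x) * w2 x \<partial>M2)"
      using im i1 i2 by (subst (1 2) integral_Im[symmetric]) (auto simp: ind)
  qed
qed

text \<open>The oscillating factors are replaced by indicators of the \<open>B j\<close> one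
  coordinate at a time. All other factors, already replaced or not, are bounded by 1 and act as the
  weight in \<open>weighted_char_unique\<close>.\<close>

lemma joint_char_unique:
  fixes X1 :: "'i \<Rightarrow> 'a \<Rightarrow> real" and X2 :: "'i \<Rightarrow> 'b \<Rightarrow> real"
  assumes M1: "prob_space M1" and M2: "prob_space M2" and J: "finite J"
    and X1: "\<And>j. j \<in> J \<Longrightarrow> X1 j \<in> borel_measurable M1"
    and X2: "\<And>j. j \<in> J \<Longrightarrow> X2 j \<in> borel_measurable M2"
    and B: "\<And>j. j \<in> J \<Longrightarrow> B j \<in> sets borel"
    and eq: "\<And>t. (\<integral>x. cis (\<Sum>j\<in>J. t j * X1 j x) \<partial>M1) = (\<integral>x. cis (\<Sum>j\<in>J. t j * X2 j x) \<partial>M2)"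
  shows "measure M1 {x \<in> space M1. \<forall>j\<in>J. X1 j x \<in> B j} = measure M2 {x \<in> space M2. \<forall>j\<in>J. X2 j x \<in> B j}"
proof -
  interpret M1: prob_space M1 by fact
  interpret M2: prob_space M2 by fact
  have main: "(\<integral>x. (\<Prod>j\<in>K. indicator (B j) (X1 j x)) * cis (\<Sum>j\<in>J-K. t j * X1 j x) \<partial>M1)
     = (\<integral>x. (\<Prod>j\<in>K. indicator (B j) (X2 j x)) * cis (\<Sum>j\<in>J-K. t j * X2 j x) \<partial>M2)"
    if "K \<subseteq> J" for K t
  proof -
    have "finite K" using that J by (rule finite_subset)
    then show ?thesis using that
    proof (induction K arbitrary: t rule: finite_induct)
      case empty
      then show ?case by (simp add: eq)
    next
      case (insert k K)
      let ?J = "J - insert k K"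
      have k: "k \<in> J" "K \<subseteq> J" and fJ: "finite ?J" "k \<notin> ?J" "J - K = insert k ?J"
        using insert J by auto
      have [measurable]: "X1 j \<in> borel_measurable M1" "X2 j \<in> borel_measurable M2" "B j \<in> sets borel"
        if "j \<in> K" for j using X1 X2 B k that by auto
      have [measurable]: "X1 j \<in> borel_measurable M1" "X2 j \<in> borel_measurable M2"
        if "j \<in> ?J" for j using X1 X2 that by auto
      define w1 where "w1 x = (\<Prod>j\<in>K. indicator (B j) (X1 j x)) * cis (\<Sum>j\<in>?J. t j * X1 j x)" for x
      define w2 where "w2 x = (\<Prod>j\<in>K. indicator (B j) (X2 j x)) * cis (\<Sum>j\<in>?J. t j * X2 j x)" for x
      have prod_le: "(\<Prod>j\<in>K. norm (indicator (B j) (f j) :: complex)) \<le> 1" for f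
        by (intro prod_le_1) (auto simp: indicator_def)
      have "(\<integral>x. indicator (B k) (X1 k x) * w1 x \<partial>M1) = (\<integral>x. indicator (B k) (X2 k x) * w2 x \<partial>M2)"
      proof (rule weighted_char_unique)
        show "w1 \<in> borel_measurable M1" "w2 \<in> borel_measurable M2"
          unfolding w1_def[abs_def] w2_def[abs_def] by measurable
        show "norm (w1 x) \<le> 1" for x
          unfolding w1_def norm_mult norm_cis prod_norm[symmetric] using prod_le by simp
        show "norm (w2 x) \<le> 1" for x
          unfolding w2_def norm_mult norm_cis prod_norm[symmetric] using prod_le by simp
        \<comment> \<open>Frequency \<open>s\<close> at \<open>k\<close> and zero elsewhere isolates
          the marginal law of coordinate \<open>k\<close>.\<close>
        show "(\<integral>x. cis (s * X1 k x) \<partial>M1) = (\<integral>x. cis (s * X2 k x) \<partial>M2)" for s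
          using eq[of "\<lambda>j. if j = k then s else 0"] k J
          by (simp add: if_distrib[of "\<lambda>a. a * _"] cong: if_cong)
        fix s
        have sum: "(\<Sum>j\<in>J-K. (t(k:=s)) j * f j) = s * f k + (\<Sum>j\<in>?J. t j * f j)" for f :: "_ \<Rightarrow> real"
          using fJ(1,2) unfolding fJ(3) by (subst sum.insert) (auto intro!: sum.cong)
        show "(\<integral>x. cis (s * X1 k x) * w1 x \<partial>M1) = (\<integral>x. cis (s * X2 k x) * w2 x \<partial>M2)"
          using insert.IH[OF k(2), of "t(k:=s)", unfolded sum cis_mult[symmetric]]
          unfolding w1_def w2_def by (simp only: mult_ac)
      qed (use k X1 X2 B M1 M2 in auto)
      then show ?case
        unfolding w1_def w2_def using insert(1,2) by (simp add: mult.assoc)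
    qed
  qed
  have m1: "complex_of_real (measure M1 {x \<in> space M1. \<forall>j\<in>J. X1 j x \<in> B j}) =
      (\<integral>x. (\<Prod>j\<in>J. indicator (B j) (X1 j x)) \<partial>M1)"
  proof -
    have [measurable]: "{x \<in> space M1. \<forall>j\<in>J. X1 j x \<in> B j} \<in> sets M1"
      using X1 B J by (intro sets.sets_Collect_finite_All) (auto intro: measurable_sets_Collect)
    have "(\<integral>x. (\<Prod>j\<in>J. indicator (B j) (X1 j x)) \<partial>M1) =
       (\<integral>x. complex_of_real (indicator {x \<in> space M1. \<forall>j\<in>J. X1 j x \<in> B j} x) \<partial>M1)"
      using J by (intro Bochner_Integration.integral_cong) (auto simp: indicator_def)
    also have "\<dots> = of_real (measure M1 {x \<in> space M1. \<forall>j\<in>J. X1 j x \<in> B j})"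
      by (subst integral_complex_of_real) (simp add: Int_absorb2 Collect_subset)
    finally show ?thesis ..
  qed
  have m2: "complex_of_real (measure M2 {x \<in> space M2. \<forall>j\<in>J. X2 j x \<in> B j}) =
      (\<integral>x. (\<Prod>j\<in>J. indicator (B j) (X2 j x)) \<partial>M2)"
  proof -
    have [measurable]: "{x \<in> space M2. \<forall>j\<in>J. X2 j x \<in> B j} \<in> sets M2"
      using X2 B J by (intro sets.sets_Collect_finite_All) (auto intro: measurable_sets_Collect)
    have "(\<integral>x. (\<Prod>j\<in>J. indicator (B j) (X2 j x)) \<partial>M2) =
       (\<integral>x. complex_of_real (indicator {x \<in> space M2. \<forall>j\<in>J. X2 j x \<in> B j} x) \<partial>M2)"
      using J by (intro Bochner_Integration.integral_cong) (auto simp: indicator_def)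
    also have "\<dots> = of_real (measure M2 {x \<in> space M2. \<forall>j\<in>J. X2 j x \<in> B j})"
      by (subst integral_complex_of_real) (simp add: Int_absorb2 Collect_subset)
    finally show ?thesis ..
  qed
  have "complex_of_real (measure M1 {x \<in> space M1. \<forall>j\<in>J. X1 j x \<in> B j}) =
      of_real (measure M2 {x \<in> space M2. \<forall>j\<in>J. X2 j x \<in> B j})"
    unfolding m1 m2 using main[of J "\<lambda>_. 0"] by simp
  then show ?thesis by (simp only: of_real_eq_iff)
qed

section \<open>Gaussian laws\<close>

lemma cis_sum: "cis (\<Sum>a\<in>A. f a) = (\<Prod>a\<in>A. cis (f a))"
  by (induction A rule: infinite_finite_induct) (auto simp: cis_mult[symmetric])

lemma prob_space_std_normal: "prob_space std_normal_distribution"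
  using real_dist_normal_dist by (simp add: real_distribution_def)

lemma integral_cis_std_normal_PiM:
  assumes "finite A"
  shows "(\<integral>x. cis (\<Sum>l\<in>A. b l * x l) \<partial>(\<Pi>\<^sub>M l\<in>A. std_normal_distribution)) =
    exp (- (\<Sum>l\<in>A. (b l)\<^sup>2) / 2)"
proof -
  interpret N: prob_space std_normal_distribution by (rule prob_space_std_normal)
  interpret product_sigma_finite "\<lambda>_. std_normal_distribution" ..
  have "(\<integral>x. cis (\<Sum>l\<in>A. b l * x l) \<partial>(\<Pi>\<^sub>M l\<in>A. std_normal_distribution)) =
      (\<Prod>l\<in>A. \<integral>x. cis (b l * x) \<partial>std_normal_distribution)"
    unfolding cis_sum using assms
    by (intro product_integral_prod) (auto intro!: N.integrable_bounded_by[where B=1])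
  also have "\<dots> = (\<Prod>l\<in>A. complex_of_real (exp (- ((b l)\<^sup>2) / 2)))"
    by (simp add: char_conv_cis[symmetric] char_std_normal_distribution)
  also have "\<dots> = exp (- (\<Sum>l\<in>A. (b l)\<^sup>2) / 2)"
    using assms by (simp add: exp_sum[symmetric] sum_negf[symmetric] sum_divide_distrib of_real_prod[symmetric] flip: exp_of_real)
  finally show ?thesis .
qed

text \<open>
  Stated through the characteristic functional rather than through a factorization of the covariance
  matrix: linear images and sums of independent Gaussians then need no matrix algebra.
\<close>

definition gauss_law ::
    "'i set \<Rightarrow> ('i \<Rightarrow> real) \<Rightarrow> ('i \<Rightarrow> 'i \<Rightarrow> real) \<Rightarrow> ('i \<Rightarrow> real) measure \<Rightarrow> bool" where
  "gauss_law I \<mu> C M \<longleftrightarrow>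
     prob_space M \<and> sets M = sets (\<Pi>\<^sub>M i\<in>I. borel) \<and>
     (\<forall>J t. finite J \<longrightarrow> J \<subseteq> I \<longrightarrow>
        (\<integral>\<omega>. cis (\<Sum>j\<in>J. t j * \<omega> j) \<partial>M) =
        cis (\<Sum>j\<in>J. t j * \<mu> j) * exp (- (\<Sum>i\<in>J. \<Sum>j\<in>J. t i * t j * C i j) / 2))"

lemma gauss_lawD:
  assumes "gauss_law I \<mu> C M"
  shows "prob_space M" "sets M = sets (\<Pi>\<^sub>M i\<in>I. borel)"
    "space M = (\<Pi>\<^sub>E i\<in>I. UNIV)"
    "i \<in> I \<Longrightarrow> (\<lambda>\<omega>. \<omega> i) \<in> borel_measurable M"
proof -
  show "prob_space M" and s: "sets M = sets (\<Pi>\<^sub>M i\<in>I. borel)"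
    using assms by (auto simp: gauss_law_def)
  show "space M = (\<Pi>\<^sub>E i\<in>I. UNIV)"
    using sets_eq_imp_space_eq[OF s] by (simp add: space_PiM)
  show "(\<lambda>\<omega>. \<omega> i) \<in> borel_measurable M" if "i \<in> I"
    using that by (subst measurable_cong_sets[OF s refl]) measurable
qed

lemma gauss_law_cong:
  assumes "gauss_law I \<mu> C M" "\<And>i. i \<in> I \<Longrightarrow> \<mu> i = \<mu>' i"
    "\<And>i j. i \<in> I \<Longrightarrow> j \<in> I \<Longrightarrow> C i j = C' i j"
  shows "gauss_law I \<mu>' C' M"
  unfolding gauss_law_def
proof (intro conjI allI impI)
  fix J t assume J: "finite J" "J \<subseteq> I"
  have "(\<Sum>j\<in>J. t j * \<mu>' j) = (\<Sum>j\<in>J. t j * \<mu> j)"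
    "(\<Sum>i\<in>J. \<Sum>j\<in>J. t i * t j * C' i j) = (\<Sum>i\<in>J. \<Sum>j\<in>J. t i * t j * C i j)"
    using J assms(2,3) by (auto intro!: sum.cong simp: subset_iff)
  then show "(\<integral>\<omega>. cis (\<Sum>j\<in>J. t j * \<omega> j) \<partial>M) =
        cis (\<Sum>j\<in>J. t j * \<mu>' j) * exp (- (\<Sum>i\<in>J. \<Sum>j\<in>J. t i * t j * C' i j) / 2)"
    using assms(1) J by (simp add: gauss_law_def)
qed (use assms(1) in \<open>auto simp: gauss_law_def\<close>)

text \<open>\<open>I\<close> may be uncountable, as it is for white noise. The cylinders over finite
  \<open>J\<close> generate the sigma-algebra and are closed under intersection, and
  \<open>joint_char_unique\<close> decides on them.\<close>

lemma gauss_law_unique: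
  assumes M: "gauss_law I \<mu> C M" and N: "gauss_law I \<mu> C N"
  shows "M = N"
proof (rule measure_eqI_PiM_infinite)
  show "sets M = sets (\<Pi>\<^sub>M i\<in>I. borel)" "sets N = sets (\<Pi>\<^sub>M i\<in>I. borel)"
    using gauss_lawD(2)[OF M] gauss_lawD(2)[OF N] .
  interpret M: prob_space M using gauss_lawD[OF M] by simp
  interpret N: prob_space N using gauss_lawD[OF N] by simp
  show "finite_measure M" by (rule M.finite_measure_axioms)
  fix A and J :: "'a set"
  assume J: "finite J" "J \<subseteq> I" and A: "\<And>i. i \<in> J \<Longrightarrow> A i \<in> sets (borel :: real measure)"
  have "measure M {x \<in> space M. \<forall>j\<in>J. x j \<in> A j} = measure N {x \<in> space N. \<forall>j\<in>J. x j \<in> A j}"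
  proof (rule joint_char_unique)
    show "(\<integral>x. cis (\<Sum>j\<in>J. t j * x j) \<partial>M) = (\<integral>x. cis (\<Sum>j\<in>J. t j * x j) \<partial>N)" for t
      using M N J by (simp add: gauss_law_def)
  qed (use M.prob_space_axioms N.prob_space_axioms J A gauss_lawD(4)[OF M] gauss_lawD(4)[OF N] in auto)
  moreover have "prod_emb I (\<lambda>_. borel) J (Pi\<^sub>E J A) = {x \<in> space M. \<forall>j\<in>J. x j \<in> A j}"
    "prod_emb I (\<lambda>_. borel) J (Pi\<^sub>E J A) = {x \<in> space N. \<forall>j\<in>J. x j \<in> A j}"
    using J by (auto simp: prod_emb_def gauss_lawD(3)[OF M] gauss_lawD(3)[OF N] PiE_iff extensional_def)
  ultimately show "emeasure M (prod_emb I (\<lambda>_. borel) J (Pi\<^sub>E J A)) =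
      emeasure N (prod_emb I (\<lambda>_. borel) J (Pi\<^sub>E J A))"
    by (simp add: M.emeasure_eq_measure N.emeasure_eq_measure)
qed

lemma gauss_law_affine_std_normal:
  assumes A: "finite A"
  shows "gauss_law I \<mu> (\<lambda>i j. \<Sum>l\<in>A. a i l * a j l)
    (distr (\<Pi>\<^sub>M l\<in>A. std_normal_distribution) (\<Pi>\<^sub>M i\<in>I. borel)
       (\<lambda>x. \<lambda>i\<in>I. \<mu> i + (\<Sum>l\<in>A. a i l * x l)))" (is "gauss_law I \<mu> ?C (distr ?N _ ?T)")
  unfolding gauss_law_def
proof (intro conjI allI impI)
  interpret N: prob_space ?N by (intro prob_space_PiM prob_space_std_normal)
  have T[measurable]: "?T \<in> ?N \<rightarrow>\<^sub>M (\<Pi>\<^sub>M i\<in>I. borel)"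
    by (intro measurable_restrict borel_measurable_add borel_measurable_sum borel_measurable_times) auto
  show "prob_space (distr ?N (\<Pi>\<^sub>M i\<in>I. borel) ?T)"
    by (rule N.prob_space_distr) measurable
  show "sets (distr ?N (\<Pi>\<^sub>M i\<in>I. borel) ?T) = sets (\<Pi>\<^sub>M i\<in>I. borel)" by simp
  fix J t assume J: "finite J" "J \<subseteq> I"
  \<comment> \<open>\<open>b l\<close> is the coefficient of \<open>x l\<close> in the linear
    functional given by \<open>t\<close>; the sum of the squares is the quadratic form of the
    covariance.\<close>
  define b where "b l = (\<Sum>j\<in>J. t j * a j l)" for l
  have *: "(\<Sum>j\<in>J. t j * ?T x j) = (\<Sum>j\<in>J. t j * \<mu> j) + (\<Sum>l\<in>A. b l * x l)" for x
  proof -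
    have "(\<Sum>j\<in>J. t j * ?T x j) = (\<Sum>j\<in>J. t j * \<mu> j + (\<Sum>l\<in>A. t j * a j l * x l))"
      using J by (intro sum.cong) (auto simp: distrib_left sum_distrib_left mult.assoc)
    also have "\<dots> = (\<Sum>j\<in>J. t j * \<mu> j) + (\<Sum>l\<in>A. \<Sum>j\<in>J. t j * a j l * x l)"
      unfolding sum.distrib by (subst sum.swap) (rule refl)
    finally show ?thesis by (simp add: b_def sum_distrib_right)
  qed
  have **: "(\<Sum>l\<in>A. (b l)\<^sup>2) = (\<Sum>i\<in>J. \<Sum>j\<in>J. t i * t j * ?C i j)"
  proof -
    have "(\<Sum>l\<in>A. (b l)\<^sup>2) = (\<Sum>l\<in>A. \<Sum>i\<in>J. \<Sum>j\<in>J. t i * t j * (a i l * a j l))"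
      by (simp add: b_def power2_eq_square sum_product mult_ac)
    also have "\<dots> = (\<Sum>i\<in>J. \<Sum>l\<in>A. \<Sum>j\<in>J. t i * t j * (a i l * a j l))"
      by (rule sum.swap)
    also have "\<dots> = (\<Sum>i\<in>J. \<Sum>j\<in>J. \<Sum>l\<in>A. t i * t j * (a i l * a j l))"
      by (intro sum.cong refl sum.swap)
    finally show ?thesis by (simp add: sum_distrib_left)
  qed
  have "(\<lambda>\<omega>. cis (\<Sum>j\<in>J. t j * \<omega> j)) \<in> borel_measurable (\<Pi>\<^sub>M i\<in>I. borel)"
    using J by (intro borel_measurable_cis borel_measurable_sum borel_measurable_times) (auto intro!: measurable_component_singleton)
  then have "(\<integral>\<omega>. cis (\<Sum>j\<in>J. t j * \<omega> j) \<partial>distr ?N (\<Pi>\<^sub>M i\<in>I. borel) ?T) =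
      (\<integral>x. cis (\<Sum>j\<in>J. t j * ?T x j) \<partial>?N)"
    by (subst integral_distr) auto
  also have "\<dots> = cis (\<Sum>j\<in>J. t j * \<mu> j) * exp (- (\<Sum>l\<in>A. (b l)\<^sup>2) / 2)"
    unfolding * cis_mult[symmetric] using A by (simp add: integral_cis_std_normal_PiM)
  finally show "(\<integral>\<omega>. cis (\<Sum>j\<in>J. t j * \<omega> j) \<partial>distr ?N (\<Pi>\<^sub>M i\<in>I. borel) ?T) =
      cis (\<Sum>j\<in>J. t j * \<mu> j) * exp (- (\<Sum>i\<in>J. \<Sum>j\<in>J. t i * t j * ?C i j) / 2)"
    unfolding ** .
qed

text \<open>The factor \<open>A\<close> of a finite-dimensional covariance depends on
  \<open>J\<close>. The characteristic functional forgets it, so the finite-dimensional laws combine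
  into one statement about \<open>M\<close>.\<close>

lemma gaussian_process_imp_gauss_law:
  assumes M: "gaussian_process I \<mu> C M"
  shows "gauss_law I \<mu> C M"
  unfolding gauss_law_def
proof (intro conjI allI impI)
  show "prob_space M" and s: "sets M = sets (\<Pi>\<^sub>M i\<in>I. borel)"
    using M by (auto simp: gaussian_process_def)
  fix J t assume J: "finite J" "J \<subseteq> I"
  let ?R = "distr M (\<Pi>\<^sub>M i\<in>J. borel) (\<lambda>\<omega>. restrict \<omega> J)"
  have "multivariate_normal J \<mu> C ?R" using M J by (auto simp: gaussian_process_def)
  then obtain r :: nat and A where C: "\<And>i j. i \<in> J \<Longrightarrow> j \<in> J \<Longrightarrow> C i j = (\<Sum>l<r. A i l * A j l)"
    and R: "?R = distr (\<Pi>\<^sub>M l\<in>{..<r}. std_normal_distribution) (\<Pi>\<^sub>M i\<in>J. borel)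
              (\<lambda>\<eta>. \<lambda>i\<in>J. \<mu> i + (\<Sum>l<r. A i l * \<eta> l))"
    unfolding multivariate_normal_def by blast
  have "gauss_law J \<mu> C ?R"
    unfolding R by (rule gauss_law_cong[OF gauss_law_affine_std_normal]) (auto simp: C)
  then have "(\<integral>\<omega>. cis (\<Sum>j\<in>J. t j * \<omega> j) \<partial>?R) =
      cis (\<Sum>j\<in>J. t j * \<mu> j) * exp (- (\<Sum>i\<in>J. \<Sum>j\<in>J. t i * t j * C i j) / 2)"
    using J by (auto simp: gauss_law_def)
  moreover have "(\<integral>\<omega>. cis (\<Sum>j\<in>J. t j * \<omega> j) \<partial>?R) = (\<integral>\<omega>. cis (\<Sum>j\<in>J. t j * \<omega> j) \<partial>M)"
  proof (subst integral_distr)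
    show "(\<lambda>\<omega>. restrict \<omega> J) \<in> M \<rightarrow>\<^sub>M (\<Pi>\<^sub>M i\<in>J. borel)"
      using J by (subst measurable_cong_sets[OF s refl]) (auto intro: measurable_restrict_subset)
    show "(\<lambda>\<omega>. cis (\<Sum>j\<in>J. t j * \<omega> j)) \<in> borel_measurable (\<Pi>\<^sub>M i\<in>J. borel)"
      by (intro borel_measurable_cis borel_measurable_sum borel_measurable_times) (auto intro!: measurable_component_singleton)
  qed simp
  ultimately show "(\<integral>\<omega>. cis (\<Sum>j\<in>J. t j * \<omega> j) \<partial>M) =
      cis (\<Sum>j\<in>J. t j * \<mu> j) * exp (- (\<Sum>i\<in>J. \<Sum>j\<in>J. t i * t j * C i j) / 2)" by simp
qed

text \<open>\<open>gauss_law\<close> takes a set of distinct indices, while a linear combination may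
  hit the same index several times. The coefficients of coinciding \<open>\<iota> q\<close> are
  therefore merged into \<open>t\<close> first.\<close>

lemma gauss_law_family:
  assumes M: "gauss_law I \<mu> C M" and Q: "finite Q" "\<And>q. q \<in> Q \<Longrightarrow> \<iota> q \<in> I"
  shows "(\<integral>\<omega>. cis (\<Sum>q\<in>Q. s q * \<omega> (\<iota> q)) \<partial>M) =
    cis (\<Sum>q\<in>Q. s q * \<mu> (\<iota> q)) * exp (- (\<Sum>p\<in>Q. \<Sum>q\<in>Q. s p * s q * C (\<iota> p) (\<iota> q)) / 2)"
proof -
  define t where "t i = (\<Sum>q\<in>{q\<in>Q. \<iota> q = i}. s q)" for i
  have reg: "(\<Sum>q\<in>Q. s q * f (\<iota> q)) = (\<Sum>i\<in>\<iota> ` Q. t i * f i)" for f :: "_ \<Rightarrow> real"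
    unfolding t_def sum_distrib_right
    by (subst sum.image_gen[OF Q(1), of _ \<iota>]) (auto intro!: sum.cong)
  have "(\<Sum>p\<in>Q. \<Sum>q\<in>Q. s p * s q * C (\<iota> p) (\<iota> q)) = (\<Sum>p\<in>Q. s p * (\<Sum>q\<in>Q. s q * C (\<iota> p) (\<iota> q)))"
    by (simp add: sum_distrib_left mult.assoc)
  also have "\<dots> = (\<Sum>i\<in>\<iota> ` Q. t i * (\<Sum>j\<in>\<iota> ` Q. t j * C i j))"
    unfolding reg[of "C _"] by (rule reg)
  also have "\<dots> = (\<Sum>i\<in>\<iota> ` Q. \<Sum>j\<in>\<iota> ` Q. t i * t j * C i j)"
    by (simp add: sum_distrib_left mult.assoc)
  finally have cov: "(\<Sum>p\<in>Q. \<Sum>q\<in>Q. s p * s q * C (\<iota> p) (\<iota> q)) = \<dots>" .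
  show ?thesis
    unfolding reg[of \<mu>] reg[of "\<lambda>i. _ i"] cov using M Q by (auto simp: gauss_law_def image_subset_iff)
qed

text \<open>The index \<open>\<iota> g q\<close> may depend on the output coordinate
  \<open>g\<close>, so that \<open>g\<close> itself can be among the coordinates combined; residuals
  need this. A linear functional of the image is one of \<open>M\<close>, indexed by
  \<open>J \<times> Q\<close>.\<close>

lemma gauss_law_linear_image:
  assumes M: "gauss_law I \<mu> C M" and Q: "finite Q" "\<And>g q. g \<in> I' \<Longrightarrow> q \<in> Q \<Longrightarrow> \<iota> g q \<in> I"
  shows "(\<lambda>\<omega>. \<lambda>g\<in>I'. b g + (\<Sum>q\<in>Q. \<alpha> g q * \<omega> (\<iota> g q))) \<in> M \<rightarrow>\<^sub>M (\<Pi>\<^sub>M i\<in>I'. borel)" (is "?T \<in> _")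
    and "gauss_law I' (\<lambda>g. b g + (\<Sum>q\<in>Q. \<alpha> g q * \<mu> (\<iota> g q)))
      (\<lambda>g h. \<Sum>p\<in>Q. \<Sum>q\<in>Q. \<alpha> g p * \<alpha> h q * C (\<iota> g p) (\<iota> h q))
      (distr M (\<Pi>\<^sub>M i\<in>I'. borel) (\<lambda>\<omega>. \<lambda>g\<in>I'. b g + (\<Sum>q\<in>Q. \<alpha> g q * \<omega> (\<iota> g q))))"
proof -
  show T[measurable]: "?T \<in> M \<rightarrow>\<^sub>M (\<Pi>\<^sub>M i\<in>I'. borel)"
    using Q by (intro measurable_restrict borel_measurable_add borel_measurable_sum borel_measurable_times)
      (auto intro: gauss_lawD(4)[OF M])
  show "gauss_law I' (\<lambda>g. b g + (\<Sum>q\<in>Q. \<alpha> g q * \<mu> (\<iota> g q)))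
      (\<lambda>g h. \<Sum>p\<in>Q. \<Sum>q\<in>Q. \<alpha> g p * \<alpha> h q * C (\<iota> g p) (\<iota> h q)) (distr M (\<Pi>\<^sub>M i\<in>I'. borel) ?T)"
    (is "gauss_law _ ?m ?C ?D")
    unfolding gauss_law_def
  proof (intro conjI allI impI)
    show "prob_space ?D" using gauss_lawD(1)[OF M] T by (rule prob_space.prob_space_distr)
    show "sets ?D = sets (\<Pi>\<^sub>M i\<in>I'. borel)" by simp
    fix J t assume J: "finite J" "J \<subseteq> I'"
    define s where "s = (\<lambda>(g, q). t g * \<alpha> g q)"
    define k where "k = (\<lambda>(g, q). \<iota> g q)"
    have lin: "(\<Sum>g\<in>J. t g * (b g + (\<Sum>q\<in>Q. \<alpha> g q * f (\<iota> g q)))) = (\<Sum>g\<in>J. t g * b g) +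
        (\<Sum>z\<in>J\<times>Q. s z * f (k z))"
      for f :: "_ \<Rightarrow> real"
      by (simp add: s_def k_def distrib_left sum.distrib sum_distrib_left mult.assoc sum.cartesian_product
          case_prod_unfold)
    have cov: "(\<Sum>x\<in>J\<times>Q. \<Sum>y\<in>J\<times>Q. s x * s y * C (k x) (k y)) = (\<Sum>g\<in>J. \<Sum>h\<in>J. t g * t h * ?C g h)"
    proof -
      have "(\<Sum>x\<in>J\<times>Q. \<Sum>y\<in>J\<times>Q. s x * s y * C (k x) (k y)) =
         (\<Sum>g\<in>J. \<Sum>p\<in>Q. \<Sum>h\<in>J. \<Sum>q\<in>Q. t g * \<alpha> g p * (t h * \<alpha> h q) * C (\<iota> g p) (\<iota> h q))"
        by (simp add: sum.cartesian_product' s_def k_def)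
      also have "\<dots> = (\<Sum>g\<in>J. \<Sum>h\<in>J. \<Sum>p\<in>Q. \<Sum>q\<in>Q. t g * \<alpha> g p * (t h * \<alpha> h q) * C (\<iota> g p) (\<iota> h q))"
        by (intro sum.cong refl sum.swap)
      finally show ?thesis by (simp add: sum_distrib_left mult_ac)
    qed
    have "(\<lambda>\<omega>. cis (\<Sum>j\<in>J. t j * \<omega> j)) \<in> borel_measurable (\<Pi>\<^sub>M i\<in>I'. borel)"
      using J by (intro borel_measurable_cis borel_measurable_sum borel_measurable_times) (auto intro!: measurable_component_singleton)
    then have "(\<integral>\<omega>. cis (\<Sum>j\<in>J. t j * \<omega> j) \<partial>?D) = (\<integral>x. cis (\<Sum>j\<in>J. t j * ?T x j) \<partial>M)"
      by (subst integral_distr) auto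
    also have "\<dots> = (\<integral>x. cis (\<Sum>g\<in>J. t g * (b g + (\<Sum>q\<in>Q. \<alpha> g q * x (\<iota> g q)))) \<partial>M)"
      using J by (intro Bochner_Integration.integral_cong refl arg_cong[where f=cis] sum.cong) auto
    also have "\<dots> = cis (\<Sum>g\<in>J. t g * b g) * (\<integral>x. cis (\<Sum>z\<in>J\<times>Q. s z * x (k z)) \<partial>M)"
      unfolding lin cis_mult[symmetric] by simp
    also have "(\<integral>x. cis (\<Sum>z\<in>J\<times>Q. s z * x (k z)) \<partial>M) = cis (\<Sum>z\<in>J\<times>Q. s z * \<mu> (k z))
        * exp (- (\<Sum>x\<in>J\<times>Q. \<Sum>y\<in>J\<times>Q. s x * s y * C (k x) (k y)) / 2)"
      using J Q by (intro gauss_law_family[OF M]) (auto simp: k_def)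
    finally show "(\<integral>\<omega>. cis (\<Sum>j\<in>J. t j * \<omega> j) \<partial>?D) =
        cis (\<Sum>j\<in>J. t j * ?m j) * exp (- (\<Sum>i\<in>J. \<Sum>j\<in>J. t i * t j * ?C i j) / 2)"
      unfolding lin cov cis_mult[symmetric] by (simp only: mult.assoc)
  qed
qed

text \<open>The common shape of all randomizations below: compute a vector from the data and add
  independent noise. Measurability of \<open>K\<close> refers to the sigma-algebra \<open>S\<close>
  alone, so the same \<open>K\<close> can act on every law of an experiment.\<close>

lemma gauss_law_bind_add:
  assumes P: "prob_space P" and sP: "sets P = sets S"
    and V: "V \<in> S \<rightarrow>\<^sub>M (\<Pi>\<^sub>M i\<in>I. borel)"
    and PV: "gauss_law I \<mu> C (distr P (\<Pi>\<^sub>M i\<in>I. borel) V)"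
    and N: "gauss_law I \<nu> D N"
  defines "K \<equiv> \<lambda>z. distr N (\<Pi>\<^sub>M i\<in>I. borel) (\<lambda>\<omega>. \<lambda>i\<in>I. V z i + \<omega> i)"
  shows "K \<in> S \<rightarrow>\<^sub>M prob_algebra (\<Pi>\<^sub>M i\<in>I. borel)"
    and "gauss_law I (\<lambda>i. \<mu> i + \<nu> i) (\<lambda>i j. C i j + D i j) (P \<bind> K)"
proof -
  let ?B = "\<Pi>\<^sub>M i\<in>I. (borel :: real measure)"
  interpret P: prob_space P by fact
  interpret N: prob_space N by (rule gauss_lawD(1)[OF N])
  interpret PN: pair_prob_space P N ..
  note [measurable_cong] = sP gauss_lawD(2)[OF N]
  note [measurable] = V
  have N': "N \<in> space (prob_algebra ?B)"
    using gauss_lawD(1,2)[OF N] by (simp add: space_prob_algebra)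
  have T0: "(\<lambda>(z, \<omega>). \<lambda>i\<in>I. V z i + \<omega> i) \<in> S \<Otimes>\<^sub>M ?B \<rightarrow>\<^sub>M ?B"
    unfolding case_prod_unfold
    by (intro measurable_restrict borel_measurable_add
        measurable_compose[OF measurable_compose[OF measurable_fst V] measurable_component_singleton]
        measurable_compose[OF measurable_snd measurable_component_singleton]) auto
  show K: "K \<in> S \<rightarrow>\<^sub>M prob_algebra ?B"
    unfolding K_def using N' T0 by (intro measurable_distr_prob_space2[where M="?B"] measurable_const)
  have T[measurable]: "(\<lambda>(z, \<omega>). \<lambda>i\<in>I. V z i + \<omega> i) \<in> P \<Otimes>\<^sub>M N \<rightarrow>\<^sub>M ?B"
    using T0 by measurable
  have P': "P \<in> space (prob_algebra S)" using P sP by (simp add: space_prob_algebra)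
  have spP: "space P = space S" using sP by (rule sets_eq_imp_space_eq)
  \<comment> \<open>Fubini: drawing \<open>z\<close> from \<open>P\<close> and then from
    \<open>K z\<close> amounts to drawing an independent pair. The characteristic functional then
    splits into a product.\<close>
  have eq: "P \<bind> K = distr (P \<Otimes>\<^sub>M N) ?B (\<lambda>(z, \<omega>). \<lambda>i\<in>I. V z i + \<omega> i)"
  proof (rule measure_eqI)
    show "sets (P \<bind> K) = sets (distr (P \<Otimes>\<^sub>M N) ?B (\<lambda>(z, \<omega>). \<lambda>i\<in>I. V z i + \<omega> i))"
      using sets_bind'[OF P' K] by simp
    fix A assume "A \<in> sets (P \<bind> K)"
    then have A[measurable]: "A \<in> sets ?B" using sets_bind'[OF P' K] by simp
    have "emeasure (P \<bind> K) A = (\<integral>\<^sup>+z. emeasure (K z) A \<partial>P)"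
      by (rule emeasure_bind_prob_algebra[OF P' K A])
    also have "\<dots> = (\<integral>\<^sup>+z. emeasure N (Pair z -` ((\<lambda>(z, \<omega>). \<lambda>i\<in>I. V z i + \<omega> i) -` A \<inter> space (P \<Otimes>\<^sub>M N))) \<partial>P)"
    proof (intro nn_integral_cong)
      fix z assume z: "z \<in> space P"
      have "(\<lambda>\<omega>. \<lambda>i\<in>I. V z i + \<omega> i) \<in> N \<rightarrow>\<^sub>M ?B"
        using measurable_Pair2[OF T z] by simp
      then show "emeasure (K z) A =
          emeasure N (Pair z -` ((\<lambda>(z, \<omega>). \<lambda>i\<in>I. V z i + \<omega> i) -` A \<inter> space (P \<Otimes>\<^sub>M N)))"
        unfolding K_def using z
        by (subst emeasure_distr) (auto simp: space_pair_measure intro!: arg_cong[where f="emeasure N"])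
    qed
    also have "\<dots> = emeasure (distr (P \<Otimes>\<^sub>M N) ?B (\<lambda>(z, \<omega>). \<lambda>i\<in>I. V z i + \<omega> i)) A"
      by (subst emeasure_distr[OF T A]) (rule N.emeasure_pair_measure_alt[symmetric, OF measurable_sets[OF T A]])
    finally show "emeasure (P \<bind> K) A = emeasure (distr (P \<Otimes>\<^sub>M N) ?B (\<lambda>(z, \<omega>). \<lambda>i\<in>I. V z i + \<omega> i)) A" .
  qed
  show "gauss_law I (\<lambda>i. \<mu> i + \<nu> i) (\<lambda>i j. C i j + D i j) (P \<bind> K)"
    unfolding gauss_law_def
  proof (intro conjI allI impI)
    show "prob_space (P \<bind> K)" by (rule prob_space_bind'[OF P' K])
    show "sets (P \<bind> K) = sets ?B" by (rule sets_bind'[OF P' K])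
    have exp_half_add: "exp (- (x + y) / 2) = exp (- x / 2) * exp (- y / 2)" for x y :: real
      by (simp add: exp_add[symmetric] add_divide_distrib[symmetric])
    fix J t assume J: "finite J" "J \<subseteq> I"
    have cis_meas: "(\<lambda>\<omega>. cis (\<Sum>j\<in>J. t j * \<omega> j)) \<in> borel_measurable ?B"
      using J by (intro borel_measurable_cis borel_measurable_sum borel_measurable_times)
        (auto intro!: measurable_component_singleton)
    have [measurable]: "(\<lambda>z. cis (\<Sum>j\<in>J. t j * V z j)) \<in> borel_measurable P"
      using measurable_compose[OF V cis_meas] by measurable
    have [measurable]: "(\<lambda>\<omega>. cis (\<Sum>j\<in>J. t j * \<omega> j)) \<in> borel_measurable N"
      using cis_meas by measurable
    have "(\<integral>\<omega>. cis (\<Sum>j\<in>J. t j * \<omega> j) \<partial>(P \<bind> K)) =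
        (\<integral>z. cis (\<Sum>j\<in>J. t j * (case z of (z, \<omega>) \<Rightarrow> \<lambda>i\<in>I. V z i + \<omega> i) j) \<partial>(P \<Otimes>\<^sub>M N))"
      unfolding eq using T cis_meas by (rule integral_distr)
    also have "\<dots> = (\<integral>z. cis (\<Sum>j\<in>J. t j * V (fst z) j) * cis (\<Sum>j\<in>J. t j * snd z j) \<partial>(P \<Otimes>\<^sub>M N))"
      using J by (intro Bochner_Integration.integral_cong)
        (auto simp: cis_mult sum.distrib[symmetric] distrib_left subset_iff intro!: arg_cong[where f=cis] sum.cong)
    also have "\<dots> = (\<integral>z. \<integral>\<omega>. cis (\<Sum>j\<in>J. t j * V z j) * cis (\<Sum>j\<in>J. t j * \<omega> j) \<partial>N \<partial>P)"
      by (subst PN.integral_fst'[symmetric])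
        (auto intro!: PN.P.integrable_bounded_by[where B=1] simp: norm_mult)
    also have "\<dots> = (\<integral>z. cis (\<Sum>j\<in>J. t j * V z j) \<partial>P) * (\<integral>\<omega>. cis (\<Sum>j\<in>J. t j * \<omega> j) \<partial>N)"
      by simp
    also have "(\<integral>z. cis (\<Sum>j\<in>J. t j * V z j) \<partial>P) = (\<integral>\<omega>. cis (\<Sum>j\<in>J. t j * \<omega> j) \<partial>distr P ?B V)"
      using cis_meas by (subst integral_distr) auto
    also have "\<dots> = cis (\<Sum>j\<in>J. t j * \<mu> j) * exp (- (\<Sum>i\<in>J. \<Sum>j\<in>J. t i * t j * C i j) / 2)"
      using PV J by (simp add: gauss_law_def)
    also have "(\<integral>\<omega>. cis (\<Sum>j\<in>J. t j * \<omega> j) \<partial>N) =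
        cis (\<Sum>j\<in>J. t j * \<nu> j) * exp (- (\<Sum>i\<in>J. \<Sum>j\<in>J. t i * t j * D i j) / 2)"
      using N J by (simp add: gauss_law_def)
    finally show "(\<integral>\<omega>. cis (\<Sum>j\<in>J. t j * \<omega> j) \<partial>(P \<bind> K)) = cis (\<Sum>j\<in>J. t j * (\<mu> j + \<nu> j)) *
       exp (- (\<Sum>i\<in>J. \<Sum>j\<in>J. t i * t j * (C i j + D i j)) / 2)"
      by (simp only: distrib_left sum.distrib cis_mult[symmetric] exp_half_add of_real_mult mult_ac)
  qed
qed

text \<open>The source of all resampled noise. With suitable \<open>\<beta>\<close> the subtracted
  sum is the part of \<open>\<omega>\<close> explained by the coordinates \<open>\<iota> q\<close>,
  and the rest is uncorrelated with them.\<close>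

lemma gauss_law_residual:
  assumes M: "gauss_law I \<mu> C M" and Q: "finite Q" "\<And>q. q \<in> Q \<Longrightarrow> \<iota> q \<in> I"
  shows "gauss_law I (\<lambda>g. \<mu> g - (\<Sum>q\<in>Q. \<beta> g q * \<mu> (\<iota> q)))
      (\<lambda>g h. C g h - (\<Sum>q\<in>Q. \<beta> h q * C g (\<iota> q)) - (\<Sum>q\<in>Q. \<beta> g q * C (\<iota> q) h)
         + (\<Sum>p\<in>Q. \<Sum>q\<in>Q. \<beta> g p * \<beta> h q * C (\<iota> p) (\<iota> q)))
      (distr M (\<Pi>\<^sub>M i\<in>I. borel) (\<lambda>\<omega>. \<lambda>g\<in>I. \<omega> g - (\<Sum>q\<in>Q. \<beta> g q * \<omega> (\<iota> q))))"
proof -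
  \<comment> \<open>\<open>None\<close> stands for the coordinate \<open>g\<close> itself, with
    coefficient 1, and \<open>Some q\<close> for the subtracted coordinate
    \<open>\<iota> q\<close>.\<close>
  define Q' where "Q' = insert None (Some ` Q)"
  define \<alpha> where "\<alpha> g q = (case q of None \<Rightarrow> 1 | Some q \<Rightarrow> - \<beta> g q)" for g q
  define k where "k g q = (case q of None \<Rightarrow> g | Some q \<Rightarrow> \<iota> q)" for g q
  have sum: "(\<Sum>q\<in>Q'. f q) = f None + (\<Sum>q\<in>Q. f (Some q))" for f :: "_ \<Rightarrow> real"
    using Q(1) by (simp add: Q'_def sum.reindex)
  have Q': "finite Q'" "\<And>g q. g \<in> I \<Longrightarrow> q \<in> Q' \<Longrightarrow> k g q \<in> I"
    using Q by (auto simp: Q'_def k_def)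
  have "gauss_law I (\<lambda>g. 0 + (\<Sum>q\<in>Q'. \<alpha> g q * \<mu> (k g q)))
      (\<lambda>g h. \<Sum>p\<in>Q'. \<Sum>q\<in>Q'. \<alpha> g p * \<alpha> h q * C (k g p) (k h q))
      (distr M (\<Pi>\<^sub>M i\<in>I. borel) (\<lambda>\<omega>. \<lambda>g\<in>I. 0 + (\<Sum>q\<in>Q'. \<alpha> g q * \<omega> (k g q))))"
    using Q' by (intro gauss_law_linear_image[OF M])
  then show ?thesis
    unfolding sum by (simp add: \<alpha>_def k_def sum_negf sum.distrib sum_subtractf algebra_simps)
qed

section \<open>Total variation, randomization and the Le Cam distance\<close>

lemma measure_uniform_unit_interval:
  assumes "0 \<le> a" "a \<le> 1"
  shows "measure (uniform_measure lborel {0..1::real}) {..<a} = a"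
proof -
  have "{0..1} \<inter> {..<a} = {0..<a}" using assms by auto
  then show ?thesis using assms by (subst measure_uniform_measure) auto
qed

text \<open>Layer cake: the integral of \<open>f\<close> is the mean of the measures of its superlevel sets.\<close>

lemma integral_diff_le_of_measure_diff_le:
  assumes P: "prob_space P" and Q: "prob_space Q" and sets: "sets Q = sets P"
    and f[measurable]: "f \<in> borel_measurable P" and f01: "\<And>x. x \<in> space P \<Longrightarrow> f x \<in> {0..1::real}"
    and b: "\<And>A. A \<in> sets P \<Longrightarrow> \<bar>measure P A - measure Q A\<bar> \<le> b"
  shows "\<bar>(\<integral>x. f x \<partial>P) - (\<integral>x. f x \<partial>Q)\<bar> \<le> b"
proof -
  let ?U = "uniform_measure lborel {0..1::real}"
  interpret U: prob_space ?U by (rule prob_space_uniform_measure) auto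
  interpret P: prob_space P by fact
  interpret Q: prob_space Q by fact
  have layer: "integrable ?U (\<lambda>t. measure R {x \<in> space R. t < f x})"
      "(\<integral>x. f x \<partial>R) = (\<integral>t. measure R {x \<in> space R. t < f x} \<partial>?U)"
    if R: "prob_space R" and sR[measurable_cong]: "sets R = sets P" for R
  proof -
    interpret R: prob_space R by fact
    interpret RU: pair_prob_space R ?U ..
    have spR: "space R = space P" using sR by (rule sets_eq_imp_space_eq)
    have int: "integrable (R \<Otimes>\<^sub>M ?U) (\<lambda>(x, t). indicator {..<f x} t :: real)"
    proof (rule RU.P.integrable_bounded_by[where B=1])
      have "(\<lambda>z. if snd z < f (fst z) then 1 else 0 :: real) \<in> borel_measurable (R \<Otimes>\<^sub>M ?U)"
        by measurable
      also have "(\<lambda>z. if snd z < f (fst z) then 1 else 0 :: real) = (\<lambda>(x, t). indicator {..<f x} t)"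
        by (auto simp: indicator_def fun_eq_iff)
      finally show "(\<lambda>(x, t). indicator {..<f x} t :: real) \<in> borel_measurable (R \<Otimes>\<^sub>M ?U)" .
    qed (auto simp: indicator_def)
    have m: "(\<integral>x. indicat_real {..<f x} t \<partial>R) = measure R {x \<in> space R. t < f x}" for t
    proof -
      have "(\<integral>x. indicat_real {..<f x} t \<partial>R) = (\<integral>x. indicat_real {x \<in> space R. t < f x} x \<partial>R)"
        by (intro Bochner_Integration.integral_cong) (auto simp: indicator_def)
      then show ?thesis by (simp add: Int_absorb2 Collect_subset)
    qed
    have f: "f x = (\<integral>t. indicator {..<f x} t \<partial>?U)" if "x \<in> space P" for x
      using measure_uniform_unit_interval[of "f x"] f01[OF that] by simp
    have "(\<integral>x. f x \<partial>R) = (\<integral>x. (\<integral>t. indicator {..<f x} t \<partial>?U) \<partial>R)"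
      by (intro Bochner_Integration.integral_cong refl) (simp only: spR f[symmetric])
    also have "\<dots> = (\<integral>t. measure R {x \<in> space R. t < f x} \<partial>?U)"
      unfolding m[symmetric] using RU.Fubini_integral[OF int] by simp
    finally show "(\<integral>x. f x \<partial>R) = (\<integral>t. measure R {x \<in> space R. t < f x} \<partial>?U)" .
    show "integrable ?U (\<lambda>t. measure R {x \<in> space R. t < f x})"
      unfolding m[symmetric] using RU.integrable_snd[OF int] by simp
  qed
  have spQ: "space Q = space P" using sets by (rule sets_eq_imp_space_eq)
  note lP = layer[OF P refl] and lQ = layer[OF Q sets]
  have *: "\<bar>measure P {x \<in> space P. t < f x} - measure Q {x \<in> space Q. t < f x}\<bar> \<le> b" for t
    unfolding spQ by (rule b) measurable
  have "\<bar>(\<integral>x. f x \<partial>P) - (\<integral>x. f x \<partial>Q)\<bar> =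
      \<bar>\<integral>t. measure P {x \<in> space P. t < f x} - measure Q {x \<in> space Q. t < f x} \<partial>?U\<bar>"
    using lP lQ by simp
  also have "\<dots> \<le> (\<integral>t. \<bar>measure P {x \<in> space P. t < f x} - measure Q {x \<in> space Q. t < f x}\<bar> \<partial>?U)"
    by (rule integral_abs_bound)
  also have "\<dots> \<le> (\<integral>t. b \<partial>?U)"
    using lP(1) lQ(1) * by (intro integral_mono) auto
  also have "\<dots> = b" by (simp add: U.prob_space)
  finally show ?thesis .
qed

section \<open>Total variation and its contraction under kernels\<close>

lemma total_variation_leI:
  "(\<And>A. A \<in> sets P \<Longrightarrow> \<bar>measure P A - measure Q A\<bar> \<le> b) \<Longrightarrow> total_variation P Q \<le> ennreal b"
  unfolding total_variation_def by (intro SUP_least ennreal_leI) auto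

lemma total_variation_commute: "sets P = sets Q \<Longrightarrow> total_variation P Q = total_variation Q P"
  by (simp add: total_variation_def abs_minus_commute)

lemma total_variation_triangle:
  assumes "sets P = sets Q" "sets Q = sets R"
  shows "total_variation P R \<le> total_variation P Q + total_variation Q R"
  unfolding total_variation_def
proof (rule SUP_least)
  fix A assume A: "A \<in> sets P"
  have "ennreal \<bar>measure P A - measure R A\<bar> \<le> ennreal \<bar>measure P A - measure Q A\<bar> +
      ennreal \<bar>measure Q A - measure R A\<bar>"
    by (simp flip: ennreal_plus)
  also have "\<dots> \<le> (SUP A\<in>sets P. ennreal \<bar>measure P A - measure Q A\<bar>) +
      (SUP A\<in>sets Q. ennreal \<bar>measure Q A - measure R A\<bar>)"
    using A assms by (intro add_mono SUP_upper) auto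
  finally show "ennreal \<bar>measure P A - measure R A\<bar> \<le>
     (SUP A\<in>sets P. ennreal \<bar>measure P A - measure Q A\<bar>) + (SUP A\<in>sets Q. ennreal \<bar>measure Q A - measure R A\<bar>)" .
qed

lemma total_variation_le_1:
  assumes "prob_space P" "prob_space Q"
  shows "total_variation P Q \<le> 1"
  unfolding ennreal_1[symmetric]
proof (rule total_variation_leI)
  interpret P: prob_space P by fact
  interpret Q: prob_space Q by fact
  show "\<bar>P.prob A - Q.prob A\<bar> \<le> 1" for A
    using P.prob_le_1[of A] Q.prob_le_1[of A] measure_nonneg[of P A] measure_nonneg[of Q A] by linarith
qed

text \<open>Under a kernel the event \<open>A\<close> becomes the function
  \<open>measure (K x) A\<close> with values in [0, 1], a randomized test. By the layer cake lemma
  it separates \<open>P\<close> and \<open>Q\<close> no better than events do.\<close>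

lemma total_variation_bind_le:
  assumes P: "P \<in> space (prob_algebra S)" and Q: "Q \<in> space (prob_algebra S)"
    and K: "K \<in> S \<rightarrow>\<^sub>M prob_algebra R"
  shows "total_variation (P \<bind> K) (Q \<bind> K) \<le> total_variation P Q"
proof -
  have p: "prob_space P" "sets P = sets S" and q: "prob_space Q" "sets Q = sets S"
    using P Q by (auto simp: space_prob_algebra)
  interpret P: prob_space P by fact
  interpret Q: prob_space Q by fact
  have fin: "total_variation P Q < top"
    using total_variation_le_1[OF p(1) q(1)] by (rule order.strict_trans1) simp
  define b where "b = enn2real (total_variation P Q)"
  have b: "total_variation P Q = ennreal b"
    using fin by (simp add: b_def)
  have bA: "\<bar>measure P A - measure Q A\<bar> \<le> b" if "A \<in> sets P" for A
  proof -
    have "ennreal \<bar>measure P A - measure Q A\<bar> \<le> ennreal b"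
      unfolding b[symmetric] total_variation_def using that by (rule SUP_upper)
    moreover have "0 \<le> b" by (simp add: b_def)
    ultimately show ?thesis by simp
  qed
  have KP: "K \<in> P \<rightarrow>\<^sub>M prob_algebra R" and KQ: "K \<in> Q \<rightarrow>\<^sub>M prob_algebra R"
    using K p(2) q(2) by (simp_all cong: measurable_cong_sets)
  have Kprob: "prob_space (K x)" if "x \<in> space P" for x
    using measurable_space[OF KP that] by (simp add: space_prob_algebra)
  show ?thesis
    unfolding b
  proof (rule total_variation_leI)
    fix A assume "A \<in> sets (P \<bind> K)"
    then have A: "A \<in> sets R" using sets_bind'[OF P K] by simp
    have mP: "measure (P \<bind> K) A = (\<integral>x. measure (K x) A \<partial>P)"
      using A KP by (intro P.measure_bind measurable_prob_algebraD)
    have mQ: "measure (Q \<bind> K) A = (\<integral>x. measure (K x) A \<partial>Q)"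
      using A KQ by (intro Q.measure_bind measurable_prob_algebraD)
    show "\<bar>measure (P \<bind> K) A - measure (Q \<bind> K) A\<bar> \<le> b"
      unfolding mP mQ
    proof (rule integral_diff_le_of_measure_diff_le)
      show "(\<lambda>x. measure (K x) A) \<in> borel_measurable P"
        using measurable_compose[OF KP measurable_measure_prob_algebra[OF A]] by simp
      show "measure (K x) A \<in> {0..1}" if "x \<in> space P" for x
        using prob_space.prob_le_1[OF Kprob[OF that]] by simp
    qed (use p q bA in auto)
  qed
qed

text \<open>Kernels are composed: the error of the first passes through the second without growing,
  by \<open>total_variation_bind_le\<close>. Since the infima need not be attained, they are taken
  one kernel at a time.\<close>

lemma deficiency_triangle:
  assumes E: "\<And>\<theta>. \<theta> \<in> \<Theta> \<Longrightarrow> snd E \<theta> \<in> space (prob_algebra (fst E))"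
    and E': "\<And>\<theta>. \<theta> \<in> \<Theta> \<Longrightarrow> snd E' \<theta> \<in> space (prob_algebra (fst E'))"
    and E'': "\<And>\<theta>. \<theta> \<in> \<Theta> \<Longrightarrow> snd E'' \<theta> \<in> space (prob_algebra (fst E''))"
  shows "deficiency \<Theta> E E'' \<le> deficiency \<Theta> E E' + deficiency \<Theta> E' E''"
proof -
  define a where "a K = (SUP \<theta>\<in>\<Theta>. total_variation (snd E \<theta> \<bind> K) (snd E' \<theta>))" for K
  define b where "b K = (SUP \<theta>\<in>\<Theta>. total_variation (snd E' \<theta> \<bind> K) (snd E'' \<theta>))" for K
  have le: "deficiency \<Theta> E E'' \<le> a K1 + b K2"
    if K1: "K1 \<in> fst E \<rightarrow>\<^sub>M prob_algebra (fst E')" and K2: "K2 \<in> fst E' \<rightarrow>\<^sub>M prob_algebra (fst E'')" for K1 K2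
  proof -
    let ?K = "\<lambda>x. K1 x \<bind> K2"
    have K: "?K \<in> fst E \<rightarrow>\<^sub>M prob_algebra (fst E'')"
      by (rule measurable_bind_prob_space[OF K1 K2])
    have "deficiency \<Theta> E E'' \<le> (SUP \<theta>\<in>\<Theta>. total_variation (snd E \<theta> \<bind> ?K) (snd E'' \<theta>))"
      unfolding deficiency_def using K by (rule INF_lower)
    also have "\<dots> \<le> a K1 + b K2"
    proof (rule SUP_least)
      fix \<theta> assume \<theta>: "\<theta> \<in> \<Theta>"
      let ?P = "snd E \<theta>" and ?P' = "snd E' \<theta>" and ?P'' = "snd E'' \<theta>"
      have K1P: "K1 \<in> ?P \<rightarrow>\<^sub>M subprob_algebra (fst E')"
        using measurable_prob_algebraD[OF K1] E[OF \<theta>]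
          by (simp add: space_prob_algebra cong: measurable_cong_sets)
      have PK1: "?P \<bind> K1 \<in> space (prob_algebra (fst E'))"
        using prob_space_bind'[OF E[OF \<theta>] K1] sets_bind'[OF E[OF \<theta>] K1] by (simp add: space_prob_algebra)
      have "?P \<bind> ?K = (?P \<bind> K1) \<bind> K2"
        by (rule bind_assoc[symmetric, OF K1P measurable_prob_algebraD[OF K2]])
      then have "total_variation (?P \<bind> ?K) ?P'' \<le>
          total_variation ((?P \<bind> K1) \<bind> K2) (?P' \<bind> K2) + total_variation (?P' \<bind> K2) ?P''"
        using sets_bind'[OF PK1 K2] sets_bind'[OF E'[OF \<theta>] K2] E''[OF \<theta>]
        by (auto intro!: total_variation_triangle simp: space_prob_algebra)
      also have "\<dots> \<le> total_variation (?P \<bind> K1) ?P' + total_variation (?P' \<bind> K2) ?P''"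
        by (intro add_right_mono total_variation_bind_le[OF PK1 E'[OF \<theta>] K2])
      also have "\<dots> \<le> a K1 + b K2"
        unfolding a_def b_def using \<theta> by (intro add_mono SUP_upper)
      finally show "total_variation (?P \<bind> ?K) ?P'' \<le> a K1 + b K2" .
    qed
    finally show ?thesis .
  qed
  \<comment> \<open>Subtracting \<open>d\<close> brings the infimum to stand alone, which is
    legitimate in \<open>ennreal\<close> for finite \<open>d\<close>; for infinite \<open>d\<close>
    the claim is trivial.\<close>
  have INF_add: "c \<le> (INF k\<in>S. f k) + d" if "\<And>k. k \<in> S \<Longrightarrow> c \<le> f k + d" for c d :: ennreal and f and S :: "'z set"
  proof (cases "d = top")
    case False
    have "c - d \<le> (INF k\<in>S. f k)"
      using that False by (intro INF_greatest) (auto simp: ennreal_minus_le_iff add.commute)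
    then show ?thesis using False by (auto simp: ennreal_minus_le_iff add.commute)
  qed simp
  have "deficiency \<Theta> E E'' \<le> deficiency \<Theta> E E' + b K2" if "K2 \<in> fst E' \<rightarrow>\<^sub>M prob_algebra (fst E'')" for K2
    unfolding deficiency_def[of _ E E'] a_def[symmetric] using le that by (intro INF_add) auto
  then show ?thesis
    unfolding deficiency_def[of _ E' E''] b_def[symmetric]
    using INF_add[of "fst E' \<rightarrow>\<^sub>M prob_algebra (fst E'')" "deficiency \<Theta> E E''" b "deficiency \<Theta> E E'"]
    by (simp add: add.commute)
qed

lemma le_cam_triangle:
  assumes "\<And>\<theta>. \<theta> \<in> \<Theta> \<Longrightarrow> snd E \<theta> \<in> space (prob_algebra (fst E))"
    and "\<And>\<theta>. \<theta> \<in> \<Theta> \<Longrightarrow> snd E' \<theta> \<in> space (prob_algebra (fst E'))"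
    and "\<And>\<theta>. \<theta> \<in> \<Theta> \<Longrightarrow> snd E'' \<theta> \<in> space (prob_algebra (fst E''))"
  shows "le_cam \<Theta> E E'' \<le> le_cam \<Theta> E E' + le_cam \<Theta> E' E''"
proof -
  have "deficiency \<Theta> E E'' \<le> deficiency \<Theta> E E' + deficiency \<Theta> E' E''"
    by (rule deficiency_triangle[OF assms])
  moreover have "deficiency \<Theta> E'' E \<le> deficiency \<Theta> E'' E' + deficiency \<Theta> E' E"
    by (rule deficiency_triangle[OF assms(3,2,1)])
  ultimately show ?thesis
    unfolding le_cam_def
    by (auto intro!: max.boundedI elim!: order_trans intro: add_mono simp: add.commute[of "deficiency \<Theta> E'' E'"])
qed

section \<open>Gaussian shifts\<close>

lemma measure_std_normal_distribution:
  assumes [measurable]: "A \<in> sets borel"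
  shows "measure std_normal_distribution A = (\<integral>x. indicator A x * std_normal_density x \<partial>lborel)"
proof -
  have "measure std_normal_distribution A = (\<integral>x. indicat_real A x \<partial>std_normal_distribution)" by simp
  also have "\<dots> = (\<integral>x. std_normal_density x *\<^sub>R indicator A x \<partial>lborel)"
    by (subst integral_density) auto
  finally show ?thesis by (simp add: mult.commute)
qed

lemma integrable_indicator_std_normal_density:
  "A \<in> sets borel \<Longrightarrow> integrable lborel (\<lambda>x. indicator A x * std_normal_density (x - \<delta>))"
  using integrable_real_mult_indicator[of A lborel "normal_density \<delta> 1"]
  by (simp add: normal_density_def mult.commute)

lemma measure_std_normal_shift:
  assumes [measurable]: "A \<in> sets borel"
  shows "measure (distr std_normal_distribution borel (\<lambda>y. y + \<delta>)) A =
    (\<integral>x. indicator A x * std_normal_density (x - \<delta>) \<partial>lborel)"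
proof -
  have "measure (distr std_normal_distribution borel (\<lambda>y. y + \<delta>)) A =
      measure std_normal_distribution ((\<lambda>y. y + \<delta>) -` A)"
    by (subst measure_distr) auto
  also have "\<dots> = (\<integral>x. indicator ((\<lambda>y. y + \<delta>) -` A) x * std_normal_density x \<partial>lborel)"
    using measurable_sets[of "\<lambda>y. y + \<delta>" borel borel A]
    by (intro measure_std_normal_distribution) auto
  also have "\<dots> = (\<integral>x. indicator A x * std_normal_density (x - \<delta>) \<partial>lborel)"
    by (subst (2) lborel_integral_real_affine[of 1 _ \<delta>]) (auto simp: indicator_def add.commute)
  finally show ?thesis .
qed

lemma std_normal_density_le_iff: "std_normal_density x \<le> std_normal_density y \<longleftrightarrow> y\<^sup>2 \<le> x\<^sup>2"
  by (simp add: std_normal_density_def divide_le_cancel)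

section \<open>The standard Gaussian distribution function\<close>

lemma Phi_ereal: "Phi (ereal u) = measure std_normal_distribution {..u}"
  by (simp add: Phi_def atMost_def)

lemma Phi_mono: "u \<le> v \<Longrightarrow> Phi u \<le> Phi v"
proof -
  assume uv: "u \<le> v"
  interpret prob_space std_normal_distribution by (rule prob_space_std_normal)
  have "{y. ereal y \<le> w} \<in> sets borel" for w by measurable
  then show ?thesis
    unfolding Phi_def using uv by (intro finite_measure_mono) (auto intro: order_trans)
qed

lemma Phi_minus: "Phi (ereal u) = 1 - Phi (ereal (- u))"
proof -
  have i: "integrable lborel (\<lambda>x. indicator A x * std_normal_density x)" if "A \<in> sets borel" for A
    using integrable_indicator_std_normal_density[OF that, of 0] by simp
  have "Phi (ereal (- u)) = (\<integral>x. indicator {..- u} x * std_normal_density x \<partial>lborel)"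
    unfolding Phi_ereal by (rule measure_std_normal_distribution) simp
  also have "\<dots> = (\<integral>x. indicator {u..} x * std_normal_density x \<partial>lborel)"
    by (subst lborel_integral_real_affine[of "- 1" _ 0])
      (auto simp: indicator_def std_normal_density_def intro!: Bochner_Integration.integral_cong)
  also have "\<dots> + Phi (ereal u) =
      (\<integral>x. indicator {u..} x * std_normal_density x + indicator {..u} x * std_normal_density x \<partial>lborel)"
    unfolding Phi_ereal using i by (subst measure_std_normal_distribution) auto
  \<comment> \<open>The two half-lines overlap in the point \<open>u\<close>, a null set.\<close>
  also have "\<dots> = (\<integral>x. std_normal_density x \<partial>lborel)"
    using AE_lborel_singleton[of u]
    by (intro integral_cong_AE) (auto elim!: eventually_mono simp: indicator_def)
  also have "\<dots> = 1" by simp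
  finally show ?thesis by simp
qed

text \<open>The left side is the Gaussian mass of an interval of length \<open>2 * u\<close>, and
  the density is at most 1 / sqrt (2 * pi) \<le> 1 / 2.\<close>

lemma Phi_bound:
  assumes "0 \<le> u"
  shows "1 - 2 * Phi (ereal (- u)) \<le> u"
proof -
  interpret prob_space std_normal_distribution by (rule prob_space_std_normal)
  have le: "std_normal_density x \<le> 1 / 2" for x
  proof -
    have "2 \<le> sqrt (2 * pi)" by (rule real_le_rsqrt) (use pi_gt3 in simp)
    then have "1 / sqrt (2 * pi) \<le> 1 / 2" by (intro divide_left_mono) auto
    moreover have "std_normal_density x \<le> 1 / sqrt (2 * pi)"
      by (simp add: std_normal_density_def divide_le_cancel)
    ultimately show ?thesis by linarith
  qed
  have "1 - 2 * Phi (ereal (- u)) = Phi (ereal u) - Phi (ereal (- u))"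
    using Phi_minus[of u] by simp
  also have "\<dots> = measure std_normal_distribution {- u<..u}"
  proof -
    have "measure std_normal_distribution ({..u} - {..- u}) = Phi (ereal u) - Phi (ereal (- u))"
      unfolding Phi_ereal using assms by (intro finite_measure_Diff) auto
    moreover have "{..u} - {..- u} = {- u<..u}" by auto
    ultimately show ?thesis by simp
  qed
  also have "\<dots> = (\<integral>x. indicator {- u<..u} x * std_normal_density x \<partial>lborel)"
    by (rule measure_std_normal_distribution) simp
  also have "\<dots> \<le> (\<integral>x. indicator {- u<..u} x * (1 / 2) \<partial>lborel)"
  proof (rule integral_mono)
    show "integrable lborel (\<lambda>x. indicat_real {- u<..u} x * std_normal_density x)"
      using integrable_indicator_std_normal_density[of "{- u<..u}" 0] by simp
    show "integrable lborel (\<lambda>x. indicat_real {- u<..u} x * (1 / 2))"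
      using assms by (intro integrable_mult_left integrable_real_indicator) auto
  qed (use le in \<open>auto intro!: mult_left_mono simp del: times_divide_eq_right\<close>)
  also have "\<dots> = u" using assms by simp
  finally show ?thesis .
qed

lemma total_variation_std_normal_shift:
  assumes "0 \<le> \<delta>"
  shows "total_variation std_normal_distribution (distr std_normal_distribution borel (\<lambda>y. y + \<delta>))
    \<le> ennreal (1 - 2 * Phi (ereal (- (\<delta> / 2))))" (is "total_variation ?P ?Q \<le> ennreal ?b")
proof (rule total_variation_leI)
  interpret P: prob_space ?P by (rule prob_space_std_normal)
  interpret Q: prob_space ?Q by (rule P.prob_space_distr) simp
  have i: "integrable lborel (\<lambda>x. indicator A x * std_normal_density x)"
      "integrable lborel (\<lambda>x. indicator A x * std_normal_density (x - \<delta>))" if "A \<in> sets borel" for A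
    using integrable_indicator_std_normal_density[OF that, of 0]
      integrable_indicator_std_normal_density[OF that] by simp_all
  have diff: "measure ?P A - measure ?Q A =
      (\<integral>x. indicator A x * (std_normal_density x - std_normal_density (x - \<delta>)) \<partial>lborel)"
    and int: "integrable lborel (\<lambda>x. indicator A x * (std_normal_density x - std_normal_density (x - \<delta>)))"
    if A: "A \<in> sets borel" for A
    using i[OF A] measure_std_normal_distribution[OF A] measure_std_normal_shift[OF A, of \<delta>]
    by (simp_all add: right_diff_distrib)
  \<comment> \<open>The densities cross at the midpoint. For \<open>\<delta> = 0\<close> they
    coincide, so the comparison holds everywhere.\<close>
  have le: "std_normal_density (x - \<delta>) \<le> std_normal_density x \<longleftrightarrow> \<delta> = 0 \<or> x \<le> \<delta> / 2" for x
  proof -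
    have "x\<^sup>2 \<le> (x - \<delta>)\<^sup>2 \<longleftrightarrow> \<delta> * x \<le> \<delta> * (\<delta> / 2)" by (simp add: power2_eq_square algebra_simps)
    moreover have "\<delta> * x \<le> \<delta> * (\<delta> / 2) \<longleftrightarrow> \<delta> = 0 \<or> x \<le> \<delta> / 2"
      using assms by (simp only: mult_le_cancel_left) auto
    ultimately show ?thesis unfolding std_normal_density_le_iff by simp
  qed
  text \<open>By Neyman--Pearson the half-line up to the midpoint separates the two laws best.\<close>
  have one_sided: "measure ?P A - measure ?Q A \<le> ?b" if A: "A \<in> sets borel" for A
  proof -
    have "measure ?P A - measure ?Q A \<le> measure ?P {..\<delta> / 2} - measure ?Q {..\<delta> / 2}"
      unfolding diff[OF A] diff[OF atMost_borel]
    proof (rule integral_mono[OF int[OF A] int[OF atMost_borel]])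
      fix x
      show "indicator A x * (std_normal_density x - std_normal_density (x - \<delta>)) \<le>
          indicator {..\<delta> / 2} x * (std_normal_density x - std_normal_density (x - \<delta>))"
        using le[of x] by (auto simp: indicator_def)
    qed
    also have "measure ?Q {..\<delta> / 2} = Phi (ereal (- (\<delta> / 2)))"
    proof -
      have "(\<lambda>y. y + \<delta>) -` {..\<delta> / 2} = {..- (\<delta> / 2)}" by auto
      then show ?thesis unfolding Phi_ereal by (subst measure_distr) auto
    qed
    also have "measure ?P {..\<delta> / 2} = 1 - Phi (ereal (- (\<delta> / 2)))"
      using Phi_minus[of "\<delta> / 2"] by (simp add: Phi_ereal)
    finally show ?thesis by simp
  qed
  fix A assume "A \<in> sets ?P"
  then have A: "A \<in> sets borel" by simp
  \<comment> \<open>Passing to the complement flips the sign of the difference, which turns the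
    one-sided bound into one for the absolute value.\<close>
  have "measure ?P (- A) = 1 - measure ?P A" "measure ?Q (- A) = 1 - measure ?Q A"
    using A P.prob_compl[of A] Q.prob_compl[of A] by (auto simp: Compl_eq_Diff_UNIV)
  moreover have "- A \<in> sets borel" using A by (simp add: borel_comp)
  ultimately show "\<bar>measure ?P A - measure ?Q A\<bar> \<le> ?b"
    using one_sided[OF A] one_sided[of "- A"] by (simp add: abs_le_iff)
qed

section \<open>Shifts of a Gaussian law along one direction\<close>

lemma gauss_law_line:
  "gauss_law I (\<lambda>i. b i + \<delta> * c i) (\<lambda>i j. c i * c j)
     (distr (distr std_normal_distribution borel (\<lambda>y. y + \<delta>)) (\<Pi>\<^sub>M i\<in>I. borel) (\<lambda>y. \<lambda>i\<in>I. b i + c i * y))"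
proof -
  interpret product_prob_space "\<lambda>_::nat. std_normal_distribution" "{0}"
    by (simp add: product_prob_space_def product_prob_space_axioms_def product_sigma_finite_def
        prob_space_std_normal prob_space_imp_sigma_finite)
  let ?N = "\<Pi>\<^sub>M l\<in>{0::nat}. std_normal_distribution"
  have c: "distr ?N borel (\<lambda>x. x 0 + \<delta>) = distr std_normal_distribution borel (\<lambda>y. y + \<delta>)"
    by (subst PiM_component[symmetric, of 0], simp, subst distr_distr) (auto simp: comp_def)
  have "gauss_law I (\<lambda>i. b i + \<delta> * c i) (\<lambda>i j. \<Sum>l\<in>{0::nat}. c i * c j)
     (distr ?N (\<Pi>\<^sub>M i\<in>I. borel) (\<lambda>x. \<lambda>i\<in>I. (b i + \<delta> * c i) + (\<Sum>l\<in>{0::nat}. c i * x l)))"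
    by (rule gauss_law_affine_std_normal) simp
  also have "distr ?N (\<Pi>\<^sub>M i\<in>I. borel) (\<lambda>x. \<lambda>i\<in>I. (b i + \<delta> * c i) + (\<Sum>l\<in>{0::nat}. c i * x l)) =
      distr (distr ?N borel (\<lambda>x. x 0 + \<delta>)) (\<Pi>\<^sub>M i\<in>I. borel) (\<lambda>y. \<lambda>i\<in>I. b i + c i * y)"
    by (subst distr_distr) (auto simp: comp_def algebra_simps intro!: measurable_restrict)
  finally show ?thesis unfolding c by simp
qed

text \<open>Let T be the functional with coefficients \<open>l q\<close> at the coordinates
  \<open>\<iota> q\<close>. By \<open>c\<close> and \<open>unit\<close> it has covariance
  \<open>c g\<close> with the coordinate \<open>g\<close> and variance 1, so subtracting
  \<open>c g\<close> times T leaves noise uncorrelated with T. The shift moves T by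
  \<open>\<delta>\<close> and does not touch that noise: the two laws arise from N(0, 1) and
  N(\<open>\<delta>\<close>, 1) by one kernel. In effect \<open>c\<close> is a unit vector of the
  Cameron-Martin space.\<close>

lemma total_variation_gauss_law_shift:
  assumes M: "gauss_law I \<mu> C M" and M': "gauss_law I (\<lambda>g. \<mu> g + \<delta> * c g) C M'" and \<delta>: "0 \<le> \<delta>"
    and Q: "finite Q" "\<And>q. q \<in> Q \<Longrightarrow> \<iota> q \<in> I"
    and sym: "\<And>g h. g \<in> I \<Longrightarrow> h \<in> I \<Longrightarrow> C g h = C h g"
    and c: "\<And>g. g \<in> I \<Longrightarrow> c g = (\<Sum>q\<in>Q. l q * C (\<iota> q) g)"
    and unit: "(\<Sum>q\<in>Q. l q * c (\<iota> q)) = 1"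
  shows "total_variation M M' \<le> ennreal (1 - 2 * Phi (ereal (- (\<delta> / 2))))"
proof -
  \<comment> \<open>The mean of T under \<open>M\<close>.\<close>
  define m where "m = (\<Sum>q\<in>Q. l q * \<mu> (\<iota> q))"
  define N where "N = distr M (\<Pi>\<^sub>M i\<in>I. borel) (\<lambda>\<omega>. \<lambda>g\<in>I. \<omega> g - (\<Sum>q\<in>Q. c g * l q * \<omega> (\<iota> q)))"
  have N: "gauss_law I (\<lambda>g. \<mu> g - c g * m) (\<lambda>g h. C g h - c g * c h) N"
    unfolding N_def
  proof (rule gauss_law_cong[OF gauss_law_residual[OF M Q]])
    fix g h assume gh: "g \<in> I" "h \<in> I"
    have 1: "(\<Sum>q\<in>Q. c h * l q * C g (\<iota> q)) = c h * c g"
      using Q gh sym by (simp add: c sum_distrib_left mult.assoc)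
    have 2: "(\<Sum>q\<in>Q. c g * l q * C (\<iota> q) h) = c g * c h"
      using gh by (simp add: c[of h] sum_distrib_left mult.assoc)
    have "(\<Sum>p\<in>Q. \<Sum>q\<in>Q. c g * l p * (c h * l q) * C (\<iota> p) (\<iota> q)) =
        c g * c h * (\<Sum>q\<in>Q. l q * (\<Sum>p\<in>Q. l p * C (\<iota> p) (\<iota> q)))"
      by (subst sum.swap) (simp add: sum_distrib_left mult_ac)
    also have "(\<Sum>q\<in>Q. l q * (\<Sum>p\<in>Q. l p * C (\<iota> p) (\<iota> q))) = 1"
      using Q unit by (simp add: c[symmetric])
    finally show "C g h - (\<Sum>q\<in>Q. c h * l q * C g (\<iota> q)) - (\<Sum>q\<in>Q. c g * l q * C (\<iota> q) h) +
        (\<Sum>p\<in>Q. \<Sum>q\<in>Q. c g * l p * (c h * l q) * C (\<iota> p) (\<iota> q)) = C g h - c g * c h"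
      unfolding 1 2 by simp
  qed (simp_all add: m_def sum_distrib_left mult_ac)
  \<comment> \<open>The input \<open>y\<close> stands for T - \<open>m\<close>, so the mean that was
    removed from \<open>N\<close> is added back here.\<close>
  define V where "V y = (\<lambda>g\<in>I. c g * m + c g * y)" for y
  define K where "K z = distr N (\<Pi>\<^sub>M i\<in>I. borel) (\<lambda>\<omega>. \<lambda>i\<in>I. V z i + \<omega> i)" for z
  have V: "V \<in> borel \<rightarrow>\<^sub>M (\<Pi>\<^sub>M i\<in>I. borel)"
    unfolding V_def[abs_def] by (intro measurable_restrict) auto
  let ?R = "\<lambda>d. distr std_normal_distribution borel (\<lambda>y. y + d)"
  have R: "prob_space (?R d)" "sets (?R d) = sets borel" for d
    by (auto intro!: prob_space.prob_space_distr prob_space_std_normal)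
  \<comment> \<open>\<open>d = 0\<close> will reproduce \<open>M\<close> and
    \<open>d = \<delta>\<close> will reproduce \<open>M'\<close>.\<close>
  have bind: "gauss_law I (\<lambda>g. \<mu> g + d * c g) C (?R d \<bind> K)" for d
    unfolding K_def V_def
    by (rule gauss_law_cong[OF gauss_law_bind_add(2)[OF R V[unfolded V_def[abs_def]] gauss_law_line N]])
      (simp_all add: algebra_simps)
  have K: "K \<in> borel \<rightarrow>\<^sub>M prob_algebra (\<Pi>\<^sub>M i\<in>I. borel)"
    unfolding K_def[abs_def] V_def
    by (rule gauss_law_bind_add(1)[OF R V[unfolded V_def[abs_def]] gauss_law_line N])
  have M_eq: "M = ?R 0 \<bind> K" using bind[of 0] M by (intro gauss_law_unique) auto
  have M'_eq: "M' = ?R \<delta> \<bind> K" using bind[of \<delta>] M' by (intro gauss_law_unique) auto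
  have "total_variation M M' \<le> total_variation (?R 0) (?R \<delta>)"
    unfolding M_eq M'_eq 
    by (intro total_variation_bind_le[OF _ _ K])
      (use R(1)[of 0] R(1)[of \<delta>] in \<open>simp_all add: space_prob_algebra\<close>)
  also have "?R 0 = std_normal_distribution" by (simp add: distr_id2)
  finally show ?thesis using total_variation_std_normal_shift[OF \<delta>] by simp
qed

section \<open>Polynomials and square-integrable functions on the sphere\<close>

lemma polynomials_add:
  "p \<in> polynomials d L \<Longrightarrow> q \<in> polynomials d L \<Longrightarrow> (\<lambda>x. p x + q x) \<in> polynomials d L"
proof -
  assume "p \<in> polynomials d L" "q \<in> polynomials d L"
  then obtain a b where "p = (\<lambda>x. \<Sum>\<alpha>\<in>multi_indices d L. a \<alpha> * (\<Prod>i\<le>d. x i ^ \<alpha> i))"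
    "q = (\<lambda>x. \<Sum>\<alpha>\<in>multi_indices d L. b \<alpha> * (\<Prod>i\<le>d. x i ^ \<alpha> i))"
    by (auto simp: polynomials_def)
  then have "(\<lambda>x. p x + q x) = (\<lambda>x. \<Sum>\<alpha>\<in>multi_indices d L. (a \<alpha> + b \<alpha>) * (\<Prod>i\<le>d. x i ^ \<alpha> i))"
    by (simp add: distrib_right sum.distrib)
  then show ?thesis unfolding polynomials_def by (auto intro!: exI[of _ "\<lambda>\<alpha>. a \<alpha> + b \<alpha>"])
qed

lemma polynomials_0: "(\<lambda>x. 0) \<in> polynomials d L"
  unfolding polynomials_def by (auto intro!: exI[of _ "\<lambda>_. 0"])

lemma polynomials_sum:
  "(\<And>a. a \<in> A \<Longrightarrow> p a \<in> polynomials d L) \<Longrightarrow> (\<lambda>x. \<Sum>a\<in>A. p a x) \<in> polynomials d L"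
  by (induction A rule: infinite_finite_induct) (simp_all add: polynomials_0 polynomials_add)

lemma polynomials_monomial:
  assumes "\<alpha> \<in> multi_indices d L"
  shows "(\<lambda>x. c * (\<Prod>i\<le>d. x i ^ \<alpha> i)) \<in> polynomials d L"
proof -
  have "(\<lambda>x. c * (\<Prod>i\<le>d. x i ^ \<alpha> i)) =
      (\<lambda>x. \<Sum>\<beta>\<in>multi_indices d L. (if \<beta> = \<alpha> then c else 0) * (\<Prod>i\<le>d. x i ^ \<beta> i))"
    using assms by (simp add: if_distrib[of "\<lambda>a. a * _"] finite_multi_indices cong: if_cong)
  then show ?thesis unfolding polynomials_def by (auto intro!: exI[of _ "\<lambda>\<beta>. if \<beta> = \<alpha> then c else 0"])
qed

lemma polynomials_mult:
  assumes "p \<in> polynomials d L" "q \<in> polynomials d L'" "L + L' \<le> t"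
  shows "(\<lambda>x. p x * q x) \<in> polynomials d t"
proof -
  obtain a b where "p = (\<lambda>x. \<Sum>\<alpha>\<in>multi_indices d L. a \<alpha> * (\<Prod>i\<le>d. x i ^ \<alpha> i))"
    "q = (\<lambda>x. \<Sum>\<alpha>\<in>multi_indices d L'. b \<alpha> * (\<Prod>i\<le>d. x i ^ \<alpha> i))"
    using assms by (auto simp: polynomials_def)
  then have "(\<lambda>x. p x * q x) = (\<lambda>x. \<Sum>\<alpha>\<in>multi_indices d L. \<Sum>\<beta>\<in>multi_indices d L'.
      (a \<alpha> * b \<beta>) * (\<Prod>i\<le>d. x i ^ (\<lambda>i\<in>{..d}. \<alpha> i + \<beta> i) i))"
    by (simp add: sum_product power_add prod.distrib mult_ac)
  also have "\<dots> \<in> polynomials d t"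
  proof (intro polynomials_sum polynomials_monomial)
    fix \<alpha> \<beta> assume "\<alpha> \<in> multi_indices d L" "\<beta> \<in> multi_indices d L'"
    then show "(\<lambda>i\<in>{..d}. \<alpha> i + \<beta> i) \<in> multi_indices d t"
      using assms(3) by (auto simp: multi_indices_def sum.distrib)
  qed
  finally show ?thesis .
qed

text \<open>The product of the polynomial representatives has degree at most \<open>2 * L\<close>.
  They agree with \<open>f\<close> and \<open>g\<close> on the sphere, which contains the design
  points and carries the measure.\<close>

lemma spherical_design_emp_inner:
  assumes D: "spherical_design d t n x" and t: "2 * L \<le> t"
    and f: "f \<in> sphere_polynomials d L" and g: "g \<in> sphere_polynomials d L"
  shows "emp_inner n x f g = L2_inner d f g"
proof -
  obtain p q where p: "p \<in> polynomials d L" "\<And>y. y \<in> unit_sphere d \<Longrightarrow> f y = p y"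
    and q: "q \<in> polynomials d L" "\<And>y. y \<in> unit_sphere d \<Longrightarrow> g y = q y"
    using f g by (auto simp: sphere_polynomials_def)
  have "(\<lambda>y. p y * q y) \<in> polynomials d t"
    using p q t by (intro polynomials_mult) auto
  then have "(\<Sum>i=1..n. p (x i) * q (x i)) / real n = (\<integral>y. p y * q y \<partial>sphere_measure d)"
    using D by (auto simp: spherical_design_def)
  moreover have "x i \<in> unit_sphere d" if "i \<in> {1..n}" for i
    using D that by (auto simp: spherical_design_def)
  moreover have "(\<integral>y. p y * q y \<partial>sphere_measure d) = L2_inner d f g"
    unfolding L2_inner_def using p(2) q(2)
    by (intro Bochner_Integration.integral_cong) (auto simp: space_sphere_measure)
  ultimately show ?thesis using p(2) q(2) by (simp add: emp_inner_def)
qed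

section \<open>The L2 semi-inner product on genuine functions\<close>

lemma L2_sphere_integrable_mult:
  assumes "f \<in> L2_sphere d" "g \<in> L2_sphere d"
  shows "integrable (sphere_measure d) (\<lambda>x. f x * g x)"
proof (rule Bochner_Integration.integrable_bound)
  show "integrable (sphere_measure d) (\<lambda>x. (f x)\<^sup>2 + (g x)\<^sup>2)"
    using assms by (auto simp: L2_sphere_def)
  show "(\<lambda>x. f x * g x) \<in> borel_measurable (sphere_measure d)"
    using assms by (auto simp: L2_sphere_def)
  have "\<bar>a * b\<bar> \<le> a\<^sup>2 + b\<^sup>2" for a b :: real
    using sum_squares_bound[of a b] sum_squares_bound[of a "- b"] zero_le_power2[of a] zero_le_power2[of b]
    unfolding abs_le_iff by simp
  then show "AE x in sphere_measure d. norm (f x * g x) \<le> norm ((f x)\<^sup>2 + (g x)\<^sup>2)"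
    by (intro AE_I2) simp
qed

lemma L2_sphere_add: "f \<in> L2_sphere d \<Longrightarrow> g \<in> L2_sphere d \<Longrightarrow> (\<lambda>x. f x + g x) \<in> L2_sphere d"
  using L2_sphere_integrable_mult[of f d g]
  by (auto simp: L2_sphere_def power2_sum mult.assoc)

lemma L2_sphere_cmult: "f \<in> L2_sphere d \<Longrightarrow> (\<lambda>x. c * f x) \<in> L2_sphere d"
  by (auto simp: L2_sphere_def power_mult_distrib)

lemma L2_sphere_diff: "f \<in> L2_sphere d \<Longrightarrow> g \<in> L2_sphere d \<Longrightarrow> (\<lambda>x. f x - g x) \<in> L2_sphere d"
  using L2_sphere_add[OF _ L2_sphere_cmult[of g d "- 1"], of f] by simp

lemma L2_sphere_0: "(\<lambda>x. 0) \<in> L2_sphere d"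
  by (simp add: L2_sphere_def)

lemma L2_sphere_sum:
  "(\<And>a. a \<in> A \<Longrightarrow> f a \<in> L2_sphere d) \<Longrightarrow> (\<lambda>x. \<Sum>a\<in>A. f a x) \<in> L2_sphere d"
  by (induction A rule: infinite_finite_induct) (simp_all add: L2_sphere_0 L2_sphere_add)

lemma L2_inner_commute: "L2_inner d f g = L2_inner d g f"
  by (simp add: L2_inner_def mult.commute)

lemma L2_inner_add_left:
  "f \<in> L2_sphere d \<Longrightarrow> f' \<in> L2_sphere d \<Longrightarrow> g \<in> L2_sphere d \<Longrightarrow>
    L2_inner d (\<lambda>x. f x + f' x) g = L2_inner d f g + L2_inner d f' g"
  by (simp add: L2_inner_def distrib_right L2_sphere_integrable_mult)

lemma L2_inner_diff_left:
  "f \<in> L2_sphere d \<Longrightarrow> f' \<in> L2_sphere d \<Longrightarrow> g \<in> L2_sphere d \<Longrightarrow>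
    L2_inner d (\<lambda>x. f x - f' x) g = L2_inner d f g - L2_inner d f' g"
  by (simp add: L2_inner_def left_diff_distrib L2_sphere_integrable_mult)

lemma L2_inner_cmult_left: "L2_inner d (\<lambda>x. c * f x) g = c * L2_inner d f g"
  by (simp add: L2_inner_def mult.assoc)

lemma L2_inner_sum_left:
  "(\<And>a. a \<in> A \<Longrightarrow> f a \<in> L2_sphere d) \<Longrightarrow> g \<in> L2_sphere d \<Longrightarrow>
    L2_inner d (\<lambda>x. \<Sum>a\<in>A. c a * f a x) g = (\<Sum>a\<in>A. c a * L2_inner d (f a) g)"
proof (induction A rule: infinite_finite_induct)
  case (insert a A)
  have "(\<lambda>x. c a * f a x) \<in> L2_sphere d" "(\<lambda>x. \<Sum>a\<in>A. c a * f a x) \<in> L2_sphere d"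
    using insert.prems by (auto intro!: L2_sphere_sum L2_sphere_cmult)
  with insert show ?case by (simp add: L2_inner_add_left L2_inner_cmult_left)
qed (simp_all add: L2_inner_def)

lemma L2_sphere_residual:
  assumes "f \<in> L2_sphere d" "\<And>k. k < r \<Longrightarrow> e k \<in> L2_sphere d"
  shows "(\<lambda>x. f x - (\<Sum>k<r. a k * e k x)) \<in> L2_sphere d"
  using assms by (intro L2_sphere_diff L2_sphere_sum L2_sphere_cmult) auto

lemma L2_inner_residual:
  assumes "f \<in> L2_sphere d" "\<And>k. k < r \<Longrightarrow> e k \<in> L2_sphere d" "g \<in> L2_sphere d"
  shows "L2_inner d (\<lambda>x. f x - (\<Sum>k<r. a k * e k x)) g =
    L2_inner d f g - (\<Sum>k<r. a k * L2_inner d (e k) g)"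
proof -
  have "(\<lambda>x. \<Sum>k<r. a k * e k x) \<in> L2_sphere d"
    using assms by (intro L2_sphere_sum L2_sphere_cmult) auto
  moreover have "L2_inner d (\<lambda>x. \<Sum>k<r. a k * e k x) g = (\<Sum>k<r. a k * L2_inner d (e k) g)"
    using assms by (intro L2_inner_sum_left) auto
  ultimately show ?thesis using assms by (simp add: L2_inner_diff_left)
qed

lemma L2_inner_nonneg: "0 \<le> L2_inner d f f"
  by (simp add: L2_inner_def integral_nonneg)

text \<open>Stands in for definiteness, which fails on genuine functions: zero norm means zero
  almost everywhere, and this is invisible to all inner products.\<close>

lemma L2_inner_null:
  assumes "f \<in> L2_sphere d" "g \<in> L2_sphere d" and null: "L2_inner d f f = 0"
  shows "L2_inner d f g = 0"
proof -
  have "AE x in sphere_measure d. f x * f x = 0"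
    using null L2_sphere_integrable_mult[OF assms(1,1)]
    by (subst integral_nonneg_eq_0_iff_AE[symmetric]) (auto simp: L2_inner_def)
  then have "AE x in sphere_measure d. f x * g x = 0" by eventually_elim simp
  then show ?thesis unfolding L2_inner_def by (rule integral_eq_zero_AE)
qed

section \<open>Linear spans and orthonormal systems\<close>

lemma linear_span_L2_sphere:
  "(\<And>j. j \<in> {1..m} \<Longrightarrow> \<psi> j \<in> L2_sphere d) \<Longrightarrow> f \<in> linear_span m \<psi> \<Longrightarrow> f \<in> L2_sphere d"
  unfolding linear_span_def by (clarsimp, intro L2_sphere_sum L2_sphere_cmult) auto

lemma linear_span_add: "f \<in> linear_span m \<psi> \<Longrightarrow> g \<in> linear_span m \<psi> \<Longrightarrow> (\<lambda>x. f x + g x) \<in> linear_span m \<psi>"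
proof -
  assume "f \<in> linear_span m \<psi>" "g \<in> linear_span m \<psi>"
  then obtain a b where "f = (\<lambda>x. \<Sum>j=1..m. a j * \<psi> j x)" "g = (\<lambda>x. \<Sum>j=1..m. b j * \<psi> j x)"
    by (auto simp: linear_span_def)
  then have "(\<lambda>x. f x + g x) = (\<lambda>x. \<Sum>j=1..m. (a j + b j) * \<psi> j x)"
    by (simp add: distrib_right sum.distrib)
  then show ?thesis unfolding linear_span_def by (auto intro!: exI[of _ "\<lambda>j. a j + b j"])
qed

lemma linear_span_cmult: "f \<in> linear_span m \<psi> \<Longrightarrow> (\<lambda>x. c * f x) \<in> linear_span m \<psi>"
proof -
  assume "f \<in> linear_span m \<psi>"
  then obtain a where "f = (\<lambda>x. \<Sum>j=1..m. a j * \<psi> j x)"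
    by (auto simp: linear_span_def)
  then have "(\<lambda>x. c * f x) = (\<lambda>x. \<Sum>j=1..m. (c * a j) * \<psi> j x)"
    by (simp add: sum_distrib_left mult.assoc)
  then show ?thesis unfolding linear_span_def by (auto intro!: exI[of _ "\<lambda>j. c * a j"])
qed

lemma linear_span_sum:
  "(\<And>a. a \<in> A \<Longrightarrow> f a \<in> linear_span m \<psi>) \<Longrightarrow> (\<lambda>x. \<Sum>a\<in>A. f a x) \<in> linear_span m \<psi>"
proof (induction A rule: infinite_finite_induct)
  case (insert a A)
  then show ?case by (simp add: linear_span_add)
qed (auto simp: linear_span_def intro!: exI[of _ "\<lambda>_. 0"])

lemma linear_span_base: "j \<in> {1..m} \<Longrightarrow> \<psi> j \<in> linear_span m \<psi>"
  by (auto simp: linear_span_def if_distrib[of "\<lambda>a. a * _"] intro!: exI[of _ "\<lambda>i. if i = j then 1 else 0"] cong: if_cong)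

lemma linear_span_Suc: "linear_span m \<psi> \<subseteq> linear_span (Suc m) \<psi>"
proof
  fix f assume "f \<in> linear_span m \<psi>"
  then obtain a where "f = (\<lambda>x. \<Sum>j=1..m. a j * \<psi> j x)"
    by (auto simp: linear_span_def)
  then have "f = (\<lambda>x. \<Sum>j=1..Suc m. (if j = Suc m then 0 else a j) * \<psi> j x)"
    by (simp add: fun_eq_iff)
  then show "f \<in> linear_span (Suc m) \<psi>" unfolding linear_span_def mem_Collect_eq
    by (intro exI[of _ "\<lambda>j. if j = Suc m then 0 else a j"] conjI TrueI)
qed

text \<open>
  Gram--Schmidt for the semi-inner product on genuine functions: the \<open>\<psi> j\<close> are recovered from the
  orthonormal system only up to a function of zero norm.
\<close>

lemma L2_orthonormal_system:
  assumes "\<forall>j\<in>{1..m}. \<psi> j \<in> L2_sphere d"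
  shows "\<exists>(r::nat) e. (\<forall>k<r. e k \<in> linear_span m \<psi>) \<and>
    (\<forall>k<r. \<forall>l<r. L2_inner d (e k) (e l) = (if k = l then 1 else 0)) \<and>
    (\<forall>j\<in>{1..m}. (let \<rho> = (\<lambda>x. \<psi> j x - (\<Sum>k<r. L2_inner d (\<psi> j) (e k) * e k x)) in L2_inner d \<rho> \<rho> = 0))"
  using assms
proof (induction m)
  case 0
  show ?case by (rule exI[of _ 0]) simp
next
  case (Suc m)
  have "\<forall>j\<in>{1..m}. \<psi> j \<in> L2_sphere d" using Suc.prems by auto
  from Suc.IH[OF this] obtain r :: nat and e where e: "\<And>k. k < r \<Longrightarrow> e k \<in> linear_span m \<psi>"
    and on: "\<And>k l. k < r \<Longrightarrow> l < r \<Longrightarrow> L2_inner d (e k) (e l) = (if k = l then 1 else 0)"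
    and res: "\<And>j. j \<in> {1..m} \<Longrightarrow> (let \<rho> = (\<lambda>x. \<psi> j x - (\<Sum>k<r. L2_inner d (\<psi> j) (e k) * e k x)) in L2_inner d \<rho> \<rho> = 0)"
    by blast
  have eL2: "e k \<in> L2_sphere d" if "k < r" for k
    using linear_span_L2_sphere[OF _ e[OF that]] Suc.prems by auto
  have \<psi>L2: "\<psi> (Suc m) \<in> L2_sphere d" using Suc.prems by auto
  define \<rho> where "\<rho> = (\<lambda>x. \<psi> (Suc m) x - (\<Sum>k<r. L2_inner d (\<psi> (Suc m)) (e k) * e k x))"
  have \<rho>L2: "\<rho> \<in> L2_sphere d" unfolding \<rho>_def using \<psi>L2 eL2 by (rule L2_sphere_residual)
  have \<rho>_inner: "L2_inner d \<rho> g =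
      L2_inner d (\<psi> (Suc m)) g - (\<Sum>k<r. L2_inner d (\<psi> (Suc m)) (e k) * L2_inner d (e k) g)"
    if "g \<in> L2_sphere d" for g
    unfolding \<rho>_def using \<psi>L2 eL2 that by (rule L2_inner_residual)
  have perp: "L2_inner d \<rho> (e l) = 0" if "l < r" for l
  proof -
    have "L2_inner d \<rho> (e l) = L2_inner d (\<psi> (Suc m)) (e l) -
        (\<Sum>k<r. L2_inner d (\<psi> (Suc m)) (e k) * L2_inner d (e k) (e l))"
      by (rule \<rho>_inner[OF eL2[OF that]])
    also have "\<dots> = 0" using that by (simp add: on if_distrib[of "\<lambda>a. _ * a"] cong: if_cong)
    finally show ?thesis .
  qed
  then have perp': "L2_inner d (e l) \<rho> = 0" if "l < r" for l
    using that by (simp only: L2_inner_commute[of d "e l" \<rho>])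
  show ?case
  proof (cases "L2_inner d \<rho> \<rho> = 0")
    case True
    \<comment> \<open>Up to a null function, \<open>\<psi> (Suc m)\<close> adds no direction, so the
      old system is kept.\<close>
    have "\<forall>j\<in>{1..Suc m}. (let \<rho> = (\<lambda>x. \<psi> j x - (\<Sum>k<r. L2_inner d (\<psi> j) (e k) * e k x)) in L2_inner d \<rho> \<rho> = 0)"
      using res True by (auto simp: atLeastAtMostSuc_conv \<rho>_def Let_def)
    then show ?thesis using e on linear_span_Suc by blast
  next
    case False
    then have pos: "0 < L2_inner d \<rho> \<rho>" using L2_inner_nonneg[of d \<rho>] by simp
    define s where "s = sqrt (L2_inner d \<rho> \<rho>)"
    have s: "0 < s" "s * s = L2_inner d \<rho> \<rho>" using pos by (auto simp: s_def)
    define e' where "e' k = (if k < r then e k else (\<lambda>x. inverse s * \<rho> x))" for k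
    have \<rho>span: "\<rho> \<in> linear_span (Suc m) \<psi>"
    proof -
      have "(\<lambda>x. \<psi> (Suc m) x + (- 1) * (\<Sum>k<r. L2_inner d (\<psi> (Suc m)) (e k) * e k x)) \<in> linear_span (Suc m) \<psi>"
        using e linear_span_Suc
        by (intro linear_span_add linear_span_base linear_span_cmult linear_span_sum) auto
      then show ?thesis by (simp add: \<rho>_def)
    qed
    have 1: "e' k \<in> linear_span (Suc m) \<psi>" for k
      using e linear_span_Suc \<rho>span by (auto simp: e'_def intro: linear_span_cmult)
    have "L2_inner d (\<lambda>x. inverse s * \<rho> x) (\<lambda>x. inverse s * \<rho> x) = inverse s * (inverse s * (s * s))"
      unfolding s(2) by (simp only: L2_inner_cmult_left L2_inner_commute[of d \<rho> "\<lambda>x. inverse s * \<rho> x"])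
    moreover have "inverse s * (inverse s * (s * s)) = 1" using s(1) by (simp add: field_simps)
    ultimately have \<rho>\<rho>: "L2_inner d (\<lambda>x. inverse s * \<rho> x) (\<lambda>x. inverse s * \<rho> x) = 1" by simp
    have 2: "L2_inner d (e' k) (e' l) = (if k = l then 1 else 0)" if "k < Suc r" "l < Suc r" for k l
      using that on perp \<rho>\<rho>
      by (auto simp: e'_def L2_inner_cmult_left L2_inner_commute[of d "e _" "\<lambda>x. inverse s * \<rho> x"])
    have sum: "(\<Sum>k<Suc r. L2_inner d f (e' k) * e' k x) =
        (\<Sum>k<r. L2_inner d f (e k) * e k x) + inverse s * inverse s * L2_inner d \<rho> f * \<rho> x" for f x
      by (simp add: e'_def L2_inner_cmult_left L2_inner_commute[of d f "\<lambda>x. inverse s * \<rho> x"])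
    have 3: "let \<rho> = (\<lambda>x. \<psi> j x - (\<Sum>k<Suc r. L2_inner d (\<psi> j) (e' k) * e' k x)) in L2_inner d \<rho> \<rho> = 0"
      if "j \<in> {1..Suc m}" for j
    proof (cases "j = Suc m")
      case True
      \<comment> \<open>\<open>\<psi> (Suc m)\<close> is \<open>\<rho>\<close> plus a combination of
        the \<open>e k\<close>, which are orthogonal to \<open>\<rho>\<close>. Its component along
        the new vector is therefore \<open>\<rho>\<close> itself and cancels the residual
        exactly.\<close>
      have j\<rho>: "L2_inner d \<rho> (\<psi> j) = L2_inner d \<rho> \<rho>"
        using \<rho>_inner[OF \<rho>L2] perp' True L2_inner_commute[of d \<rho> "\<psi> (Suc m)"] by simp
      have one: "inverse s * inverse s * L2_inner d \<rho> \<rho> = 1"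
        unfolding s(2)[symmetric] using s(1) by (simp add: field_simps)
      have "\<psi> j x - (\<Sum>k<Suc r. L2_inner d (\<psi> j) (e' k) * e' k x) = 0" for x
      proof -
        have "\<psi> j x - (\<Sum>k<Suc r. L2_inner d (\<psi> j) (e' k) * e' k x) =
            \<psi> j x - (\<Sum>k<r. L2_inner d (\<psi> j) (e k) * e k x) - \<rho> x"
          unfolding sum j\<rho> one by simp
        then show ?thesis by (simp add: True \<rho>_def)
      qed
      then have "(\<lambda>x. \<psi> j x - (\<Sum>k<Suc r. L2_inner d (\<psi> j) (e' k) * e' k x)) = (\<lambda>x. 0)" by (rule ext)
      then show ?thesis by (simp add: L2_inner_def)
    next
      case False
      with that have j: "j \<in> {1..m}" by auto
      have \<psi>j: "\<psi> j \<in> L2_sphere d" using Suc.prems j by auto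
      define \<tau> where "\<tau> = (\<lambda>x. \<psi> j x - (\<Sum>k<r. L2_inner d (\<psi> j) (e k) * e k x))"
      have \<tau>L2: "\<tau> \<in> L2_sphere d" unfolding \<tau>_def using \<psi>j eL2 by (rule L2_sphere_residual)
      have \<tau>0: "L2_inner d \<tau> \<tau> = 0" using res[OF j] by (simp add: \<tau>_def Let_def)
      \<comment> \<open>\<open>\<tau>\<close> and the \<open>e k\<close> are orthogonal to
        \<open>\<rho>\<close>, hence so is \<open>\<psi> j\<close>: the new vector leaves the old
        residual \<open>\<tau>\<close> unchanged.\<close>
      have "L2_inner d \<tau> \<rho> = L2_inner d (\<psi> j) \<rho> - (\<Sum>k<r. L2_inner d (\<psi> j) (e k) * L2_inner d (e k) \<rho>)"
        unfolding \<tau>_def using \<psi>j eL2 \<rho>L2 by (rule L2_inner_residual)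
      also have "L2_inner d \<tau> \<rho> = 0" by (rule L2_inner_null[OF \<tau>L2 \<rho>L2 \<tau>0])
      finally have "L2_inner d \<rho> (\<psi> j) = 0" using perp' L2_inner_commute[of d \<rho> "\<psi> j"] by simp
      then have "(\<lambda>x. \<psi> j x - (\<Sum>k<Suc r. L2_inner d (\<psi> j) (e' k) * e' k x)) = \<tau>"
        unfolding sum by (simp add: \<tau>_def)
      then show ?thesis using \<tau>0 by simp
    qed
    show ?thesis using 1 2 3 by blast
  qed
qed

text \<open>Here \<open>g\<close> may lie outside the span: the residual of each
  \<open>\<psi> j\<close> has zero norm and so vanishes against any square-integrable
  \<open>g\<close>, and linearity carries this over to \<open>h\<close>.\<close>

lemma L2_orthonormal_expansion:
  assumes \<psi>_L2: "\<forall>j\<in>{1..m}. \<psi> j \<in> L2_sphere d"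
  obtains r :: nat and e where "\<And>k. k < r \<Longrightarrow> e k \<in> linear_span m \<psi>"
    "\<And>k l. k < r \<Longrightarrow> l < r \<Longrightarrow> L2_inner d (e k) (e l) = (if k = l then 1 else 0)"
    "\<And>h g. h \<in> linear_span m \<psi> \<Longrightarrow> g \<in> L2_sphere d \<Longrightarrow>
       L2_inner d h g = (\<Sum>k<r. L2_inner d h (e k) * L2_inner d (e k) g)"
proof -
  have \<psi>: "\<psi> j \<in> L2_sphere d" if "j \<in> {1..m}" for j using \<psi>_L2 that by blast
  from L2_orthonormal_system[OF \<psi>_L2] obtain r :: nat and e where e: "\<And>k. k < r \<Longrightarrow> e k \<in> linear_span m \<psi>"
    and on: "\<And>k l. k < r \<Longrightarrow> l < r \<Longrightarrow> L2_inner d (e k) (e l) = (if k = l then 1 else 0)"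
    and res: "\<And>j. j \<in> {1..m} \<Longrightarrow>
      (let \<rho> = (\<lambda>x. \<psi> j x - (\<Sum>k<r. L2_inner d (\<psi> j) (e k) * e k x)) in L2_inner d \<rho> \<rho> = 0)"
    by blast
  have eL2: "e k \<in> L2_sphere d" if "k < r" for k
    using \<psi> e[OF that] by (rule linear_span_L2_sphere)
  have base: "L2_inner d (\<psi> j) g = (\<Sum>k<r. L2_inner d (\<psi> j) (e k) * L2_inner d (e k) g)"
    if j: "j \<in> {1..m}" and g: "g \<in> L2_sphere d" for j g
  proof -
    let ?\<rho> = "\<lambda>x. \<psi> j x - (\<Sum>k<r. L2_inner d (\<psi> j) (e k) * e k x)"
    have \<rho>: "?\<rho> \<in> L2_sphere d" using \<psi>[OF j] eL2 by (rule L2_sphere_residual)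
    have "L2_inner d ?\<rho> g = 0"
      using res[OF j] by (intro L2_inner_null[OF \<rho> g]) (simp add: Let_def)
    moreover have "L2_inner d ?\<rho> g =
        L2_inner d (\<psi> j) g - (\<Sum>k<r. L2_inner d (\<psi> j) (e k) * L2_inner d (e k) g)"
      using \<psi>[OF j] eL2 g by (rule L2_inner_residual)
    ultimately show ?thesis by simp
  qed
  have "L2_inner d h g = (\<Sum>k<r. L2_inner d h (e k) * L2_inner d (e k) g)"
    if h: "h \<in> linear_span m \<psi>" and g: "g \<in> L2_sphere d" for h g
  proof -
    obtain a where a: "h = (\<lambda>x. \<Sum>j=1..m. a j * \<psi> j x)" using h by (auto simp: linear_span_def)
    have lin: "L2_inner d h g = (\<Sum>j=1..m. a j * L2_inner d (\<psi> j) g)" if "g \<in> L2_sphere d" for g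
      unfolding a using \<psi> that by (rule L2_inner_sum_left)
    have "L2_inner d h g = (\<Sum>j=1..m. a j * (\<Sum>k<r. L2_inner d (\<psi> j) (e k) * L2_inner d (e k) g))"
      using base[OF _ g] by (simp add: lin[OF g])
    also have "\<dots> = (\<Sum>k<r. (\<Sum>j=1..m. a j * L2_inner d (\<psi> j) (e k)) * L2_inner d (e k) g)"
      unfolding sum_distrib_left sum_distrib_right by (subst sum.swap) (simp add: mult.assoc)
    also have "\<dots> = (\<Sum>k<r. L2_inner d h (e k) * L2_inner d (e k) g)"
      using lin[OF eL2] by simp
    finally show ?thesis .
  qed
  then show ?thesis using that e on by blast
qed

section \<open>Total variation between laws with different drifts\<close>

lemma gauss_law_regression:
  "gauss_law {1..n} (\<lambda>i. f (x i)) (\<lambda>i j. if i = j then \<sigma>\<^sup>2 else 0) (snd (regression_experiment n x \<sigma>) f)"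
proof -
  have sum: "(\<Sum>l=1..n. (if i = l then \<sigma> else 0) * y l) = \<sigma> * y i" if "i \<in> {1..n}" for i and y :: "nat \<Rightarrow> real"
    using that by (simp add: if_distrib[of "\<lambda>a. a * _"] cong: if_cong)
  have "gauss_law {1..n} (\<lambda>i. f (x i)) (\<lambda>i j. \<Sum>l=1..n. (if i = l then \<sigma> else 0) * (if j = l then \<sigma> else 0))
    (distr (\<Pi>\<^sub>M l\<in>{1..n}. std_normal_distribution) (\<Pi>\<^sub>M i\<in>{1..n}. borel)
       (\<lambda>y. \<lambda>i\<in>{1..n}. f (x i) + (\<Sum>l=1..n. (if i = l then \<sigma> else 0) * y l)))"
    by (rule gauss_law_affine_std_normal) simp
  also have "(\<lambda>y. \<lambda>i\<in>{1..n}. f (x i) + (\<Sum>l=1..n. (if i = l then \<sigma> else 0) * y l)) =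
      (\<lambda>\<epsilon>. \<lambda>i\<in>{1..n}. f (x i) + \<sigma> * \<epsilon> i)"
    by (rule ext, rule restrict_ext) (simp only: sum)
  finally show ?thesis
    unfolding regression_experiment_def snd_conv
    by (rule gauss_law_cong) (simp_all only: sum, auto simp: power2_eq_square)
qed

lemma emp_norm_square: "(emp_norm n x f)\<^sup>2 * real n = (\<Sum>i=1..n. (f (x i))\<^sup>2)" if "1 \<le> n"
  using that by (simp add: emp_norm_def emp_inner_def sum_nonneg power2_eq_square)

lemma total_variation_regression:
  fixes x :: "nat \<Rightarrow> 'a"
  assumes n: "1 \<le> n" and \<sigma>: "0 < \<sigma>"
  defines "P \<equiv> snd (regression_experiment n x \<sigma>)"
  shows "total_variation (P f) (P h)
    \<le> ennreal (1 - 2 * Phi (ereal (- (sqrt (real n) / (2 * \<sigma>) * emp_norm n x (\<lambda>y. f y - h y)))))"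
proof -
  \<comment> \<open>\<open>s\<close> is the Euclidean distance between the vectors of values of
    \<open>f\<close> and \<open>h\<close> at the points \<open>x i\<close>.\<close>
  define s where "s = sqrt (real n) * emp_norm n x (\<lambda>y. f y - h y)"
  have s0: "0 \<le> s" by (simp add: s_def emp_norm_def emp_inner_def sum_nonneg)
  have s2: "s\<^sup>2 = (\<Sum>i=1..n. (f (x i) - h (x i))\<^sup>2)"
    using emp_norm_square[OF n, of x "\<lambda>y. f y - h y"]
      by (simp add: s_def power_mult_distrib mult.commute)
  note Pf = gauss_law_regression[of n f x \<sigma>, folded P_def]
  note Ph = gauss_law_regression[of n h x \<sigma>, folded P_def]
  show ?thesis
  proof (cases "s = 0")
    \<comment> \<open>Equal drift vectors leave no direction to normalize, but then the two laws
      coincide.\<close>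
    case True
    then have "f (x i) = h (x i)" if "i \<in> {1..n}" for i
      using s2 that by (simp add: sum_nonneg_eq_0_iff)
    then have "gauss_law {1..n} (\<lambda>i. f (x i)) (\<lambda>i j. if i = j then \<sigma>\<^sup>2 else 0) (P h)"
      by (intro gauss_law_cong[OF Ph]) auto
    then have "P f = P h" by (rule gauss_law_unique[OF Pf])
    moreover have "sets (P h) \<noteq> {}" by (metis empty_iff sets.top)
    ultimately show ?thesis by (simp add: total_variation_def)
  next
    case False
    then have s: "0 < s" using s0 by simp
    \<comment> \<open>The unit-variance functional projects the data onto the normalized drift
      difference and divides by \<open>\<sigma>\<close>. Applying the covariance gives
      \<open>c\<close>, and \<open>s / \<sigma> * c i\<close> equals
      \<open>h (x i) - f (x i)\<close>.\<close>
    define l where "l i = (h (x i) - f (x i)) / (s * \<sigma>)" for i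
    define c where "c i = \<sigma>\<^sup>2 * l i" for i
    have "total_variation (P f) (P h) \<le> ennreal (1 - 2 * Phi (ereal (- ((s / \<sigma>) / 2))))"
    proof (rule total_variation_gauss_law_shift[where Q="{1..n}" and \<iota>="\<lambda>i. i" and l=l and c=c, OF Pf])
      show "gauss_law {1..n} (\<lambda>i. f (x i) + s / \<sigma> * c i) (\<lambda>i j. if i = j then \<sigma>\<^sup>2 else 0) (P h)"
        by (rule gauss_law_cong[OF Ph]) (use s \<sigma> in \<open>auto simp: c_def l_def field_simps power2_eq_square\<close>)
      have "(\<Sum>i=1..n. l i * c i) = (\<Sum>i=1..n. (f (x i) - h (x i))\<^sup>2) / s\<^sup>2"
        unfolding sum_divide_distrib using s \<sigma>
        by (intro sum.cong refl) (simp add: l_def c_def power2_eq_square field_simps)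
      also have "\<dots> = 1" unfolding s2[symmetric] using s by simp
      finally show "(\<Sum>i=1..n. l i * c i) = 1" .
      show "c g = (\<Sum>q=1..n. l q * (if q = g then \<sigma>\<^sup>2 else 0))" if "g \<in> {1..n}" for g
        using that by (simp add: c_def if_distrib[of "\<lambda>a. _ * a"] cong: if_cong)
    qed (use s \<sigma> in auto)
    also have "(s / \<sigma>) / 2 = sqrt (real n) / (2 * \<sigma>) * emp_norm n x (\<lambda>y. f y - h y)"
      by (simp add: s_def)
    finally show ?thesis .
  qed
qed

lemma total_variation_white_noise:
  assumes f: "f \<in> L2_sphere d" and h: "h \<in> L2_sphere d" and \<tau>: "0 < \<tau>"
    and M: "gauss_law (L2_sphere d) (L2_inner d f) (\<lambda>g g'. \<tau>\<^sup>2 * L2_inner d g g') M"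
    and M': "gauss_law (L2_sphere d) (L2_inner d h) (\<lambda>g g'. \<tau>\<^sup>2 * L2_inner d g g') M'"
  shows "total_variation M M' \<le> ennreal (1 - 2 * Phi (ereal (- (L2_norm d (\<lambda>y. f y - h y) / (2 * \<tau>)))))"
proof -
  define w where "w = (\<lambda>y. f y - h y)"
  define s where "s = L2_norm d w"
  have w: "w \<in> L2_sphere d" unfolding w_def using f h by (rule L2_sphere_diff)
  have s0: "0 \<le> s" by (simp add: s_def L2_norm_def L2_inner_nonneg)
  have s2: "s * s = L2_inner d w w" by (simp add: s_def L2_norm_def L2_inner_nonneg)
  have diff: "L2_inner d w g = L2_inner d f g - L2_inner d h g" if "g \<in> L2_sphere d" for g
    unfolding w_def using f h that by (rule L2_inner_diff_left)
  show ?thesis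
  proof (cases "s = 0")
    case True
    then have "L2_inner d f g = L2_inner d h g" if "g \<in> L2_sphere d" for g
      using L2_inner_null[OF w that] diff[OF that] s2 by simp
    then have "gauss_law (L2_sphere d) (L2_inner d f) (\<lambda>g g'. \<tau>\<^sup>2 * L2_inner d g g') M'"
      by (intro gauss_law_cong[OF M']) auto
    then have "M = M'" by (rule gauss_law_unique[OF M])
    moreover have "sets M' \<noteq> {}" by (metis empty_iff sets.top)
    ultimately show ?thesis by (simp add: total_variation_def)
  next
    case False
    then have s: "0 < s" using s0 by simp
    \<comment> \<open>The sign turns \<open>w = f - h\<close> into the direction from
      \<open>f\<close> to \<open>h\<close>. As \<open>u\<close> is itself an index of the process,
      the unit-variance functional is the single coordinate \<open>u\<close> divided by
      \<open>\<tau>\<close>.\<close>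
    define u where "u = (\<lambda>y. (- inverse s) * w y)"
    have u: "u \<in> L2_sphere d" unfolding u_def using w by (rule L2_sphere_cmult)
    have ug: "L2_inner d u g = - inverse s * L2_inner d w g" for g
      unfolding u_def by (rule L2_inner_cmult_left)
    have "L2_inner d u u = - inverse s * (- inverse s * (s * s))"
      unfolding s2 ug L2_inner_commute[of d w u] ..
    also have "\<dots> = 1" using s by (simp add: field_simps)
    finally have uu: "L2_inner d u u = 1" .
    have "total_variation M M' \<le> ennreal (1 - 2 * Phi (ereal (- ((s / \<tau>) / 2))))"
    proof (rule total_variation_gauss_law_shift[where Q="{()}" and \<iota>="\<lambda>_. u" and l="\<lambda>_. 1 / \<tau>"
          and c="\<lambda>g. \<tau> * L2_inner d u g", OF M])
      show "gauss_law (L2_sphere d) (\<lambda>g. L2_inner d f g + s / \<tau> * (\<tau> * L2_inner d u g))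
          (\<lambda>g g'. \<tau>\<^sup>2 * L2_inner d g g') M'"
        by (rule gauss_law_cong[OF M']) (use s \<tau> in \<open>simp_all add: ug diff field_simps\<close>)
    qed (use s \<tau> u uu in \<open>auto simp: power2_eq_square L2_inner_commute\<close>)
    then show ?thesis by (simp add: s_def w_def mult.commute)
  qed
qed

text \<open>Passes from one parameter to the supremum. The arguments are compared in
  \<open>ereal\<close> because the supremum \<open>S\<close> may be infinite.\<close>

lemma Phi_bound_mono:
  assumes "ennreal s \<le> S" "0 \<le> s" "0 \<le> c"
  shows "ennreal (1 - 2 * Phi (ereal (- (c * s)))) \<le> ennreal (1 - 2 * Phi (- (ereal c * enn2ereal S)))"
proof -
  have "ereal s \<le> enn2ereal S"
    using assms(1,2) by (simp add: less_eq_ennreal.rep_eq enn2ereal_ennreal)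
  then have "ereal (c * s) \<le> ereal c * enn2ereal S"
    using assms(3) by (simp add: ereal_mult_left_mono flip: times_ereal.simps(1))
  then have "- (ereal c * enn2ereal S) \<le> ereal (- (c * s))"
    using ereal_minus_le_minus[of "ereal c * enn2ereal S" "ereal (c * s)"] by simp
  from Phi_mono[OF this] show ?thesis by (intro ennreal_leI) simp
qed

lemma Phi_bound_linear:
  assumes \<sigma>: "0 < \<sigma>" and n: "1 \<le> n"
  shows "ennreal (1 - 2 * Phi (- (ereal (sqrt (real n) / (2 * \<sigma>)) * enn2ereal S)))
    \<le> ennreal (inverse \<sigma> * sqrt (real n)) * S"
proof (cases S)
  case (real s)
  define c where "c = sqrt (real n) / (2 * \<sigma>)"
  have c: "0 \<le> c * s" using real \<sigma> by (simp add: c_def)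
  have "- (ereal c * enn2ereal S) = ereal (- (c * s))"
    using real by (simp add: enn2ereal_ennreal)
  then have "ennreal (1 - 2 * Phi (- (ereal c * enn2ereal S))) \<le> ennreal (c * s)"
    using Phi_bound[OF c] by (intro ennreal_leI) simp
  \<comment> \<open>\<open>c\<close> is half of the factor on the right: the spare factor 2 in the
    constant.\<close>
  also have "c * s \<le> (inverse \<sigma> * sqrt (real n)) * s"
    using \<sigma> real by (intro mult_right_mono) (auto simp: c_def field_simps)
  then have "ennreal (c * s) \<le> ennreal (inverse \<sigma> * sqrt (real n)) * S"
    using real \<sigma> by (simp add: ennreal_leI flip: ennreal_mult)
  finally show ?thesis by (simp add: c_def)
next
  case top
  \<comment> \<open>A nonzero factor makes the right side infinite.\<close>
  have "ennreal (inverse \<sigma> * sqrt (real n)) \<noteq> 0" using \<sigma> n by simp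
  then show ?thesis unfolding top by (simp add: ennreal_mult_top)
qed

section \<open>Equivalence of regression and white noise for drifts in the span\<close>

text \<open>\<open>H\<close> will be the span of the \<open>\<psi> j\<close>.
  \<open>H_expand\<close> sees functions only up to zero norm; the kernel towards regression needs
  actual values at the design points, which \<open>H_eval\<close> provides.\<close>

locale design_frame =
  fixes d n r :: nat and x :: "nat \<Rightarrow> nat \<Rightarrow> real" and e :: "nat \<Rightarrow> (nat \<Rightarrow> real) \<Rightarrow> real"
    and \<sigma> :: real and H :: "((nat \<Rightarrow> real) \<Rightarrow> real) set"
  assumes n: "1 \<le> n" and \<sigma>: "0 < \<sigma>"
    and e_L2: "\<And>k. k < r \<Longrightarrow> e k \<in> L2_sphere d"
    and e_on: "\<And>k l. k < r \<Longrightarrow> l < r \<Longrightarrow> L2_inner d (e k) (e l) = (if k = l then 1 else 0)"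
    and e_emp_on: "\<And>k l. k < r \<Longrightarrow> l < r \<Longrightarrow> emp_inner n x (e k) (e l) = (if k = l then 1 else 0)"
    and H_emp: "\<And>h k. h \<in> H \<Longrightarrow> k < r \<Longrightarrow> emp_inner n x (e k) h = L2_inner d h (e k)"
    and H_expand: "\<And>h g. h \<in> H \<Longrightarrow> g \<in> L2_sphere d \<Longrightarrow>
      L2_inner d h g = (\<Sum>k<r. L2_inner d h (e k) * L2_inner d (e k) g)"
    and H_eval: "\<And>h i. h \<in> H \<Longrightarrow> i \<in> {1..n} \<Longrightarrow> h (x i) = (\<Sum>k<r. L2_inner d h (e k) * e k (x i))"
begin

abbreviation "\<tau>2 \<equiv> (\<sigma> / sqrt (real n))\<^sup>2"

abbreviation "white_noise_gauss h \<equiv> gauss_law (L2_sphere d) (L2_inner d h) (\<lambda>g g'. \<tau>2 * L2_inner d g g')"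

abbreviation "regression_law \<equiv> snd (regression_experiment n x \<sigma>)"

lemma sum_e_on: "k < r \<Longrightarrow> (\<Sum>l<r. b l * L2_inner d (e k) (e l)) = b k"
  by (simp add: e_on if_distrib[of "\<lambda>a. _ * a"] cong: if_cong)

lemma sum_e_emp_on: "k < r \<Longrightarrow> (\<Sum>l<r. b l * emp_inner n x (e k) (e l)) = b k"
  by (simp add: e_emp_on if_distrib[of "\<lambda>a. _ * a"] cong: if_cong)

text \<open>The variance at which both sides meet: averaging \<open>n\<close> observations of
  variance \<open>\<sigma>\<^sup>2\<close> against an \<open>e k\<close> of empirical norm 1 gives
  the same value.\<close>

lemma \<tau>2: "\<tau>2 = \<sigma>\<^sup>2 / real n"
  using n by (simp add: power_divide)

text \<open>
  The empirical coefficients \<open>emp_inner n x (e k) z\<close> of the observations carry the drift exactly; the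
  components of the white noise orthogonal to the \<open>e k\<close> have mean zero and are resampled.
\<close>

lemma regression_to_white_noise:
  assumes h0: "h0 \<in> H" and M0: "white_noise_gauss h0 M0"
  obtains K where "K \<in> (\<Pi>\<^sub>M i\<in>{1..n}. borel) \<rightarrow>\<^sub>M prob_algebra (white_noise_space d)"
    "\<And>h. h \<in> H \<Longrightarrow> white_noise_gauss h (regression_law h \<bind> K)"
proof -
  let ?I = "L2_sphere d" and ?B = "\<Pi>\<^sub>M i\<in>{1..n}. (borel :: real measure)"
  \<comment> \<open>With these weights the sum of \<open>\<alpha> g i * z i\<close> over
    \<open>i\<close> is the sum over \<open>k\<close> of \<open>L2_inner d (e k) g\<close> times the
    empirical coefficient of \<open>z\<close> along \<open>e k\<close>: the projected white noise,
    tested against \<open>g\<close>, rebuilt from the data.\<close>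
  define \<alpha> where "\<alpha> g i = (\<Sum>k<r. e k (x i) * L2_inner d (e k) g) / real n" for g i
  define V where "V = (\<lambda>z::nat \<Rightarrow> real. \<lambda>g\<in>?I. 0 + (\<Sum>i=1..n. \<alpha> g i * z i))"
  \<comment> \<open>\<open>M0\<close> is a source of noise. Its drift lies in the span and cancels
    in the residual, so \<open>N\<close> has mean zero whatever \<open>h0\<close> is.\<close>
  define N where "N = distr M0 (\<Pi>\<^sub>M g\<in>?I. borel) (\<lambda>\<omega>. \<lambda>g\<in>?I. \<omega> g - (\<Sum>k<r. L2_inner d (e k) g * \<omega> (e k)))"
  define K where "K = (\<lambda>z. distr N (\<Pi>\<^sub>M g\<in>?I. borel) (\<lambda>\<omega>. \<lambda>g\<in>?I. V z g + \<omega> g))"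
  have N: "gauss_law ?I (\<lambda>g. 0) (\<lambda>g g'. \<tau>2 * L2_inner d g g' - \<tau>2 * (\<Sum>k<r. L2_inner d (e k) g * L2_inner d (e k) g')) N"
    unfolding N_def
  proof (rule gauss_law_cong[OF gauss_law_residual[OF M0]])
    fix g assume g: "g \<in> ?I"
    show "L2_inner d h0 g - (\<Sum>q<r. L2_inner d (e q) g * L2_inner d h0 (e q)) = 0"
      using H_expand[OF h0 g] by (simp add: mult.commute)
    fix g' assume g': "g' \<in> ?I"
    \<comment> \<open>Orthonormality of the \<open>e k\<close> reduces the double sum to its
      diagonal.\<close>
    have "(\<Sum>p<r. \<Sum>q<r. L2_inner d (e p) g * L2_inner d (e q) g' * (\<tau>2 * L2_inner d (e p) (e q))) =
        (\<Sum>p<r. \<Sum>q<r. (\<tau>2 * L2_inner d (e p) g * L2_inner d (e q) g') * L2_inner d (e p) (e q))"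
      by (intro sum.cong refl) (simp only: mult_ac)
    also have "\<dots> = (\<Sum>p<r. \<tau>2 * L2_inner d (e p) g * L2_inner d (e p) g')"
      by (intro sum.cong refl) (simp add: sum_e_on)
    finally have dbl: "(\<Sum>p<r. \<Sum>q<r. L2_inner d (e p) g * L2_inner d (e q) g' * (\<tau>2 * L2_inner d (e p) (e q))) =
        \<tau>2 * (\<Sum>k<r. L2_inner d (e k) g * L2_inner d (e k) g')"
      by (simp only: sum_distrib_left mult.assoc)
    have s1: "(\<Sum>q<r. L2_inner d (e q) g' * (\<tau>2 * L2_inner d g (e q))) =
        \<tau>2 * (\<Sum>k<r. L2_inner d (e k) g * L2_inner d (e k) g')"
      unfolding sum_distrib_left by (intro sum.cong refl) (simp only: mult_ac L2_inner_commute[of d g])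
    have s2: "(\<Sum>q<r. L2_inner d (e q) g * (\<tau>2 * L2_inner d (e q) g')) =
        \<tau>2 * (\<Sum>k<r. L2_inner d (e k) g * L2_inner d (e k) g')"
      unfolding sum_distrib_left by (intro sum.cong refl) (simp only: mult_ac)
    show "\<tau>2 * L2_inner d g g' - (\<Sum>q<r. L2_inner d (e q) g' * (\<tau>2 * L2_inner d g (e q))) -
        (\<Sum>q<r. L2_inner d (e q) g * (\<tau>2 * L2_inner d (e q) g')) +
        (\<Sum>p<r. \<Sum>q<r. L2_inner d (e p) g * L2_inner d (e q) g' * (\<tau>2 * L2_inner d (e p) (e q))) =
        \<tau>2 * L2_inner d g g' - \<tau>2 * (\<Sum>k<r. L2_inner d (e k) g * L2_inner d (e k) g')"
      unfolding dbl s1 s2 by simp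
  qed (use e_L2 in auto)
  \<comment> \<open>The part carrying the drift. Its covariance is exactly what \<open>N\<close>
    lacks, so adding the two restores white noise.\<close>
  have PV: "gauss_law ?I (L2_inner d h) (\<lambda>g g'. \<tau>2 * (\<Sum>k<r. L2_inner d (e k) g * L2_inner d (e k) g'))
      (distr (regression_law h) (\<Pi>\<^sub>M g\<in>?I. borel) V)" if h: "h \<in> H" for h
    unfolding V_def
  proof (rule gauss_law_cong[OF gauss_law_linear_image(2)[where \<iota>="\<lambda>g i. i", OF gauss_law_regression]])
    fix g assume g: "g \<in> ?I"
    have "(\<Sum>q=1..n. \<alpha> g q * h (x q)) = (\<Sum>k<r. L2_inner d (e k) g * emp_inner n x (e k) h)"
      unfolding \<alpha>_def emp_inner_def sum_distrib_left sum_distrib_right sum_divide_distrib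
      by (subst sum.swap) (simp add: mult_ac)
    also have "\<dots> = L2_inner d h g" using H_emp[OF h] H_expand[OF h g] by (simp add: mult.commute)
    finally show "0 + (\<Sum>q=1..n. \<alpha> g q * h (x q)) = L2_inner d h g" by simp
    fix g' assume g': "g' \<in> ?I"
    have "(\<Sum>p=1..n. \<Sum>q=1..n. \<alpha> g p * \<alpha> g' q * (if p = q then \<sigma>\<^sup>2 else 0)) =
        (\<Sum>p=1..n. \<alpha> g p * \<alpha> g' p * \<sigma>\<^sup>2)"
      by (simp add: if_distrib[of "\<lambda>a. _ * a"] cong: if_cong)
    also have "\<dots> = (\<Sum>p=1..n. \<Sum>k<r. \<Sum>l<r. \<tau>2 * (L2_inner d (e k) g * L2_inner d (e l) g' * (e k (x p) * e l (x p) / real n)))"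
    proof (rule sum.cong[OF refl])
      fix p
      have "\<alpha> g p * \<alpha> g' p * \<sigma>\<^sup>2 = (\<Sum>k<r. e k (x p) * L2_inner d (e k) g) *
          (\<Sum>l<r. e l (x p) * L2_inner d (e l) g') * (\<tau>2 / real n)"
        by (simp add: \<alpha>_def \<tau>2)
      also have "\<dots> = (\<Sum>k<r. \<Sum>l<r. \<tau>2 * (L2_inner d (e k) g * L2_inner d (e l) g' * (e k (x p) * e l (x p) / real n)))"
        unfolding sum_product unfolding sum_distrib_right by (intro sum.cong refl) (simp add: mult_ac)
      finally show "\<alpha> g p * \<alpha> g' p * \<sigma>\<^sup>2 =
          (\<Sum>k<r. \<Sum>l<r. \<tau>2 * (L2_inner d (e k) g * L2_inner d (e l) g' * (e k (x p) * e l (x p) / real n)))" .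
    qed
    also have "\<dots> = (\<Sum>k<r. \<Sum>l<r. \<Sum>p=1..n. \<tau>2 * (L2_inner d (e k) g * L2_inner d (e l) g' * (e k (x p) * e l (x p) / real n)))"
      by (subst sum.swap) (intro sum.cong refl sum.swap)
    also have "\<dots> = \<tau>2 * (\<Sum>k<r. L2_inner d (e k) g * (\<Sum>l<r. L2_inner d (e l) g' * emp_inner n x (e k) (e l)))"
      unfolding emp_inner_def by (simp only: sum_distrib_left sum_divide_distrib mult.assoc)
    also have "\<dots> = \<tau>2 * (\<Sum>k<r. L2_inner d (e k) g * L2_inner d (e k) g')"
      by (simp add: sum_e_emp_on)
    finally show "(\<Sum>p=1..n. \<Sum>q=1..n. \<alpha> g p * \<alpha> g' q * (if p = q then \<sigma>\<^sup>2 else 0)) =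
        \<tau>2 * (\<Sum>k<r. L2_inner d (e k) g * L2_inner d (e k) g')" .
  qed auto
  note reg = gauss_lawD(1,2)[OF gauss_law_regression]
  have V: "V \<in> ?B \<rightarrow>\<^sub>M (\<Pi>\<^sub>M g\<in>?I. borel)"
    unfolding V_def by (intro measurable_restrict borel_measurable_add borel_measurable_sum borel_measurable_times)
      (auto intro!: measurable_component_singleton)
  show ?thesis
  proof
    show "K \<in> ?B \<rightarrow>\<^sub>M prob_algebra (white_noise_space d)"
      unfolding K_def white_noise_space_def by (rule gauss_law_bind_add(1)[OF reg V PV[OF h0] N])
    show "white_noise_gauss h (regression_law h \<bind> K)" if "h \<in> H" for h
      unfolding K_def
      by (rule gauss_law_cong[OF gauss_law_bind_add(2)[OF reg V PV[OF that] N]]) simp_all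
  qed
qed

text \<open>The mirror construction: the coordinates along the \<open>e k\<close> yield fitted
  values at the design points, and independent noise supplies the residuals that a least-squares fit
  would leave.\<close>

lemma white_noise_to_regression:
  assumes h0: "h0 \<in> H" and M0: "white_noise_gauss h0 M0"
  obtains K where "K \<in> white_noise_space d \<rightarrow>\<^sub>M prob_algebra (\<Pi>\<^sub>M i\<in>{1..n}. borel)"
    "\<And>h M. h \<in> H \<Longrightarrow> white_noise_gauss h M \<Longrightarrow> M \<bind> K = regression_law h"
proof -
  let ?I = "{1..n}" and ?S = "\<Pi>\<^sub>M g\<in>L2_sphere d. (borel :: real measure)"
  \<comment> \<open>The matrix of the orthogonal projection onto the vectors of values of the
    \<open>e k\<close> at the design points.\<close>
  define \<pi> where "\<pi> i j = (\<Sum>k<r. e k (x i) * e k (x j)) / real n" for i j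
  define V where "V = (\<lambda>z::((nat \<Rightarrow> real) \<Rightarrow> real) \<Rightarrow> real. \<lambda>i\<in>?I. 0 + (\<Sum>k<r. e k (x i) * z (e k)))"
  \<comment> \<open>The residuals are drawn from pure observation noise, that is, regression with
    drift zero.\<close>
  define N where "N = distr (regression_law (\<lambda>_. 0)) (\<Pi>\<^sub>M i\<in>?I. borel) (\<lambda>\<omega>. \<lambda>i\<in>?I. \<omega> i - (\<Sum>j\<in>{1..n}. \<pi> i j * \<omega> j))"
  define K where "K = (\<lambda>z. distr N (\<Pi>\<^sub>M i\<in>?I. borel) (\<lambda>\<omega>. \<lambda>i\<in>?I. V z i + \<omega> i))"
  \<comment> \<open>Being symmetric and idempotent, \<open>\<pi>\<close> leaves a residual
    covariance equal to \<open>\<sigma>\<^sup>2\<close> times the complementary projection.\<close>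
  have \<pi>_idem: "(\<Sum>q=1..n. \<pi> i q * \<pi> j q) = \<pi> i j" for i j
  proof -
    have "(\<Sum>q=1..n. \<pi> i q * \<pi> j q) =
        (\<Sum>q=1..n. \<Sum>k<r. \<Sum>l<r. e k (x i) * (e l (x j) * (e k (x q) * e l (x q) / real n)) / real n)"
    proof (rule sum.cong[OF refl])
      fix q
      have "\<pi> i q * \<pi> j q = (\<Sum>k<r. e k (x i) * e k (x q)) * (\<Sum>l<r. e l (x j) * e l (x q)) * (1 / (real n * real n))"
        by (simp add: \<pi>_def)
      also have "\<dots> = (\<Sum>k<r. \<Sum>l<r. e k (x i) * (e l (x j) * (e k (x q) * e l (x q) / real n)) / real n)"
        unfolding sum_product unfolding sum_distrib_right by (intro sum.cong refl) (simp add: mult_ac)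
      finally show "\<pi> i q * \<pi> j q =
          (\<Sum>k<r. \<Sum>l<r. e k (x i) * (e l (x j) * (e k (x q) * e l (x q) / real n)) / real n)" .
    qed
    also have "\<dots> = (\<Sum>k<r. \<Sum>l<r. \<Sum>q=1..n. e k (x i) * (e l (x j) * (e k (x q) * e l (x q) / real n)) / real n)"
      by (subst sum.swap) (intro sum.cong refl sum.swap)
    also have "\<dots> = (\<Sum>k<r. e k (x i) * (\<Sum>l<r. e l (x j) * emp_inner n x (e k) (e l))) / real n"
      unfolding emp_inner_def by (simp only: sum_distrib_left sum_divide_distrib)
    also have "\<dots> = \<pi> i j" by (simp add: sum_e_emp_on \<pi>_def)
    finally show ?thesis .
  qed
  have \<pi>_sym: "\<pi> i j = \<pi> j i" for i j by (simp add: \<pi>_def mult.commute)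
  have N: "gauss_law ?I (\<lambda>i. 0) (\<lambda>i j. (if i = j then \<sigma>\<^sup>2 else 0) - \<sigma>\<^sup>2 * \<pi> i j) N"
    unfolding N_def
  proof (rule gauss_law_cong[OF gauss_law_residual[where \<iota>="\<lambda>i. i", OF gauss_law_regression]])
    fix i j assume ij: "i \<in> ?I" "j \<in> ?I"
    have *: "(\<Sum>q=1..n. f q * (if p = q then \<sigma>\<^sup>2 else 0)) = f p * \<sigma>\<^sup>2"
      "(\<Sum>q=1..n. f q * (if q = p then \<sigma>\<^sup>2 else 0)) = f p * \<sigma>\<^sup>2" if "p \<in> ?I" for f :: "nat \<Rightarrow> real" and p
      using that by (simp_all add: if_distrib[of "\<lambda>a. _ * a"] cong: if_cong)
    have "(\<Sum>p=1..n. \<Sum>q=1..n. \<pi> i p * \<pi> j q * (if p = q then \<sigma>\<^sup>2 else 0)) =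
        (\<Sum>p=1..n. \<pi> i p * \<pi> j p * \<sigma>\<^sup>2)"
      by (intro sum.cong refl *)
    also have "\<dots> = \<sigma>\<^sup>2 * \<pi> i j" unfolding sum_distrib_right[symmetric] \<pi>_idem by (rule mult.commute)
    finally show "(if i = j then \<sigma>\<^sup>2 else 0) - (\<Sum>q=1..n. \<pi> j q * (if i = q then \<sigma>\<^sup>2 else 0)) -
        (\<Sum>q=1..n. \<pi> i q * (if q = j then \<sigma>\<^sup>2 else 0)) +
        (\<Sum>p=1..n. \<Sum>q=1..n. \<pi> i p * \<pi> j q * (if p = q then \<sigma>\<^sup>2 else 0)) =
        (if i = j then \<sigma>\<^sup>2 else 0) - \<sigma>\<^sup>2 * \<pi> i j"
      unfolding *(1)[OF ij(1)] *(2)[OF ij(2)] using \<pi>_sym[of i j] by simp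
  qed auto
  have PV: "gauss_law ?I (\<lambda>i. h (x i)) (\<lambda>i j. \<sigma>\<^sup>2 * \<pi> i j) (distr M (\<Pi>\<^sub>M i\<in>?I. borel) V)"
    if h: "h \<in> H" and M: "white_noise_gauss h M" for h M
    unfolding V_def
  proof (rule gauss_law_cong[OF gauss_law_linear_image(2)[where \<iota>="\<lambda>i k. e k", OF M]])
    fix i assume i: "i \<in> ?I"
    show "0 + (\<Sum>k<r. e k (x i) * L2_inner d h (e k)) = h (x i)"
      using H_eval[OF h i] by (simp add: mult.commute)
    fix j assume "j \<in> ?I"
    have "(\<Sum>p<r. \<Sum>q<r. e p (x i) * e q (x j) * (\<tau>2 * L2_inner d (e p) (e q))) =
        (\<Sum>p<r. \<Sum>q<r. (\<tau>2 * (e p (x i) * e q (x j))) * L2_inner d (e p) (e q))"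
      by (intro sum.cong refl) (simp only: mult_ac)
    also have "\<dots> = (\<Sum>p<r. \<tau>2 * (e p (x i) * e p (x j)))"
      by (intro sum.cong refl) (simp add: sum_e_on)
    also have "\<dots> = \<sigma>\<^sup>2 * \<pi> i j" unfolding \<tau>2 \<pi>_def by (simp add: sum_distrib_left sum_divide_distrib)
    finally show "(\<Sum>p<r. \<Sum>q<r. e p (x i) * e q (x j) * (\<tau>2 * L2_inner d (e p) (e q))) = \<sigma>\<^sup>2 * \<pi> i j" .
  qed (use e_L2 in auto)
  have V: "V \<in> ?S \<rightarrow>\<^sub>M (\<Pi>\<^sub>M i\<in>?I. borel)"
    unfolding V_def using e_L2
    by (intro measurable_restrict borel_measurable_add borel_measurable_sum borel_measurable_times)
      (auto intro!: measurable_component_singleton)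
  show ?thesis
  proof
    show "K \<in> white_noise_space d \<rightarrow>\<^sub>M prob_algebra (\<Pi>\<^sub>M i\<in>?I. borel)"
      unfolding K_def white_noise_space_def
      by (rule gauss_law_bind_add(1)[OF gauss_lawD(1,2)[OF M0] V PV[OF h0 M0] N])
    show "M \<bind> K = regression_law h" if h: "h \<in> H" and M: "white_noise_gauss h M" for h M
    proof (rule gauss_law_unique[OF _ gauss_law_regression])
      show "gauss_law ?I (\<lambda>i. h (x i)) (\<lambda>i j. if i = j then \<sigma>\<^sup>2 else 0) (M \<bind> K)"
        unfolding K_def
        by (rule gauss_law_cong[OF gauss_law_bind_add(2)[OF gauss_lawD(1,2)[OF M] V PV[OF h M] N]]) simp_all
    qed
  qed
qed

end

text \<open>On the span both inner products coincide by the design, so one orthonormal system serves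
  both. The pointwise expansion takes a further argument.\<close>

lemma design_frame_of_spherical_design:
  assumes n: "1 \<le> n" and \<sigma>: "0 < \<sigma>"
    and \<psi>_L2: "\<forall>j\<in>{1..m}. \<psi> j \<in> L2_sphere d"
    and span: "linear_span m \<psi> \<subseteq> sphere_polynomials d L"
    and design: "spherical_design d t n x" and t: "2 * L \<le> t"
  obtains r e where "design_frame d n r x e \<sigma> (linear_span m \<psi>)"
proof -
  obtain r :: nat and e where e: "\<And>k. k < r \<Longrightarrow> e k \<in> linear_span m \<psi>"
    and on: "\<And>k l. k < r \<Longrightarrow> l < r \<Longrightarrow> L2_inner d (e k) (e l) = (if k = l then 1 else 0)"
    and expand: "\<And>h g. h \<in> linear_span m \<psi> \<Longrightarrow> g \<in> L2_sphere d \<Longrightarrow>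
       L2_inner d h g = (\<Sum>k<r. L2_inner d h (e k) * L2_inner d (e k) g)"
    using L2_orthonormal_expansion[OF \<psi>_L2] by blast
  have \<psi>: "\<psi> j \<in> L2_sphere d" if "j \<in> {1..m}" for j using \<psi>_L2 that by blast
  have eL2: "e k \<in> L2_sphere d" if "k < r" for k
    using \<psi> e[OF that] by (rule linear_span_L2_sphere)
  have emp: "emp_inner n x f g = L2_inner d f g" if "f \<in> linear_span m \<psi>" "g \<in> linear_span m \<psi>" for f g
    using that span by (intro spherical_design_emp_inner[OF design t]) auto
  have eval: "h (x i) = (\<Sum>k<r. L2_inner d h (e k) * e k (x i))"
    if h: "h \<in> linear_span m \<psi>" and i: "i \<in> {1..n}" for h i
  proof -
    \<comment> \<open>The residual stays in the span and has zero L2 norm, hence zero empirical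
      norm, which is a sum of squares over the design points.\<close>
    define \<rho> where "\<rho> = (\<lambda>y. h y - (\<Sum>k<r. L2_inner d h (e k) * e k y))"
    have "(\<lambda>y. h y + (- 1) * (\<Sum>k<r. L2_inner d h (e k) * e k y)) \<in> linear_span m \<psi>"
      using h e by (intro linear_span_add linear_span_cmult linear_span_sum) auto
    then have \<rho>: "\<rho> \<in> linear_span m \<psi>" by (simp add: \<rho>_def)
    have hL2: "h \<in> L2_sphere d" and \<rho>L2: "\<rho> \<in> L2_sphere d"
      using linear_span_L2_sphere[OF \<psi>] h \<rho> by auto
    have "L2_inner d \<rho> \<rho> = L2_inner d h \<rho> - (\<Sum>k<r. L2_inner d h (e k) * L2_inner d (e k) \<rho>)"
      by (subst (1) \<rho>_def) (rule L2_inner_residual[OF hL2 eL2 \<rho>L2])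
    also have "\<dots> = 0" using expand[OF h \<rho>L2] by simp
    finally have "emp_inner n x \<rho> \<rho> = 0" using emp[OF \<rho> \<rho>] by simp
    then have "(\<Sum>i=1..n. \<rho> (x i) * \<rho> (x i)) = 0" using n by (simp add: emp_inner_def)
    then have "\<rho> (x i) * \<rho> (x i) = 0" using i by (subst (asm) sum_nonneg_eq_0_iff) auto
    then show ?thesis by (simp add: \<rho>_def)
  qed
  have "design_frame d n r x e \<sigma> (linear_span m \<psi>)"
  proof
    show "emp_inner n x (e k) (e l) = (if k = l then 1 else 0)" if "k < r" "l < r" for k l
      using emp[OF e e] on that by simp
    show "emp_inner n x (e k) h = L2_inner d h (e k)" if "h \<in> linear_span m \<psi>" "k < r" for h k
      using emp[OF e that(1)] that by (simp add: L2_inner_commute)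
  qed (fact n \<sigma> eL2 on expand eval)+
  then show ?thesis by (rule that)
qed

section \<open>Deficiency bounds and the final estimate\<close>

lemma deficiency_leI:
  assumes "K \<in> fst E \<rightarrow>\<^sub>M prob_algebra (fst E')"
    "\<And>\<theta>. \<theta> \<in> \<Theta> \<Longrightarrow> total_variation (snd E \<theta> \<bind> K) (snd E' \<theta>) \<le> b"
  shows "deficiency \<Theta> E E' \<le> b"
  unfolding deficiency_def using assms by (intro INF_lower2[of K] SUP_least)

text \<open>An empty parameter space offers no white noise law from which to build the kernels. Any
  kernel will do then, and a constant one exists once the target space has a point.\<close>

lemma deficiency_empty:
  assumes "space (fst E') \<noteq> {}"
  shows "deficiency {} E E' = 0"
proof -
  obtain y where "y \<in> space (fst E')" using assms by blast
  then have "(\<lambda>_. return (fst E') y) \<in> fst E \<rightarrow>\<^sub>M prob_algebra (fst E')"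
    by (intro measurable_const) (simp add: space_prob_algebra prob_space_return)
  then have "deficiency {} E E' \<le> 0" by (rule deficiency_leI) simp
  then show ?thesis by simp
qed

lemma white_noise_experiment_gauss_law:
  assumes "white_noise_experiment d \<tau> \<Theta> D E" "\<theta> \<in> \<Theta>"
  shows "gauss_law (L2_sphere d) (L2_inner d (D \<theta>)) (\<lambda>g g'. \<tau>\<^sup>2 * L2_inner d g g') (snd E \<theta>)"
  using assms by (auto simp: white_noise_experiment_def white_noise_law_def intro: gaussian_process_imp_gauss_law)

lemma emp_approx_in_linear_span: "emp_approx n x m \<psi> f \<in> linear_span m \<psi>"
  unfolding emp_approx_def linear_span_def mem_Collect_eq
  by (intro exI[of _ "\<lambda>j. emp_inner n x f (\<psi> j)"] conjI refl TrueI)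

theorem theorem3p1:
  "\<exists>C::real. C > 0 \<and>
    (\<forall>(d::nat) (n::nat) (m::nat) (L::nat) (t::nat) (\<sigma>::real)
       (\<Theta> :: ((nat \<Rightarrow> real) \<Rightarrow> real) set)
       (\<psi> :: nat \<Rightarrow> (nat \<Rightarrow> real) \<Rightarrow> real)
       (x :: nat \<Rightarrow> nat \<Rightarrow> real) F G Gt.
      1 \<le> d \<longrightarrow> 1 \<le> n \<longrightarrow> 1 \<le> m \<longrightarrow> 0 < \<sigma> \<longrightarrow>
      \<Theta> \<subseteq> L2_sphere d \<longrightarrow>
      (\<forall>j\<in>{1..m}. \<psi> j \<in> L2_sphere d) \<longrightarrow>
      linear_span m \<psi> \<subseteq> sphere_polynomials d L \<longrightarrow>
      spherical_design d t n x \<longrightarrow> 2 * L \<le> t \<longrightarrow>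
      F = regression_experiment n x \<sigma> \<longrightarrow>
      white_noise_experiment d (\<sigma> / sqrt (real n)) \<Theta> (\<lambda>f. f) G \<longrightarrow>
      white_noise_experiment d (\<sigma> / sqrt (real n)) \<Theta> (\<lambda>f. emp_approx n x m \<psi> f) Gt \<longrightarrow>
      (let S1 = (SUP f\<in>\<Theta>. ennreal (emp_norm n x (\<lambda>y. f y - emp_approx n x m \<psi> f y)));
           S2 = (SUP f\<in>\<Theta>. ennreal (L2_norm d (\<lambda>y. f y - emp_approx n x m \<psi> f y)));
           B1 = ennreal (1 - 2 * Phi (- (ereal (sqrt (real n) / (2 * \<sigma>)) * enn2ereal S1)));
           B2 = ennreal (1 - 2 * Phi (- (ereal (sqrt (real n) / (2 * \<sigma>)) * enn2ereal S2)))
       in le_cam \<Theta> F G \<le> le_cam \<Theta> F Gt + le_cam \<Theta> Gt G \<and>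
          le_cam \<Theta> F Gt \<le> B1 \<and>
          B1 \<le> ennreal (C * inverse \<sigma> * sqrt (real n)) * S1 \<and>
          le_cam \<Theta> Gt G \<le> B2 \<and>
          B2 \<le> ennreal (C * inverse \<sigma> * sqrt (real n)) * S2))"
proof (intro exI[of _ "1::real"] conjI allI impI zero_less_one)
  fix d n m L t :: nat and \<sigma> :: real and \<Theta> :: "((nat \<Rightarrow> real) \<Rightarrow> real) set"
    and \<psi> :: "nat \<Rightarrow> (nat \<Rightarrow> real) \<Rightarrow> real" and x :: "nat \<Rightarrow> nat \<Rightarrow> real" and F G Gt
  assume n: "1 \<le> n" and \<sigma>: "0 < \<sigma>" and \<Theta>: "\<Theta> \<subseteq> L2_sphere d"
    and \<psi>: "\<forall>j\<in>{1..m}. \<psi> j \<in> L2_sphere d" and span: "linear_span m \<psi> \<subseteq> sphere_polynomials d L"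
    and design: "spherical_design d t n x" and t: "2 * L \<le> t"
    and F: "F = regression_experiment n x \<sigma>"
    and G: "white_noise_experiment d (\<sigma> / sqrt (real n)) \<Theta> (\<lambda>f. f) G"
    and Gt: "white_noise_experiment d (\<sigma> / sqrt (real n)) \<Theta> (\<lambda>f. emp_approx n x m \<psi> f) Gt"
  define a where "a = emp_approx n x m \<psi>"
  define c where "c = sqrt (real n) / (2 * \<sigma>)"
  define S1 where "S1 = (SUP f\<in>\<Theta>. ennreal (emp_norm n x (\<lambda>y. f y - a f y)))"
  define S2 where "S2 = (SUP f\<in>\<Theta>. ennreal (L2_norm d (\<lambda>y. f y - a f y)))"
  define B where "B S = ennreal (1 - 2 * Phi (- (ereal c * enn2ereal S)))" for S
  have c: "0 \<le> c" using \<sigma> by (simp add: c_def)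
  have \<tau>: "0 < \<sigma> / sqrt (real n)" using n \<sigma> by simp
  have fst_F: "fst F = (\<Pi>\<^sub>M i\<in>{1..n}. borel)" by (simp add: F regression_experiment_def)
  have fst_G: "fst G = white_noise_space d" "fst Gt = white_noise_space d"
    using G Gt by (auto simp: white_noise_experiment_def)
  note lF = gauss_law_regression[of n _ x \<sigma>, folded F]
  note lG = white_noise_experiment_gauss_law[OF G]
  note lGt = white_noise_experiment_gauss_law[OF Gt, folded a_def]
  have F_prob: "snd F f \<in> space (prob_algebra (fst F))" for f
    using gauss_lawD(1,2)[OF lF] by (simp add: space_prob_algebra fst_F)
  have G_prob: "snd G f \<in> space (prob_algebra (fst G))" if "f \<in> \<Theta>" for f
    using gauss_lawD(1,2)[OF lG[OF that]] by (simp add: space_prob_algebra fst_G white_noise_space_def)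
  have Gt_prob: "snd Gt f \<in> space (prob_algebra (fst Gt))" if "f \<in> \<Theta>" for f
    using gauss_lawD(1,2)[OF lGt[OF that]] by (simp add: space_prob_algebra fst_G white_noise_space_def)
  have a_span: "a f \<in> linear_span m \<psi>" for f
    unfolding a_def by (rule emp_approx_in_linear_span)
  have a_L2: "a f \<in> L2_sphere d" for f
    using \<psi> by (intro linear_span_L2_sphere[OF _ a_span]) auto
  \<comment> \<open>Regression with drift \<open>a f\<close> is the intermediate law. It is
    equivalent to \<open>Gt\<close>, so this change of drift is the whole cost of the first
    comparison.\<close>
  have tv_F: "total_variation (snd F f) (snd F (a f)) \<le> B S1" if f: "f \<in> \<Theta>" for f
  proof -
    have "total_variation (snd F f) (snd F (a f)) \<le>
        ennreal (1 - 2 * Phi (ereal (- (c * emp_norm n x (\<lambda>y. f y - a f y)))))"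
      unfolding F c_def by (rule total_variation_regression[OF n \<sigma>])
    also have "\<dots> \<le> B S1"
      unfolding B_def using c f
      by (intro Phi_bound_mono) (auto simp: S1_def emp_norm_def emp_inner_def intro!: SUP_upper sum_nonneg divide_nonneg_nonneg)
    finally show ?thesis .
  qed
  have tv_G: "total_variation (snd G f) (snd Gt f) \<le> B S2" if f: "f \<in> \<Theta>" for f
  proof -
    have "total_variation (snd G f) (snd Gt f) \<le>
        ennreal (1 - 2 * Phi (ereal (- (L2_norm d (\<lambda>y. f y - a f y) / (2 * (\<sigma> / sqrt (real n)))))))"
      using \<Theta> f by (intro total_variation_white_noise[OF _ a_L2 \<tau> lG[OF f] lGt[OF f]]) auto
    also have "L2_norm d (\<lambda>y. f y - a f y) / (2 * (\<sigma> / sqrt (real n))) = c * L2_norm d (\<lambda>y. f y - a f y)"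
      by (simp add: c_def)
    also have "ennreal (1 - 2 * Phi (ereal (- (c * L2_norm d (\<lambda>y. f y - a f y))))) \<le> B S2"
      unfolding B_def using c f
      by (intro Phi_bound_mono) (auto simp: S2_def L2_norm_def L2_inner_nonneg intro!: SUP_upper)
    finally show ?thesis .
  qed
  have le1: "le_cam \<Theta> F Gt \<le> B S1"
  proof (cases "\<Theta> = {}")
    case True
    have "space (fst F) \<noteq> {}" "space (fst Gt) \<noteq> {}"
      by (auto simp: fst_F fst_G white_noise_space_def space_PiM PiE_eq_empty_iff)
    then show ?thesis unfolding True le_cam_def by (simp add: deficiency_empty)
  next
    case False
    \<comment> \<open>Any parameter supplies the white noise law from which the kernels are built;
      they do not depend on the parameter they are applied to.\<close>
    then obtain f0 where f0: "f0 \<in> \<Theta>" by blast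
    obtain r e where "design_frame d n r x e \<sigma> (linear_span m \<psi>)"
      using design_frame_of_spherical_design[OF n \<sigma> \<psi> span design t] by blast
    then interpret design_frame d n r x e \<sigma> "linear_span m \<psi>" .
    obtain K where "K \<in> (\<Pi>\<^sub>M i\<in>{1..n}. borel) \<rightarrow>\<^sub>M prob_algebra (white_noise_space d)"
      and K_law: "\<And>h. h \<in> linear_span m \<psi> \<Longrightarrow> white_noise_gauss h (regression_law h \<bind> K)"
      using regression_to_white_noise[OF a_span[of f0] lGt[OF f0]] by blast
    then have K: "K \<in> fst F \<rightarrow>\<^sub>M prob_algebra (fst Gt)" by (simp only: fst_F fst_G)
    obtain K' where "K' \<in> white_noise_space d \<rightarrow>\<^sub>M prob_algebra (\<Pi>\<^sub>M i\<in>{1..n}. borel)"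
      and K'_law: "\<And>h M. h \<in> linear_span m \<psi> \<Longrightarrow> white_noise_gauss h M \<Longrightarrow> M \<bind> K' = regression_law h"
      using white_noise_to_regression[OF a_span[of f0] lGt[OF f0]] by blast
    then have K': "K' \<in> fst Gt \<rightarrow>\<^sub>M prob_algebra (fst F)" by (simp only: fst_F fst_G)
    have "deficiency \<Theta> F Gt \<le> B S1"
    proof (rule deficiency_leI[OF K])
      fix f assume f: "f \<in> \<Theta>"
      \<comment> \<open>\<open>Gt\<close> is an exact randomization of regression with drift
        \<open>a f\<close>, so applying \<open>K\<close> to regression with drift \<open>f\<close>
        can only shrink the distance in \<open>tv_F\<close>.\<close>
      have "snd Gt f = snd F (a f) \<bind> K"
        unfolding F by (rule gauss_law_unique[OF lGt[OF f] K_law[OF a_span]])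
      then have "total_variation (snd F f \<bind> K) (snd Gt f) \<le> total_variation (snd F f) (snd F (a f))"
        using total_variation_bind_le[OF F_prob F_prob K] by simp
      also have "\<dots> \<le> B S1" by (rule tv_F[OF f])
      finally show "total_variation (snd F f \<bind> K) (snd Gt f) \<le> B S1" .
    qed
    moreover have "deficiency \<Theta> Gt F \<le> B S1"
    proof (rule deficiency_leI[OF K'])
      fix f assume f: "f \<in> \<Theta>"
      have "snd Gt f \<bind> K' = snd F (a f)" unfolding F by (rule K'_law[OF a_span lGt[OF f]])
      moreover have "sets (snd F (a f)) = sets (snd F f)"
        using gauss_lawD(2)[OF lF] by simp
      ultimately show "total_variation (snd Gt f \<bind> K') (snd F f) \<le> B S1"
        using tv_F[OF f] total_variation_commute by metis
    qed
    ultimately show ?thesis by (simp add: le_cam_def)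
  qed
  have le2: "le_cam \<Theta> Gt G \<le> B S2"
  proof -
    \<comment> \<open>Both experiments live on one sample space, so the identity kernel suffices in
      either direction.\<close>
    have K: "return (white_noise_space d) \<in> white_noise_space d \<rightarrow>\<^sub>M prob_algebra (white_noise_space d)"
      by (rule measurable_return_prob_space)
    have sets: "sets (snd G f) = sets (white_noise_space d)" "sets (snd Gt f) =
        sets (white_noise_space d)"
      if "f \<in> \<Theta>" for f
      using gauss_lawD(2)[OF lG[OF that]] gauss_lawD(2)[OF lGt[OF that]]
        by (simp_all add: white_noise_space_def)
    have "deficiency \<Theta> G Gt \<le> B S2"
      by (rule deficiency_leI[where K="return (white_noise_space d)"])
        (use tv_G sets K in \<open>auto simp: fst_G bind_return''\<close>)
    moreover have "deficiency \<Theta> Gt G \<le> B S2"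
    proof (rule deficiency_leI[where K="return (white_noise_space d)"])
      fix f assume f: "f \<in> \<Theta>"
      show "total_variation (snd Gt f \<bind> return (white_noise_space d)) (snd G f) \<le> B S2"
        using tv_G[OF f] sets[OF f] total_variation_commute[of "snd G f" "snd Gt f"]
        by (simp add: bind_return'')
    qed (use K in \<open>simp add: fst_G\<close>)
    ultimately show ?thesis by (simp add: le_cam_def)
  qed
  have tri: "le_cam \<Theta> F G \<le> le_cam \<Theta> F Gt + le_cam \<Theta> Gt G"
    by (rule le_cam_triangle[OF F_prob Gt_prob G_prob])
  have lin: "B S \<le> ennreal (1 * inverse \<sigma> * sqrt (real n)) * S" for S
    unfolding B_def c_def mult_1 by (rule Phi_bound_linear[OF \<sigma> n])
  show "let S1 = (SUP f\<in>\<Theta>. ennreal (emp_norm n x (\<lambda>y. f y - emp_approx n x m \<psi> f y)));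
           S2 = (SUP f\<in>\<Theta>. ennreal (L2_norm d (\<lambda>y. f y - emp_approx n x m \<psi> f y)));
           B1 = ennreal (1 - 2 * Phi (- (ereal (sqrt (real n) / (2 * \<sigma>)) * enn2ereal S1)));
           B2 = ennreal (1 - 2 * Phi (- (ereal (sqrt (real n) / (2 * \<sigma>)) * enn2ereal S2)))
       in le_cam \<Theta> F G \<le> le_cam \<Theta> F Gt + le_cam \<Theta> Gt G \<and>
          le_cam \<Theta> F Gt \<le> B1 \<and>
          B1 \<le> ennreal (1 * inverse \<sigma> * sqrt (real n)) * S1 \<and>
          le_cam \<Theta> Gt G \<le> B2 \<and>
          B2 \<le> ennreal (1 * inverse \<sigma> * sqrt (real n)) * S2"
    unfolding Let_def a_def[symmetric] c_def[symmetric] S1_def[symmetric] S2_def[symmetric] B_def[symmetric]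
    using tri le1 le2 lin by blast
qed

end
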